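(* Let $X$ be a scheme and let $\mathrm{cl}$ be a glueable preclosure operation on submodules over $X$. Let $\mathcal{M}$ be a quasi-coherent $\mathcal{O}_X$-module and $\mathcal{L}$ a quasi-coherent $\mathcal{O}_X$-submodule of $\mathcal{M}$. Then: (1) For every open set $U\subseteq X$ and every $s\in\mathcal{M}(U)$, we have $s\in\mathcal{L}^{\mathrm{cl}}_{\mathcal{M}}(U)$ if and only if $s|_V\in\mathcal{L}(V)^{\mathrm{cl}}_{\mathcal{M}(V)}$ for all affine open subsets $V$ of $U$. (2) For every affine open subset $V$ of $X$, $\mathcal{L}^{\mathrm{cl}}_{\mathcal{M}}(V)=\mathcal{L}(V)^{\mathrm{cl}}_{\mathcal{M}(V)}$. (3) $\mathcal{L}^{\mathrm{cl}}_{\mathcal{M}}$ is unique with respect to this property: if $\mathcal{F}$ is a subsheaf of $\mathcal{M}$ such that $\mathcal{F}(V)=\mathcal{L}(V)^{\mathrm{cl}}_{\mathcal{M}(V)}$ for all affine open subsets $V$ of $X$, then $\mathcal{F}=\mathcal{L}^{\mathrm{cl}}_{\mathcal{M}}$.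
   Context: All rings are commutative with $1$. A preclosure operation on a poset is an extensive ($s\le s^{\mathrm{cl}}$) and order-preserving self-map. A preclosure operation $\mathrm{cl}$ on (sub)modules over a scheme $X$ gives, for every affine open $U\subseteq X$ and every module $M$ over $S=\mathcal{O}_X(U)$, a preclosure operation $L\mapsto L^{\mathrm{cl}}_M$ on the $S$-submodules of $M$. Canonically isomorphic modules are identified, so the operation is understood to be compatible with module isomorphisms. Openly persistent over $X$: for all affine opens $V\subseteq U\subseteq X$, with $R=\mathcal{O}_X(U)$, $S=\mathcal{O}_X(V)$, all $R$-modules $L\subseteq M$ and all $x\in L^{\mathrm{cl}}_M$, we have $x\otimes1\in(LS)^{\mathrm{cl}}_{M\otimes_RS}$, where $LS$ is the image of $L\otimes_RS\to M\otimes_RS$. Glueable over $X$: $\mathrm{cl}$ is openly persistent over $X$ and for every affine open $\operatorname{Spec}R\subseteq X$: whenever $I$ is an ideal of $R$ with generating set $(f_\alpha)_{\alpha\in A}$, $g\in\sqrt I$, $L\subseteq M$ are $R$-modules, and $z\in M$ satisfies $z/1\in(L_{f_\alpha})^{\mathrm{cl}}_{M_{f_\alpha}}$ for all $\alpha\in A$, it follows that $z/1\in(L_g)^{\mathrm{cl}}_{M_g}$. Sheaf $\mathcal{L}^{\mathrm{cl}}_{\mathcal{M}}$: for $U\subseteq X$ open, $\mathcal{L}^{\mathrm{cl}}_{\mathcal{M}}(U)$ is the set of $s\in\mathcal{M}(U)$ such that every $x\in U$ has an affine open neighborhood $V\subseteq U$ with $s|_V\in\mathcal{L}(V)^{\mathrm{cl}}_{\mathcal{M}(V)}$;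 for openly persistent $\mathrm{cl}$ and quasi-coherent $\mathcal{M}$ this is a subsheaf of $\mathcal{O}_X$-modules of $\mathcal{M}$. *)

theory Defs
  imports
    "HOL-Algebra.QuotRing"
    "HOL-Algebra.Module"
    "HOL-Algebra.Free_Abelian_Groups"
    "HOL-Analysis.Abstract_Topology"
begin

text \<open>
  Rings and modules are those of HOL-Algebra. The record type of modules extends that of rings, so
  a module record carries two idle fields (\<open>mult\<close>, \<open>one\<close>); they are ignored below, except that the
  constructions \<open>localization\<close> and \<open>tilde\<close> fill them in pointwise, so that applied to a ring
  regarded as a module over itself they yield the corresponding rings.
\<close>

section \<open>Sheaves, ringed spaces and sheaves of modules\<close>

definition is_sheaf ::
  "'x topology \<Rightarrow> ('x set \<Rightarrow> 's set) \<Rightarrow> ('x set \<Rightarrow> 'x set \<Rightarrow> 's \<Rightarrow> 's) \<Rightarrow> bool" where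
  "is_sheaf T F res \<longleftrightarrow>
     (\<forall>U V. openin T U \<and> openin T V \<and> V \<subseteq> U \<longrightarrow> res U V ` F U \<subseteq> F V) \<and>
     (\<forall>U. openin T U \<longrightarrow> (\<forall>s\<in>F U. res U U s = s)) \<and>
     (\<forall>U V W. openin T U \<and> openin T V \<and> openin T W \<and> W \<subseteq> V \<and> V \<subseteq> U \<longrightarrow>
        (\<forall>s\<in>F U. res V W (res U V s) = res U W s)) \<and>
     (\<forall>\<W> s. (\<forall>W\<in>\<W>. openin T W \<and> s W \<in> F W) \<and>
        (\<forall>W\<in>\<W>. \<forall>W'\<in>\<W>. res W (W \<inter> W') (s W) = res W' (W \<inter> W') (s W')) \<longrightarrow>
        (\<exists>!t. t \<in> F (\<Union>\<W>) \<and> (\<forall>W\<in>\<W>. res (\<Union>\<W>) W t = s W)))"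

record ('x, 'r) ringed_space =
  top_of :: "'x topology"
  sec :: "'x set \<Rightarrow> 'r ring"
  rres :: "'x set \<Rightarrow> 'x set \<Rightarrow> 'r \<Rightarrow> 'r"

definition is_ringed_space :: "('x, 'r) ringed_space \<Rightarrow> bool" where
  "is_ringed_space X \<longleftrightarrow>
     (\<forall>U. openin (top_of X) U \<longrightarrow> cring (sec X U)) \<and>
     (\<forall>U V. openin (top_of X) U \<and> openin (top_of X) V \<and> V \<subseteq> U \<longrightarrow>
        rres X U V \<in> ring_hom (sec X U) (sec X V)) \<and>
     is_sheaf (top_of X) (\<lambda>U. carrier (sec X U)) (rres X)"

record ('x, 'r, 'm) module_sheaf =
  msec :: "'x set \<Rightarrow> ('r, 'm) module"
  mres :: "'x set \<Rightarrow> 'x set \<Rightarrow> 'm \<Rightarrow> 'm"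

definition is_module_sheaf :: "('x, 'r) ringed_space \<Rightarrow> ('x, 'r, 'm) module_sheaf \<Rightarrow> bool" where
  "is_module_sheaf X M \<longleftrightarrow>
     (\<forall>U. openin (top_of X) U \<longrightarrow> Module.module (sec X U) (msec M U)) \<and>
     (\<forall>U V. openin (top_of X) U \<and> openin (top_of X) V \<and> V \<subseteq> U \<longrightarrow>
        (\<forall>s\<in>carrier (msec M U). \<forall>t\<in>carrier (msec M U).
           mres M U V (s \<oplus>\<^bsub>msec M U\<^esub> t) = mres M U V s \<oplus>\<^bsub>msec M V\<^esub> mres M U V t) \<and>
        (\<forall>a\<in>carrier (sec X U). \<forall>s\<in>carrier (msec M U).
           mres M U V (a \<odot>\<^bsub>msec M U\<^esub> s) = rres X U V a \<odot>\<^bsub>msec M V\<^esub> mres M U V s)) \<and>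
     is_sheaf (top_of X) (\<lambda>U. carrier (msec M U)) (mres M)"

text \<open>A subsheaf (of sets), given by subsets of the section modules, with the ambient restrictions.\<close>

definition subsheaf ::
  "('x, 'r) ringed_space \<Rightarrow> ('x, 'r, 'm) module_sheaf \<Rightarrow> ('x set \<Rightarrow> 'm set) \<Rightarrow> bool" where
  "subsheaf X M F \<longleftrightarrow>
     (\<forall>U. openin (top_of X) U \<longrightarrow> F U \<subseteq> carrier (msec M U)) \<and> is_sheaf (top_of X) F (mres M)"

definition submodule_sheaf ::
  "('x, 'r) ringed_space \<Rightarrow> ('x, 'r, 'm) module_sheaf \<Rightarrow> ('x set \<Rightarrow> 'm set) \<Rightarrow> bool" where
  "submodule_sheaf X M L \<longleftrightarrow>
     subsheaf X M L \<and> (\<forall>U. openin (top_of X) U \<longrightarrow> submodule (L U) (sec X U) (msec M U))"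

definition sub_module_sheaf ::
  "('x, 'r, 'm) module_sheaf \<Rightarrow> ('x set \<Rightarrow> 'm set) \<Rightarrow> ('x, 'r, 'm) module_sheaf" where
  "sub_module_sheaf M L = \<lparr>msec = (\<lambda>U. (msec M U)\<lparr>carrier := L U\<rparr>), mres = mres M\<rparr>"


section \<open>Semilinear isomorphisms, localization and base change of modules\<close>

definition semilinear_iso ::
  "('r, 'c) ring_scheme \<Rightarrow> ('r \<Rightarrow> 's) \<Rightarrow> ('r, 'm) module \<Rightarrow> ('s, 'n) module \<Rightarrow> ('m \<Rightarrow> 'n) \<Rightarrow> bool" where
  "semilinear_iso R \<theta> M N \<psi> \<longleftrightarrow>
     bij_betw \<psi> (carrier M) (carrier N) \<and>
     (\<forall>x\<in>carrier M. \<forall>y\<in>carrier M. \<psi> (x \<oplus>\<^bsub>M\<^esub> y) = \<psi> x \<oplus>\<^bsub>N\<^esub> \<psi> y) \<and>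
     (\<forall>a\<in>carrier R. \<forall>x\<in>carrier M. \<psi> (a \<odot>\<^bsub>M\<^esub> x) = \<theta> a \<odot>\<^bsub>N\<^esub> \<psi> x)"

definition self_module :: "'r ring \<Rightarrow> ('r, 'r) module" where
  "self_module R =
     \<lparr>carrier = carrier R, mult = mult R, one = one R, ring.zero = \<zero>\<^bsub>R\<^esub>, add = add R, smult = mult R\<rparr>"

text \<open>The fraction \<open>m/s\<close>, as an equivalence class of pairs.\<close>

definition frac :: "'r ring \<Rightarrow> 'r set \<Rightarrow> ('r, 'm) module \<Rightarrow> 'm \<Rightarrow> 'r \<Rightarrow> ('m \<times> 'r) set" where
  "frac R S M m s = {(m', s'). m' \<in> carrier M \<and> s' \<in> S \<and>
     (\<exists>t\<in>S. t \<odot>\<^bsub>M\<^esub> (s' \<odot>\<^bsub>M\<^esub> m) = t \<odot>\<^bsub>M\<^esub> (s \<odot>\<^bsub>M\<^esub> m'))}"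

text \<open>
  \<open>S\<^sup>-\<^sup>1M\<close> as a module over \<open>S\<^sup>-\<^sup>1R\<close>, the latter being the ring part of the localization of \<open>R\<close> as a
  module over itself. The unions below are unions of copies of one and the same class.
\<close>

definition localization ::
  "'r ring \<Rightarrow> 'r set \<Rightarrow> ('r, 'm) module \<Rightarrow> (('r \<times> 'r) set, ('m \<times> 'r) set) module" where
  "localization R S M =
     \<lparr>carrier = {frac R S M m s |m s. m \<in> carrier M \<and> s \<in> S},
      mult = (\<lambda>C D. \<Union>(m, s)\<in>C. \<Union>(n, t)\<in>D. frac R S M (m \<otimes>\<^bsub>M\<^esub> n) (s \<otimes>\<^bsub>R\<^esub> t)),
      one = frac R S M \<one>\<^bsub>M\<^esub> \<one>\<^bsub>R\<^esub>,
      ring.zero = frac R S M \<zero>\<^bsub>M\<^esub> \<one>\<^bsub>R\<^esub>,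
      add = (\<lambda>C D. \<Union>(m, s)\<in>C. \<Union>(n, t)\<in>D.
               frac R S M ((t \<odot>\<^bsub>M\<^esub> m) \<oplus>\<^bsub>M\<^esub> (s \<odot>\<^bsub>M\<^esub> n)) (s \<otimes>\<^bsub>R\<^esub> t)),
      smult = (\<lambda>C D. \<Union>(a, s)\<in>C. \<Union>(m, t)\<in>D. frac R S M (a \<odot>\<^bsub>M\<^esub> m) (s \<otimes>\<^bsub>R\<^esub> t))\<rparr>"

definition ring_localization :: "'r ring \<Rightarrow> 'r set \<Rightarrow> (('r \<times> 'r) set, ('r \<times> 'r) set) module" where
  "ring_localization R S = localization R S (self_module R)"

definition powers :: "'r ring \<Rightarrow> 'r \<Rightarrow> 'r set" where
  "powers R f = {f [^]\<^bsub>R\<^esub> n |n::nat. True}"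

text \<open>\<open>M \<otimes>\<^sub>R S\<close> along \<open>\<rho> : R \<rightarrow> S\<close>: the free abelian group on \<open>M \<times> S\<close> modulo the usual relations.\<close>

definition tensor_relations ::
  "'r ring \<Rightarrow> ('r \<Rightarrow> 's) \<Rightarrow> 's ring \<Rightarrow> ('r, 'm) module \<Rightarrow> ('m \<times> 's \<Rightarrow>\<^sub>0 int) set" where
  "tensor_relations R \<rho> S M =
     {frag_of (m \<oplus>\<^bsub>M\<^esub> m', s) - frag_of (m, s) - frag_of (m', s) |m m' s.
        m \<in> carrier M \<and> m' \<in> carrier M \<and> s \<in> carrier S} \<union>
     {frag_of (m, s \<oplus>\<^bsub>S\<^esub> s') - frag_of (m, s) - frag_of (m, s') |m s s'.
        m \<in> carrier M \<and> s \<in> carrier S \<and> s' \<in> carrier S} \<union>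
     {frag_of (r \<odot>\<^bsub>M\<^esub> m, s) - frag_of (m, \<rho> r \<otimes>\<^bsub>S\<^esub> s) |r m s.
        r \<in> carrier R \<and> m \<in> carrier M \<and> s \<in> carrier S}"

definition tensor_kernel ::
  "'r ring \<Rightarrow> ('r \<Rightarrow> 's) \<Rightarrow> 's ring \<Rightarrow> ('r, 'm) module \<Rightarrow> ('m \<times> 's \<Rightarrow>\<^sub>0 int) set" where
  "tensor_kernel R \<rho> S M =
     generate (free_Abelian_group (carrier M \<times> carrier S)) (tensor_relations R \<rho> S M)"

definition tensor_group ::
  "'r ring \<Rightarrow> ('r \<Rightarrow> 's) \<Rightarrow> 's ring \<Rightarrow> ('r, 'm) module \<Rightarrow> ('m \<times> 's \<Rightarrow>\<^sub>0 int) set monoid" where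
  "tensor_group R \<rho> S M =
     free_Abelian_group (carrier M \<times> carrier S) Mod tensor_kernel R \<rho> S M"

text \<open>The class in the tensor product of a formal \<open>\<int>\<close>-linear combination of pairs.\<close>

definition tensor_class ::
  "'r ring \<Rightarrow> ('r \<Rightarrow> 's) \<Rightarrow> 's ring \<Rightarrow> ('r, 'm) module \<Rightarrow>
     ('m \<times> 's \<Rightarrow>\<^sub>0 int) \<Rightarrow> ('m \<times> 's \<Rightarrow>\<^sub>0 int) set" where
  "tensor_class R \<rho> S M c =
     tensor_kernel R \<rho> S M #>\<^bsub>free_Abelian_group (carrier M \<times> carrier S)\<^esub> c"

definition pure_tensor ::
  "'r ring \<Rightarrow> ('r \<Rightarrow> 's) \<Rightarrow> 's ring \<Rightarrow> ('r, 'm) module \<Rightarrow> 'm \<Rightarrow> 's \<Rightarrow> ('m \<times> 's \<Rightarrow>\<^sub>0 int) set" where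
  "pure_tensor R \<rho> S M m s = tensor_class R \<rho> S M (frag_of (m, s))"

text \<open>The scalar multiplication is the additive extension of \<open>s \<cdot> (m \<otimes> t) = m \<otimes> st\<close>.\<close>

definition base_change ::
  "'r ring \<Rightarrow> ('r \<Rightarrow> 's) \<Rightarrow> 's ring \<Rightarrow> ('r, 'm) module \<Rightarrow> ('s, ('m \<times> 's \<Rightarrow>\<^sub>0 int) set) module" where
  "base_change R \<rho> S M =
     \<lparr>carrier = carrier (tensor_group R \<rho> S M),
      mult = undefined,
      one = undefined,
      ring.zero = one (tensor_group R \<rho> S M),
      add = mult (tensor_group R \<rho> S M),
      smult = (\<lambda>s C. \<Union>c\<in>C. tensor_class R \<rho> S M
                        (frag_extend (\<lambda>(m, t). frag_of (m, s \<otimes>\<^bsub>S\<^esub> t)) c))\<rparr>"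

text \<open>The image \<open>LS\<close> of \<open>L \<otimes>\<^sub>R S \<rightarrow> M \<otimes>\<^sub>R S\<close>: all sums of tensors \<open>l \<otimes> s\<close>.\<close>

definition base_change_image ::
  "'r ring \<Rightarrow> ('r \<Rightarrow> 's) \<Rightarrow> 's ring \<Rightarrow> ('r, 'm) module \<Rightarrow> 'm set \<Rightarrow> ('m \<times> 's \<Rightarrow>\<^sub>0 int) set set" where
  "base_change_image R \<rho> S M L =
     generate (tensor_group R \<rho> S M) {pure_tensor R \<rho> S M l s |l s. l \<in> L \<and> s \<in> carrier S}"


section \<open>Spectra, schemes and quasi-coherent modules\<close>

definition zariski :: "'r ring \<Rightarrow> 'r set topology" where
  "zariski A = topology (\<lambda>W. \<exists>E\<subseteq>carrier A. W = {P. primeideal P A \<and> \<not> E \<subseteq> P})"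

lemma openin_zariski:
  assumes "cring A"
  shows "openin (zariski A) W \<longleftrightarrow> (\<exists>E\<subseteq>carrier A. W = {P. primeideal P A \<and> \<not> E \<subseteq> P})"
proof -
  let ?D = "\<lambda>E. {P. primeideal P A \<and> \<not> E \<subseteq> P}"
  interpret cring A by fact
  have int: "?D E \<inter> ?D F = ?D {e \<otimes>\<^bsub>A\<^esub> f |e f. e \<in> E \<and> f \<in> F}"
    if "E \<subseteq> carrier A" "F \<subseteq> carrier A" for E F
  proof (intro equalityI subsetI)
    fix P assume "P \<in> ?D E \<inter> ?D F"
    then obtain e f where P: "primeideal P A" "e \<in> E" "e \<notin> P" "f \<in> F" "f \<notin> P" by auto
    have "e \<in> carrier A" "f \<in> carrier A" using P that by auto
    then have "e \<otimes>\<^bsub>A\<^esub> f \<notin> P" using primeideal.I_prime[OF P(1)] P by blast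
    then show "P \<in> ?D {e \<otimes>\<^bsub>A\<^esub> f |e f. e \<in> E \<and> f \<in> F}" using P by blast
  next
    fix P assume "P \<in> ?D {e \<otimes>\<^bsub>A\<^esub> f |e f. e \<in> E \<and> f \<in> F}"
    then obtain e f where P: "primeideal P A" "e \<in> E" "f \<in> F" "e \<otimes>\<^bsub>A\<^esub> f \<notin> P" by auto
    interpret P: primeideal P A by fact
    have c: "e \<in> carrier A" "f \<in> carrier A" using P(2,3) that by auto
    have "e \<notin> P" using P(4) P.I_r_closed[OF _ c(2)] by blast
    moreover have "f \<notin> P" using P(4) P.I_l_closed[OF _ c(1)] by blast
    ultimately
    show "P \<in> ?D E \<inter> ?D F" using P by blast
  qed
  have "istopology (\<lambda>W. \<exists>E\<subseteq>carrier A. W = ?D E)"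
    unfolding istopology_def
  proof (intro conjI allI impI)
    fix S T assume "\<exists>E\<subseteq>carrier A. S = ?D E" "\<exists>E\<subseteq>carrier A. T = ?D E"
    then obtain E F where EF: "E \<subseteq> carrier A" "S = ?D E" "F \<subseteq> carrier A" "T = ?D F" by blast
    have "{e \<otimes>\<^bsub>A\<^esub> f |e f. e \<in> E \<and> f \<in> F} \<subseteq> carrier A" using EF by blast
    moreover have "S \<inter> T = ?D {e \<otimes>\<^bsub>A\<^esub> f |e f. e \<in> E \<and> f \<in> F}"
      unfolding EF(2,4) by (rule int[OF EF(1,3)])
    ultimately show "\<exists>E\<subseteq>carrier A. S \<inter> T = ?D E" by (intro exI conjI)
  next
    fix \<K> assume "\<forall>K\<in>\<K>. \<exists>E\<subseteq>carrier A. K = ?D E"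
    then obtain E where E: "\<forall>K\<in>\<K>. E K \<subseteq> carrier A \<and> K = ?D (E K)"
      by (rule bchoice[THEN exE])
    have "\<Union>\<K> = (\<Union>K\<in>\<K>. ?D (E K))" by (rule arg_cong[where f = Union]) (use E in force)
    also have "\<dots> = ?D (\<Union>K\<in>\<K>. E K)" by blast
    finally have "\<Union>\<K> = ?D (\<Union>K\<in>\<K>. E K)" .
    moreover have "(\<Union>K\<in>\<K>. E K) \<subseteq> carrier A" using E by blast
    ultimately show "\<exists>E\<subseteq>carrier A. \<Union>\<K> = ?D E" by (intro exI conjI)
  qed
  then show ?thesis unfolding zariski_def by (simp only: topology_inverse')
qed

text \<open>
  The sections over \<open>W\<close> of the sheaf associated with an \<open>A\<close>-module \<open>M\<close> on \<open>Spec A\<close>: the functions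
  \<open>P \<mapsto> s P \<in> M\<^sub>P\<close> on \<open>W\<close> that are locally given by a fraction \<open>m/f\<close>. Restriction of sections is
  restriction of functions. Scalars are sections of the structure sheaf \<open>spec_sheaf A\<close>.
\<close>

definition tilde ::
  "'r ring \<Rightarrow> ('r, 'm) module \<Rightarrow> 'r set set \<Rightarrow>
     ('r set \<Rightarrow> ('r \<times> 'r) set, 'r set \<Rightarrow> ('m \<times> 'r) set) module" where
  "tilde A M W =
     (let stalk = (\<lambda>P. localization A (carrier A - P) M) in
     \<lparr>carrier = {s \<in> (\<Pi>\<^sub>E P\<in>W. carrier (stalk P)).
        \<forall>P\<in>W. \<exists>V. openin (zariski A) V \<and> P \<in> V \<and> V \<subseteq> W \<and>
          (\<exists>m\<in>carrier M. \<exists>f\<in>carrier A. \<forall>Q\<in>V. f \<notin> Q \<and> s Q = frac A (carrier A - Q) M m f)},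
      mult = (\<lambda>s t. \<lambda>P\<in>W. s P \<otimes>\<^bsub>stalk P\<^esub> t P),
      one = (\<lambda>P\<in>W. \<one>\<^bsub>stalk P\<^esub>),
      ring.zero = (\<lambda>P\<in>W. \<zero>\<^bsub>stalk P\<^esub>),
      add = (\<lambda>s t. \<lambda>P\<in>W. s P \<oplus>\<^bsub>stalk P\<^esub> t P),
      smult = (\<lambda>a s. \<lambda>P\<in>W. a P \<odot>\<^bsub>stalk P\<^esub> s P)\<rparr>)"

definition spec_sheaf ::
  "'r ring \<Rightarrow> 'r set set \<Rightarrow>
     ('r set \<Rightarrow> ('r \<times> 'r) set, 'r set \<Rightarrow> ('r \<times> 'r) set) module" where
  "spec_sheaf A W = tilde A (self_module A) W"

text \<open>\<open>(h, \<theta>)\<close> is an isomorphism of ringed spaces from \<open>(U, \<O>\<^sub>X|\<^sub>U)\<close> to \<open>Spec A\<close>.\<close>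

definition spec_chart ::
  "('x, 'r) ringed_space \<Rightarrow> 'x set \<Rightarrow> 'r ring \<Rightarrow> ('x \<Rightarrow> 'r set) \<Rightarrow>
     ('x set \<Rightarrow> 'r \<Rightarrow> 'r set \<Rightarrow> ('r \<times> 'r) set) \<Rightarrow> bool" where
  "spec_chart X U A h \<theta> \<longleftrightarrow>
     openin (top_of X) U \<and> cring A \<and>
     homeomorphic_map (subtopology (top_of X) U) (zariski A) h \<and>
     (\<forall>W. openin (top_of X) W \<and> W \<subseteq> U \<longrightarrow> \<theta> W \<in> ring_iso (sec X W) (spec_sheaf A (h ` W))) \<and>
     (\<forall>W W'. openin (top_of X) W \<and> openin (top_of X) W' \<and> W' \<subseteq> W \<and> W \<subseteq> U \<longrightarrow>
        (\<forall>a\<in>carrier (sec X W). \<theta> W' (rres X W W' a) = restrict (\<theta> W a) (h ` W')))"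

text \<open>
  The ring \<open>A\<close> may be taken over the type \<open>'r\<close> without loss of generality, since it is isomorphic
  to \<open>\<O>\<^sub>X(U)\<close>.
\<close>

definition affine_open :: "('x, 'r) ringed_space \<Rightarrow> 'x set \<Rightarrow> bool" where
  "affine_open X U \<longleftrightarrow> (\<exists>A h \<theta>. spec_chart X U A h \<theta>)"

text \<open>
  As in EGA I, a scheme is a ringed space in which every point has an affine open neighborhood.
  Being locally isomorphic to spectra, it is automatically locally ringed, and isomorphisms of
  ringed spaces between locally ringed spaces are automatically local.
\<close>

definition scheme :: "('x, 'r) ringed_space \<Rightarrow> bool" where
  "scheme X \<longleftrightarrow> is_ringed_space X \<and> (\<forall>x\<in>topspace (top_of X). \<exists>U. x \<in> U \<and> affine_open X U)"

text \<open>Every point has an affine open neighborhood \<open>U \<cong> Spec A\<close> on which \<open>M\<close> is isomorphic to the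
  sheaf associated with some \<open>A\<close>-module \<open>N\<close> (isomorphic to \<open>M(U)\<close>, hence of type \<open>'m\<close> without
  loss of generality).\<close>

definition quasi_coherent :: "('x, 'r) ringed_space \<Rightarrow> ('x, 'r, 'm) module_sheaf \<Rightarrow> bool" where
  "quasi_coherent X M \<longleftrightarrow>
     is_module_sheaf X M \<and>
     (\<forall>x\<in>topspace (top_of X). \<exists>U A h \<theta> (N :: ('r, 'm) module) \<sigma>.
        x \<in> U \<and> spec_chart X U A h \<theta> \<and> Module.module A N \<and>
        (\<forall>W. openin (top_of X) W \<and> W \<subseteq> U \<longrightarrow>
           semilinear_iso (sec X W) (\<theta> W) (msec M W) (tilde A N (h ` W)) (\<sigma> W)) \<and>
        (\<forall>W W'. openin (top_of X) W \<and> openin (top_of X) W' \<and> W' \<subseteq> W \<and> W \<subseteq> U \<longrightarrow>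
           (\<forall>s\<in>carrier (msec M W). \<sigma> W' (mres M W W' s) = restrict (\<sigma> W s) (h ` W'))))"

definition quasi_coherent_submodule ::
  "('x, 'r) ringed_space \<Rightarrow> ('x, 'r, 'm) module_sheaf \<Rightarrow> ('x set \<Rightarrow> 'm set) \<Rightarrow> bool" where
  "quasi_coherent_submodule X M L \<longleftrightarrow>
     submodule_sheaf X M L \<and> quasi_coherent X (sub_module_sheaf M L)"

text \<open>The set of points of \<open>U\<close> where the germ of \<open>f \<in> \<O>\<^sub>X(U)\<close> is a unit.\<close>

definition basic_open :: "('x, 'r) ringed_space \<Rightarrow> 'x set \<Rightarrow> 'r \<Rightarrow> 'x set" where
  "basic_open X U f = {x \<in> U. \<exists>W. openin (top_of X) W \<and> x \<in> W \<and> W \<subseteq> U \<and>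
     rres X U W f \<in> Units (sec X W)}"


section \<open>Preclosure operations on submodules over a scheme\<close>

text \<open>
  \<open>cl U M L\<close> is the preclosure of the submodule \<open>L\<close> of the \<open>\<O>\<^sub>X(U)\<close>-module \<open>M\<close>. Modules range over
  all module records with elements in the type \<open>'m\<close>, which is arbitrary and plays the role of a
  universe of sets: an infinite type \<open>'m\<close> at least as large as \<open>'r\<close> contains, up to isomorphism,
  all base changes and localizations of its modules. The last clause is the identification of
  isomorphic modules; it makes \<open>cl\<close> independent of how a base change or localization is modelled
  in \<open>'m\<close>, and of the idle fields of the module records.
\<close>

type_synonym ('x, 'r, 'm) module_closure = "'x set \<Rightarrow> ('r, 'm) module \<Rightarrow> 'm set \<Rightarrow> 'm set"

definition preclosure_operation ::
  "('x, 'r) ringed_space \<Rightarrow> ('x, 'r, 'm) module_closure \<Rightarrow> bool" where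
  "preclosure_operation X cl \<longleftrightarrow>
     (\<forall>U M L. affine_open X U \<and> Module.module (sec X U) M \<and> submodule L (sec X U) M \<longrightarrow>
        submodule (cl U M L) (sec X U) M \<and> L \<subseteq> cl U M L) \<and>
     (\<forall>U M L L'. affine_open X U \<and> Module.module (sec X U) M \<and>
        submodule L (sec X U) M \<and> submodule L' (sec X U) M \<and> L \<subseteq> L' \<longrightarrow> cl U M L \<subseteq> cl U M L') \<and>
     (\<forall>U M N \<psi> L. affine_open X U \<and> Module.module (sec X U) M \<and> Module.module (sec X U) N \<and>
        semilinear_iso (sec X U) (\<lambda>a. a) M N \<psi> \<and> submodule L (sec X U) M \<longrightarrow>
        cl U N (\<psi> ` L) = \<psi> ` cl U M L)"

text \<open>\<open>N\<close> together with \<open>\<psi>\<close> is a copy in \<open>'m\<close> of \<open>M \<otimes>\<^sub>R S\<close> for \<open>R = \<O>\<^sub>X(U)\<close>, \<open>S = \<O>\<^sub>X(V)\<close>.\<close>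

definition base_change_model ::
  "('x, 'r) ringed_space \<Rightarrow> 'x set \<Rightarrow> 'x set \<Rightarrow> ('r, 'm) module \<Rightarrow> ('r, 'm) module \<Rightarrow>
     (('m \<times> 'r \<Rightarrow>\<^sub>0 int) set \<Rightarrow> 'm) \<Rightarrow> bool" where
  "base_change_model X U V M N \<psi> \<longleftrightarrow>
     Module.module (sec X V) N \<and>
     semilinear_iso (sec X V) (\<lambda>a. a) (base_change (sec X U) (rres X U V) (sec X V) M) N \<psi>"

definition openly_persistent ::
  "('x, 'r) ringed_space \<Rightarrow> ('x, 'r, 'm) module_closure \<Rightarrow> bool" where
  "openly_persistent X cl \<longleftrightarrow>
     (\<forall>U V M L N \<psi> x. affine_open X U \<and> affine_open X V \<and> V \<subseteq> U \<and>
        Module.module (sec X U) M \<and> submodule L (sec X U) M \<and> base_change_model X U V M N \<psi> \<and>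
        x \<in> cl U M L \<longrightarrow>
        \<psi> (pure_tensor (sec X U) (rres X U V) (sec X V) M x \<one>\<^bsub>sec X V\<^esub>)
          \<in> cl V N (\<psi> ` base_change_image (sec X U) (rres X U V) (sec X V) M L))"

text \<open>
  For \<open>Spec R = U\<close> and \<open>f \<in> R\<close>, the affine open \<open>Spec R\<^sub>f\<close> is \<open>basic_open X U f\<close>; \<open>\<theta>\<close> identifies \<open>R\<^sub>f\<close>
  with its ring of sections (\<open>\<theta>\<close> is the canonical isomorphism, being the only one under \<open>R\<close>), and
  \<open>N\<close> together with \<open>\<psi>\<close> is a copy in \<open>'m\<close> of the \<open>R\<^sub>f\<close>-module \<open>M\<^sub>f\<close>.
\<close>

definition localization_model ::
  "('x, 'r) ringed_space \<Rightarrow> 'x set \<Rightarrow> 'r \<Rightarrow> ('r, 'm) module \<Rightarrow>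
     (('r \<times> 'r) set \<Rightarrow> 'r) \<Rightarrow> ('r, 'm) module \<Rightarrow> (('m \<times> 'r) set \<Rightarrow> 'm) \<Rightarrow> bool" where
  "localization_model X U f M \<theta> N \<psi> \<longleftrightarrow>
     (let R = sec X U; S = powers R f; D = basic_open X U f in
      \<theta> \<in> ring_iso (ring_localization R S) (sec X D) \<and>
      (\<forall>a\<in>carrier R. \<theta> (frac R S (self_module R) a \<one>\<^bsub>R\<^esub>) = rres X U D a) \<and>
      Module.module (sec X D) N \<and>
      semilinear_iso (ring_localization R S) \<theta> (localization R S M) N \<psi>)"

text \<open>The submodule \<open>L\<^sub>f\<close> of \<open>M\<^sub>f\<close>.\<close>

definition loc_image :: "'r ring \<Rightarrow> 'r \<Rightarrow> ('r, 'm) module \<Rightarrow> 'm set \<Rightarrow> ('m \<times> 'r) set set" where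
  "loc_image R f M L = {frac R (powers R f) M l s |l s. l \<in> L \<and> s \<in> powers R f}"

definition glueable :: "('x, 'r) ringed_space \<Rightarrow> ('x, 'r, 'm) module_closure \<Rightarrow> bool" where
  "glueable X cl \<longleftrightarrow>
     openly_persistent X cl \<and>
     (\<forall>U E g M L z \<theta> N \<psi>.
        affine_open X U \<and> E \<subseteq> carrier (sec X U) \<and>
        g \<in> carrier (sec X U) \<and> (\<exists>n::nat. g [^]\<^bsub>sec X U\<^esub> n \<in> genideal (sec X U) E) \<and>
        Module.module (sec X U) M \<and> submodule L (sec X U) M \<and> z \<in> carrier M \<and>
        (\<forall>f\<in>insert g E. localization_model X U f M (\<theta> f) (N f) (\<psi> f)) \<and>
        (\<forall>f\<in>E. \<psi> f (frac (sec X U) (powers (sec X U) f) M z \<one>\<^bsub>sec X U\<^esub>)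
           \<in> cl (basic_open X U f) (N f) (\<psi> f ` loc_image (sec X U) f M L)) \<longrightarrow>
        \<psi> g (frac (sec X U) (powers (sec X U) g) M z \<one>\<^bsub>sec X U\<^esub>)
          \<in> cl (basic_open X U g) (N g) (\<psi> g ` loc_image (sec X U) g M L))"

text \<open>The sheaf \<open>L\<^sup>c\<^sup>l\<^sub>M\<close>.\<close>

definition closure_sheaf ::
  "('x, 'r) ringed_space \<Rightarrow> ('x, 'r, 'm) module_closure \<Rightarrow> ('x, 'r, 'm) module_sheaf \<Rightarrow>
     ('x set \<Rightarrow> 'm set) \<Rightarrow> 'x set \<Rightarrow> 'm set" where
  "closure_sheaf X cl M L U =
     {s \<in> carrier (msec M U).
        \<forall>x\<in>U. \<exists>V. affine_open X V \<and> x \<in> V \<and> V \<subseteq> U \<and> mres M U V s \<in> cl V (msec M V) (L V)}"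

end

theory Submission
  imports Defs "HOL-Algebra.Ring_Divisibility"
begin

text \<open>
  Everything reduces to sections over affine open sets. Let \<open>s\<close> be a section of the closure sheaf over
  \<open>U\<close> and \<open>V \<subseteq> U\<close> affine. Every \<open>x \<in> V\<close> lies in some affine \<open>W \<subseteq> U\<close> with \<open>s|\<^sub>W\<close> in the closure of \<open>L(W)\<close>, and
  in an open set \<open>B\<close> that is basic both in \<open>V\<close> and in \<open>W\<close>. By persistence from \<open>W\<close> to \<open>B\<close>, the section
  \<open>s|\<^sub>B\<close> lies in the closure of \<open>L(B)\<close>; these \<open>B\<close> are the \<open>D(f)\<close> for elements \<open>f\<close> generating the unit ideal
  of \<open>\<O>(V)\<close>, so gluing with \<open>g = 1\<close> puts \<open>s|\<^sub>V\<close> in the closure of \<open>L(V)\<close>. Persistence is thus needed only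
  along localizations \<open>W \<supseteq> D(f)\<close>, where \<open>M(W) \<otimes> \<O>(D(f)) = M(W)\<^sub>f = M(D(f))\<close>, and likewise for \<open>L\<close>, because a
  quasi-coherent module is the sheaf associated with its sections on every affine open set.
\<close>

section \<open>Modules and ideals\<close>

text \<open>The obstacle is that \<open>affine_open\<close> asserts only that some chart exists, and
  a chart of \<open>U\<close> does not visibly restrict to a chart of \<open>D(f)\<close>.
  Affineness is therefore traded for conditions on the ring O(U) and its basic open sets; these pass
  to \<open>D(f)\<close>, and a chart can be rebuilt from them with O(U) as its ring. That a point
  defines a prime ideal of O(U) needs local stalks, which have to be extracted from the charts, a
  scheme being given here as a ringed space. Likewise, quasi-coherence provides charts around
  points, unrelated to the affine open set under consideration. The remedy is to express
  \<open>M(D(f)) = M(U)_f\<close> by two statements about the restriction map, which are inherited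
  by basic open sets and can be glued from a finite cover by such sets. The same two statements make
  \<open>M(D(f))\<close>, whose elements already have the type on which \<open>cl\<close> is
  defined, a copy of both the localization and the tensor product of which the hypotheses on
  \<open>cl\<close> speak.\<close>

context Module.module
begin

lemma smult_lcomm:
  assumes "a \<in> carrier R" "b \<in> carrier R" "x \<in> carrier M"
  shows "a \<odot>\<^bsub>M\<^esub> (b \<odot>\<^bsub>M\<^esub> x) = b \<odot>\<^bsub>M\<^esub> (a \<odot>\<^bsub>M\<^esub> x)"
  using assms by (metis smult_assoc1 R.m_comm)

lemmas smult_ac = smult_assoc1 smult_lcomm

lemma smult_Units_cancel:
  assumes "u \<in> Units R" "x \<in> carrier M" "y \<in> carrier M" "u \<odot>\<^bsub>M\<^esub> x = u \<odot>\<^bsub>M\<^esub> y"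
  shows "x = y"
proof -
  have "(inv u \<otimes> u) \<odot>\<^bsub>M\<^esub> x = (inv u \<otimes> u) \<odot>\<^bsub>M\<^esub> y"
    using assms by (simp only: smult_assoc1 R.Units_closed R.Units_inv_closed)
  then show ?thesis using assms(2,3) by (simp only: R.Units_l_inv[OF assms(1)] smult_one)
qed

end

lemma module_self_module:
  fixes R :: "'r ring"
  assumes "cring R"
  shows "Module.module R (self_module R)"
proof -
  interpret cring R by fact
  have "abelian_group (self_module R)"
    by (rule abelian_groupI)
      (auto simp: self_module_def a_ac intro: bexI[of _ "\<ominus>\<^bsub>R\<^esub> _"] l_neg)
  then show ?thesis
    using assms by (intro moduleI) (simp_all add: self_module_def l_distr r_distr m_assoc)
qed

lemma self_module_simps [simp]:
  "carrier (self_module R) = carrier R" "monoid.mult (self_module R) = monoid.mult R"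
  "one (self_module R) = one R" "ring.zero (self_module R) = \<zero>\<^bsub>R\<^esub>"
  "add (self_module R) = add R" "smult (self_module R) = monoid.mult R"
  by (simp_all add: self_module_def)


section \<open>Fractions and prime ideals\<close>

locale fractions = Module.module R M for R :: "'r ring" (structure) and M :: "('r, 'm) module" (structure) +
  fixes S :: "'r set"
  assumes S_sub: "S \<subseteq> carrier R" and S_one: "\<one> \<in> S"
    and S_mult: "\<lbrakk>s \<in> S; t \<in> S\<rbrakk> \<Longrightarrow> s \<otimes> t \<in> S"
begin

lemma S_carr [simp, intro]: "s \<in> S \<Longrightarrow> s \<in> carrier R"
  using S_sub by blast

text \<open>Multiplying the first relation by \<open>u\<close> and \<open>s''\<close> and the second
  by \<open>t\<close> and \<open>s\<close> makes them meet at \<open>m'\<close>. The factor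
  \<open>s'\<close> cannot be cancelled in \<open>M\<close>, so it becomes part of the witness
  \<open>t \<otimes> u \<otimes> s'\<close>.\<close>

lemma frac_trans:
  assumes c: "m \<in> carrier M" "m' \<in> carrier M" "m'' \<in> carrier M" "s \<in> S" "s' \<in> S" "s'' \<in> S"
    and t: "t \<in> S" "t \<odot>\<^bsub>M\<^esub> (s' \<odot>\<^bsub>M\<^esub> m) = t \<odot>\<^bsub>M\<^esub> (s \<odot>\<^bsub>M\<^esub> m')"
    and u: "u \<in> S" "u \<odot>\<^bsub>M\<^esub> (s'' \<odot>\<^bsub>M\<^esub> m') = u \<odot>\<^bsub>M\<^esub> (s' \<odot>\<^bsub>M\<^esub> m'')"
  shows "\<exists>v\<in>S. v \<odot>\<^bsub>M\<^esub> (s'' \<odot>\<^bsub>M\<^esub> m) = v \<odot>\<^bsub>M\<^esub> (s \<odot>\<^bsub>M\<^esub> m'')"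
proof
  have "(t \<otimes> u \<otimes> s') \<odot>\<^bsub>M\<^esub> (s'' \<odot>\<^bsub>M\<^esub> m) = u \<odot>\<^bsub>M\<^esub> (s'' \<odot>\<^bsub>M\<^esub> (t \<odot>\<^bsub>M\<^esub> (s' \<odot>\<^bsub>M\<^esub> m)))"
    using c t(1) u(1) by (simp add: smult_ac)
  also have "\<dots> = t \<odot>\<^bsub>M\<^esub> (s \<odot>\<^bsub>M\<^esub> (u \<odot>\<^bsub>M\<^esub> (s'' \<odot>\<^bsub>M\<^esub> m')))"
    unfolding t(2) using c t(1) u(1) by (simp add: smult_ac)
  also have "\<dots> = (t \<otimes> u \<otimes> s') \<odot>\<^bsub>M\<^esub> (s \<odot>\<^bsub>M\<^esub> m'')"
    unfolding u(2) using c t(1) u(1) by (simp add: smult_ac)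
  finally show "(t \<otimes> u \<otimes> s') \<odot>\<^bsub>M\<^esub> (s'' \<odot>\<^bsub>M\<^esub> m) = (t \<otimes> u \<otimes> s') \<odot>\<^bsub>M\<^esub> (s \<odot>\<^bsub>M\<^esub> m'')" .
  show "t \<otimes> u \<otimes> s' \<in> S" using c t(1) u(1) by (simp add: S_mult)
qed

lemma frac_eqI:
  assumes "m \<in> carrier M" "m' \<in> carrier M" "s \<in> S" "s' \<in> S" "t \<in> S"
    and "t \<odot>\<^bsub>M\<^esub> (s' \<odot>\<^bsub>M\<^esub> m) = t \<odot>\<^bsub>M\<^esub> (s \<odot>\<^bsub>M\<^esub> m')"
  shows "frac R S M m s = frac R S M m' s'"
  using frac_trans[OF assms(1,2) _ assms(3,4) _ assms(5,6)]
    frac_trans[OF assms(2,1) _ assms(4,3) _ assms(5) assms(6)[symmetric]]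
  unfolding frac_def by fast

lemma frac_mem: "\<lbrakk>m \<in> carrier M; s \<in> S\<rbrakk> \<Longrightarrow> (m, s) \<in> frac R S M m s"
  using S_one by (auto simp: frac_def)

lemma frac_memD:
  assumes "m \<in> carrier M" "s \<in> S" "(m', s') \<in> frac R S M m s"
  shows "m' \<in> carrier M" "s' \<in> S" "frac R S M m' s' = frac R S M m s"
proof -
  show m': "m' \<in> carrier M" "s' \<in> S" using assms(3) by (simp_all add: frac_def)
  obtain t where "t \<in> S" "t \<odot>\<^bsub>M\<^esub> (s' \<odot>\<^bsub>M\<^esub> m) = t \<odot>\<^bsub>M\<^esub> (s \<odot>\<^bsub>M\<^esub> m')"
    using assms(3) by (auto simp: frac_def)
  then show "frac R S M m' s' = frac R S M m s"
    using frac_eqI[OF assms(1) m'(1) assms(2) m'(2)] by simp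
qed

lemma frac_eq_iff:
  assumes "m \<in> carrier M" "m' \<in> carrier M" "s \<in> S" "s' \<in> S"
  shows "frac R S M m s = frac R S M m' s' \<longleftrightarrow>
    (\<exists>t\<in>S. t \<odot>\<^bsub>M\<^esub> (s' \<odot>\<^bsub>M\<^esub> m) = t \<odot>\<^bsub>M\<^esub> (s \<odot>\<^bsub>M\<^esub> m'))"
proof
  assume "frac R S M m s = frac R S M m' s'"
  then have "(m', s') \<in> frac R S M m s" using frac_mem assms by simp
  then show "\<exists>t\<in>S. t \<odot>\<^bsub>M\<^esub> (s' \<odot>\<^bsub>M\<^esub> m) = t \<odot>\<^bsub>M\<^esub> (s \<odot>\<^bsub>M\<^esub> m')" by (auto simp: frac_def)
qed (use frac_eqI assms in blast)

lemma frac_eqI1: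
  assumes "m \<in> carrier M" "m' \<in> carrier M" "s \<in> S" "s' \<in> S" "s' \<odot>\<^bsub>M\<^esub> m = s \<odot>\<^bsub>M\<^esub> m'"
  shows "frac R S M m s = frac R S M m' s'"
  using frac_eqI[OF assms(1-4) S_one] assms by simp

lemma frac_cong:
  assumes c: "m \<in> carrier M" "m' \<in> carrier M" "s \<in> S" "s' \<in> S"
    and eq: "frac R S M m s = frac R S M m' s'"
  obtains t where "t \<in> S" "t \<odot>\<^bsub>M\<^esub> (s' \<odot>\<^bsub>M\<^esub> m) = t \<odot>\<^bsub>M\<^esub> (s \<odot>\<^bsub>M\<^esub> m')"
  using frac_eq_iff[OF c] eq by blast

lemma carrier_localization:
  "carrier (localization R S M) = {frac R S M m s |m s. m \<in> carrier M \<and> s \<in> S}"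
  by (simp add: localization_def)

lemma frac_closed: "\<lbrakk>m \<in> carrier M; s \<in> S\<rbrakk> \<Longrightarrow> frac R S M m s \<in> carrier (localization R S M)"
  by (auto simp: carrier_localization)

text \<open>The operations of \<open>localization\<close> are unions over all representatives. Once
  the value is known to be the same for all of them, the nonempty union collapses to the value at
  the chosen one.\<close>

lemma UN_frac:
  assumes "m \<in> carrier M" "s \<in> S" "\<And>m' s'. (m', s') \<in> frac R S M m s \<Longrightarrow> F m' s' = F m s"
  shows "(\<Union>(m', s')\<in>frac R S M m s. F m' s') = F m s"
proof (rule SUP_eq_const)
  show "frac R S M m s \<noteq> {}" using frac_mem[OF assms(1,2)] by blast
  show "(case i of (m', s') \<Rightarrow> F m' s') = F m s" if "i \<in> frac R S M m s" for i
    using that assms(3) by (cases i) (simp only: prod.case)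
qed

lemma frac_add:
  assumes c: "m \<in> carrier M" "n \<in> carrier M" "s \<in> S" "t \<in> S"
  shows "frac R S M m s \<oplus>\<^bsub>localization R S M\<^esub> frac R S M n t
    = frac R S M ((t \<odot>\<^bsub>M\<^esub> m) \<oplus>\<^bsub>M\<^esub> (s \<odot>\<^bsub>M\<^esub> n)) (s \<otimes> t)"
proof -
  let ?G = "\<lambda>m s n t. frac R S M ((t \<odot>\<^bsub>M\<^esub> m) \<oplus>\<^bsub>M\<^esub> (s \<odot>\<^bsub>M\<^esub> n)) (s \<otimes> t)"
  have 1: "?G m' s' n t = ?G m s n t"
    if m: "(m', s') \<in> frac R S M m s" and n: "n \<in> carrier M" "t \<in> S" for m' s' n t
  proof -
    note d = frac_memD[OF c(1,3) m]
    obtain u where u: "u \<in> S" "u \<odot>\<^bsub>M\<^esub> (s' \<odot>\<^bsub>M\<^esub> m) = u \<odot>\<^bsub>M\<^esub> (s \<odot>\<^bsub>M\<^esub> m')"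
      using frac_cong[OF c(1) d(1) c(3) d(2) d(3)[symmetric]] .
    \<comment> \<open>The numerators to be compared are \<open>t m + s n\<close> and
      \<open>t m' + s' n\<close> over \<open>s t\<close> and \<open>s' t\<close>. After
      cross-multiplication the summands with \<open>n\<close> agree on their own, and those with
      \<open>m\<close> and \<open>m'\<close> agree by the relation for \<open>u\<close> times
      \<open>t\<close> squared.\<close>
    have "t \<odot>\<^bsub>M\<^esub> (t \<odot>\<^bsub>M\<^esub> (u \<odot>\<^bsub>M\<^esub> (s' \<odot>\<^bsub>M\<^esub> m))) = t \<odot>\<^bsub>M\<^esub> (t \<odot>\<^bsub>M\<^esub> (u \<odot>\<^bsub>M\<^esub> (s \<odot>\<^bsub>M\<^esub> m')))"
      using u(2) by simp
    then have "t \<odot>\<^bsub>M\<^esub> (u \<odot>\<^bsub>M\<^esub> (t \<odot>\<^bsub>M\<^esub> (s' \<odot>\<^bsub>M\<^esub> m))) = t \<odot>\<^bsub>M\<^esub> (u \<odot>\<^bsub>M\<^esub> (t \<odot>\<^bsub>M\<^esub> (s \<odot>\<^bsub>M\<^esub> m')))"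
      using c d n u(1) by (simp add: smult_lcomm)
    then show ?thesis
      using c d n u(1)
      by (intro frac_eqI[where t = u]) (simp_all add: S_mult smult_ac smult_r_distr)
  qed
  have 2: "?G m s n' t' = ?G m s n t" if n: "(n', t') \<in> frac R S M n t" for n' t'
  proof -
    note d = frac_memD[OF c(2,4) n]
    obtain u where u: "u \<in> S" "u \<odot>\<^bsub>M\<^esub> (t' \<odot>\<^bsub>M\<^esub> n) = u \<odot>\<^bsub>M\<^esub> (t \<odot>\<^bsub>M\<^esub> n')"
      using frac_cong[OF c(2) d(1) c(4) d(2) d(3)[symmetric]] .
    have "s \<odot>\<^bsub>M\<^esub> (s \<odot>\<^bsub>M\<^esub> (u \<odot>\<^bsub>M\<^esub> (t' \<odot>\<^bsub>M\<^esub> n))) = s \<odot>\<^bsub>M\<^esub> (s \<odot>\<^bsub>M\<^esub> (u \<odot>\<^bsub>M\<^esub> (t \<odot>\<^bsub>M\<^esub> n')))"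
      using u(2) by simp
    then have "s \<odot>\<^bsub>M\<^esub> (u \<odot>\<^bsub>M\<^esub> (s \<odot>\<^bsub>M\<^esub> (t' \<odot>\<^bsub>M\<^esub> n))) = s \<odot>\<^bsub>M\<^esub> (u \<odot>\<^bsub>M\<^esub> (s \<odot>\<^bsub>M\<^esub> (t \<odot>\<^bsub>M\<^esub> n')))"
      using c d u(1) by (simp add: smult_lcomm)
    then show ?thesis
      using c d u(1)
      by (intro frac_eqI[where t = u]) (simp_all add: S_mult smult_ac smult_r_distr)
  qed
  have "(\<Union>(m', s')\<in>frac R S M m s. \<Union>(n', t')\<in>frac R S M n t. ?G m' s' n' t')
      = (\<Union>(n', t')\<in>frac R S M n t. ?G m s n' t')"
    by (rule UN_frac[OF c(1,3)])
      (use 1 frac_memD[OF c(2,4)] in \<open>fast intro!: SUP_cong\<close>)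
  also have "\<dots> = ?G m s n t" by (rule UN_frac[OF c(2,4)]) (rule 2)
  finally show ?thesis by (simp add: localization_def)
qed

end

lemma fractions_self:
  fixes R :: "'r ring"
  assumes "fractions R M S"
  shows "fractions R (self_module R) S"
proof -
  interpret fractions R M S by fact
  show ?thesis
    by (intro fractions.intro module_self_module fractions_axioms.intro)
      (use S_sub S_one S_mult R.is_cring in auto)
qed

context fractions
begin

lemma frac_smult:
  assumes c: "a \<in> carrier R" "n \<in> carrier M" "s \<in> S" "t \<in> S"
  shows "frac R S (self_module R) a s \<odot>\<^bsub>localization R S M\<^esub> frac R S M n t
    = frac R S M (a \<odot>\<^bsub>M\<^esub> n) (s \<otimes> t)"
proof -
  interpret A: fractions R "self_module R" S by (rule fractions_self) unfold_locales
  let ?G = "\<lambda>a s n t. frac R S M (a \<odot>\<^bsub>M\<^esub> n) (s \<otimes> t)"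
  have 1: "?G a' s' n t = ?G a s n t"
    if m: "(a', s') \<in> frac R S (self_module R) a s" and n: "n \<in> carrier M" "t \<in> S" for a' s' n t
  proof -
    note d = A.frac_memD[OF _ c(3) m] 
    obtain u where u: "u \<in> S" "u \<otimes> (s' \<otimes> a) = u \<otimes> (s \<otimes> a')"
      using A.frac_cong[of a a' s s'] c d by auto
    have "(u \<otimes> (s' \<otimes> a)) \<odot>\<^bsub>M\<^esub> (t \<odot>\<^bsub>M\<^esub> n) = (u \<otimes> (s \<otimes> a')) \<odot>\<^bsub>M\<^esub> (t \<odot>\<^bsub>M\<^esub> n)"
      using u(2) by simp
    then show ?thesis
      using c d n u(1)
      by (intro frac_eqI[where t = u]) (simp_all add: S_mult smult_ac)
  qed
  have 2: "?G a s n' t' = ?G a s n t" if n: "(n', t') \<in> frac R S M n t" for n' t'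
  proof -
    note d = frac_memD[OF c(2,4) n]
    obtain u where u: "u \<in> S" "u \<odot>\<^bsub>M\<^esub> (t' \<odot>\<^bsub>M\<^esub> n) = u \<odot>\<^bsub>M\<^esub> (t \<odot>\<^bsub>M\<^esub> n')"
      using frac_cong[OF c(2) d(1) c(4) d(2) d(3)[symmetric]] .
    have "a \<odot>\<^bsub>M\<^esub> (s \<odot>\<^bsub>M\<^esub> (u \<odot>\<^bsub>M\<^esub> (t' \<odot>\<^bsub>M\<^esub> n))) = a \<odot>\<^bsub>M\<^esub> (s \<odot>\<^bsub>M\<^esub> (u \<odot>\<^bsub>M\<^esub> (t \<odot>\<^bsub>M\<^esub> n')))"
      using u(2) by simp
    then show ?thesis
      using c d u(1)
      by (intro frac_eqI[where t = u]) (simp_all add: S_mult smult_ac)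
  qed
  have "(\<Union>(m', s')\<in>frac R S (self_module R) a s. \<Union>(n', t')\<in>frac R S M n t. ?G m' s' n' t')
      = (\<Union>(n', t')\<in>frac R S M n t. ?G a s n' t')"
    by (rule A.UN_frac) (use c 1 frac_memD[OF c(2,4)] in \<open>auto intro!: SUP_cong\<close>)
  also have "\<dots> = ?G a s n t" by (rule UN_frac[OF c(2,4)]) (rule 2)
  finally show ?thesis by (simp add: localization_def)
qed

lemma frac_mult:
  assumes c: "a \<in> carrier R" "b \<in> carrier R" "s \<in> S" "t \<in> S"
  shows "frac R S (self_module R) a s \<otimes>\<^bsub>localization R S (self_module R)\<^esub> frac R S (self_module R) b t
    = frac R S (self_module R) (a \<otimes> b) (s \<otimes> t)"
proof -
  interpret A: fractions R "self_module R" S by (rule fractions_self) unfold_locales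
  show ?thesis using A.frac_smult[of a b s t] c by (simp add: localization_def)
qed

end

section \<open>Prime ideals, radicals and generated ideals\<close>

context cring
begin

lemma ideal_pow_closed:
  assumes "primeideal P R" "f \<in> carrier R" "f [^] (n::nat) \<in> P"
  shows "f \<in> P"
  using assms(3)
proof (induction n)
  case 0
  then have "\<one> \<in> P" by simp
  then show ?case using ideal.one_imp_carrier[of P R] assms(1,2) primeideal.axioms(1) by blast
next
  case (Suc n)
  then have "f [^] n \<in> P \<or> f \<in> P" using primeideal.I_prime[OF assms(1), of "f [^] n" f] assms(2) by simp
  then show ?case using Suc.IH by blast
qed

text \<open>By Zorn, take an ideal \<open>P\<close> maximal among those that contain
  \<open>I\<close> and no power of \<open>f\<close>. If neither \<open>a\<close> nor
  \<open>b\<close> were in \<open>P\<close>, powers of \<open>f\<close> would lie in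
  \<open>P + (a)\<close> and in \<open>P + (b)\<close>, and their product in
  \<open>P + (ab)\<close>; so \<open>ab\<close> cannot be in \<open>P\<close>.\<close>

lemma exists_prime_avoiding:
  assumes I: "ideal I R" and f: "f \<in> carrier R" and av: "\<And>n::nat. f [^] n \<notin> I"
  shows "\<exists>P. primeideal P R \<and> I \<subseteq> P \<and> f \<notin> P"
proof -
  define \<A> where "\<A> = {J. ideal J R \<and> I \<subseteq> J \<and> (\<forall>n::nat. f [^] n \<notin> J)}"
  have "\<exists>U\<in>\<A>. \<forall>X\<in>C. X \<subseteq> U" if C: "subset.chain \<A> C" for C
  proof (cases "C = {}")
    \<comment> \<open>The union of the empty chain is empty, hence no ideal; \<open>I\<close> itself
      serves as its bound.\<close>
    case True
    then show ?thesis using I av by (auto simp: \<A>_def)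
  next
    case False
    have CA: "C \<subseteq> \<A>" using C by (simp add: subset_chain_def)
    have "subset.chain {J. ideal J R} C"
      using C by (auto simp: subset_chain_def \<A>_def)
    then have "ideal (\<Union>C) R" using chain_Union_is_ideal[of C] False by simp
    then have "\<Union>C \<in> \<A>" using CA False by (fastforce simp: \<A>_def)
    then show ?thesis by blast
  qed
  then obtain P where P: "P \<in> \<A>" and max: "\<And>J. J \<in> \<A> \<Longrightarrow> P \<subseteq> J \<Longrightarrow> J = P"
    using subset_Zorn[of \<A>] by (metis (no_types, lifting))
  interpret P: ideal P R using P by (simp add: \<A>_def)
  have step: "\<exists>n::nat. \<exists>p\<in>P. \<exists>x\<in>carrier R. f [^] n = p \<oplus> x \<otimes> a" if a: "a \<in> carrier R" "a \<notin> P" for a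
  proof -
    let ?J = "P <+>\<^bsub>R\<^esub> PIdl a"
    have J: "ideal ?J R" using add_ideals P.is_ideal cgenideal_ideal[OF a(1)] by blast
    have "a = \<zero> \<oplus> a" "\<zero> \<in> P" "a \<in> PIdl a"
      using a(1) cgenideal_self P.zero_closed by auto
    then have "a \<in> ?J" unfolding set_add_def' by blast
    have "p \<in> ?J" if "p \<in> P" for p
    proof -
      have "p = p \<oplus> \<zero>" using P.Icarr[OF that] by simp
      moreover have "\<zero> \<in> PIdl a"
        by (rule additive_subgroup.zero_closed[OF ideal.axioms(1)[OF cgenideal_ideal[OF a(1)]]])
      ultimately show ?thesis using that unfolding set_add_def' by blast
    qed
    then have "P \<subseteq> ?J" by blast
    have "?J \<notin> \<A>" using max[of ?J] \<open>P \<subseteq> ?J\<close> \<open>a \<in> ?J\<close> a(2) by blast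
    moreover have "I \<subseteq> ?J" using P \<open>P \<subseteq> ?J\<close> by (auto simp: \<A>_def)
    ultimately obtain n :: nat where "f [^] n \<in> ?J" using J by (auto simp: \<A>_def)
    then show ?thesis unfolding set_add_def' cgenideal_def by blast
  qed
  have "primeideal P R"
  proof (rule primeidealI)
    show "ideal P R" by (rule P.is_ideal)
    show "cring R" by (rule is_cring)
    show "carrier R \<noteq> P" using P f by (auto simp: \<A>_def)
    fix a b assume ab: "a \<in> carrier R" "b \<in> carrier R" "a \<otimes> b \<in> P"
    show "a \<in> P \<or> b \<in> P"
    proof (rule ccontr)
      assume "\<not> (a \<in> P \<or> b \<in> P)"
      then obtain n m :: nat and p q x y where
        1: "p \<in> P" "x \<in> carrier R" "f [^] n = p \<oplus> x \<otimes> a" and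
        2: "q \<in> P" "y \<in> carrier R" "f [^] m = q \<oplus> y \<otimes> b"
        using step ab by metis
      have pq: "p \<in> carrier R" "q \<in> carrier R" using 1 2 P.Icarr by auto
      have "f [^] (n + m) = (p \<oplus> x \<otimes> a) \<otimes> (q \<oplus> y \<otimes> b)"
        using 1(3) 2(3) f by (simp add: nat_pow_mult[symmetric])
      also have "\<dots> = p \<otimes> (q \<oplus> y \<otimes> b) \<oplus> (x \<otimes> a \<otimes> q \<oplus> (x \<otimes> y) \<otimes> (a \<otimes> b))"
        using 1 2 pq ab by (simp add: l_distr r_distr m_ac a_ac)
      also have "\<dots> \<in> P"
        using 1 2 pq ab P.I_r_closed[OF 1(1)] P.I_l_closed[OF 2(1)] P.I_l_closed[OF ab(3)]
        by (intro P.a_closed) auto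
      finally show False using P by (simp add: \<A>_def)
    qed
  qed
  moreover have "f \<notin> P"
  proof
    assume "f \<in> P"
    then have "f [^] (1::nat) \<in> P" using f by simp
    then show False using P unfolding \<A>_def by blast
  qed
  ultimately show ?thesis using P by (auto simp: \<A>_def)
qed

text \<open>Contrapositive of the existence of a prime avoiding \<open>f\<close>, in the form in
  which it is applied: to find a power of \<open>f\<close> in an ideal, it suffices to examine the
  primes over that ideal.\<close>

lemma in_radical:
  assumes "ideal I R" "f \<in> carrier R" "\<And>P. primeideal P R \<Longrightarrow> I \<subseteq> P \<Longrightarrow> f \<in> P"
  obtains n :: nat where "f [^] n \<in> I"
  using exists_prime_avoiding[OF assms(1,2)] assms(3) by blast

text \<open>\<open>genideal\<close> is an intersection of ideals and offers no linear combinations.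
  Instead, the elements that lie in the ideal of some finite subset of \<open>E\<close> form an
  ideal, by passing to the union of two finite sets, and this ideal contains
  \<open>E\<close>.\<close>

lemma genideal_finite:
  assumes E: "E \<subseteq> carrier R" and a: "a \<in> genideal R E"
  obtains F where "finite F" "F \<subseteq> E" "a \<in> genideal R F"
proof -
  let ?J = "{a. \<exists>F. finite F \<and> F \<subseteq> E \<and> a \<in> genideal R F}"
  have id: "ideal (genideal R F) R" if "F \<subseteq> E" for F
    using genideal_ideal that E by blast
  have mono: "genideal R F \<subseteq> genideal R F'" if "F \<subseteq> F'" "F' \<subseteq> E" for F F'
    using genideal_minimal[OF id[OF that(2)]] genideal_self[of F'] that E by blast
  have "ideal ?J R"
  proof (rule idealI)
    show "ring R" by (rule ring_axioms)
    show "subgroup ?J (add_monoid R)"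
    proof (rule group.subgroupI)
      show "group (add_monoid R)" by (rule a_group)
      show "?J \<subseteq> carrier (add_monoid R)" using ideal.Icarr[OF id] by fastforce
      have "\<zero> \<in> genideal R {}"
        by (rule additive_subgroup.zero_closed[OF ideal.axioms(1)[OF id]]) simp
      then show "?J \<noteq> {}" by blast
      show "inv\<^bsub>add_monoid R\<^esub> a \<in> ?J" if "a \<in> ?J" for a
        using that additive_subgroup.a_inv_closed[OF ideal.axioms(1)[OF id]]
        unfolding a_inv_def by blast
      fix a b assume "a \<in> ?J" "b \<in> ?J"
      then obtain F F' where F: "finite F" "F \<subseteq> E" "a \<in> genideal R F"
        "finite F'" "F' \<subseteq> E" "b \<in> genideal R F'" by blast
      then have U: "F \<union> F' \<subseteq> E" "a \<in> genideal R (F \<union> F')" "b \<in> genideal R (F \<union> F')"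
        using mono[of F "F \<union> F'"] mono[of F' "F \<union> F'"] by auto
      then have "a \<oplus> b \<in> genideal R (F \<union> F')"
        using additive_subgroup.a_closed[OF ideal.axioms(1)[OF id]] by blast
      then show "a \<otimes>\<^bsub>add_monoid R\<^esub> b \<in> ?J" using F U by auto
    qed
    fix a x assume "a \<in> ?J" "x \<in> carrier R"
    then obtain F where F: "finite F" "F \<subseteq> E" "a \<in> genideal R F" by blast
    show "x \<otimes> a \<in> ?J" "a \<otimes> x \<in> ?J"
      using F ideal.I_l_closed[OF id[OF F(2)] F(3)] ideal.I_r_closed[OF id[OF F(2)] F(3)]
        \<open>x \<in> carrier R\<close> by auto
  qed
  moreover have "E \<subseteq> ?J"
  proof
    fix e assume "e \<in> E"
    then have "e \<in> genideal R {e}" using genideal_self[of "{e}"] E by auto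
    then show "e \<in> ?J" using \<open>e \<in> E\<close> by (intro CollectI exI[of _ "{e}"]) auto
  qed
  ultimately have "a \<in> ?J" using genideal_minimal a by blast
  then show ?thesis using that by blast
qed

end

text \<open>Negatives are multiples by \<open>\<ominus> \<one>\<close>.\<close>

lemma (in cring) idealI_cring:
  assumes "J \<subseteq> carrier R" "\<zero> \<in> J" "\<And>a b. \<lbrakk>a \<in> J; b \<in> J\<rbrakk> \<Longrightarrow> a \<oplus> b \<in> J"
    "\<And>a x. \<lbrakk>a \<in> J; x \<in> carrier R\<rbrakk> \<Longrightarrow> x \<otimes> a \<in> J"
  shows "ideal J R"
proof (rule idealI)
  show "ring R" by (rule ring_axioms)
  show "subgroup J (add_monoid R)"
  proof (rule group.subgroupI)
    show "group (add_monoid R)" by (rule a_group)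
    show "J \<subseteq> carrier (add_monoid R)" "J \<noteq> {}" using assms by auto
    show "inv\<^bsub>add_monoid R\<^esub> a \<in> J" if "a \<in> J" for a
    proof -
      have "a \<in> carrier R" using that assms(1) by blast
      then have "(\<ominus> \<one>) \<otimes> a = \<ominus> a" by (simp add: l_minus)
      then show ?thesis using assms(4)[OF that, of "\<ominus> \<one>"] by (simp add: a_inv_def)
    qed
    show "a \<otimes>\<^bsub>add_monoid R\<^esub> b \<in> J" if "a \<in> J" "b \<in> J" for a b
      using assms(3)[OF that] by simp
  qed
  show "x \<otimes> a \<in> J" if "a \<in> J" "x \<in> carrier R" for a x using that assms(4) by blast
  show "a \<otimes> x \<in> J" if "a \<in> J" "x \<in> carrier R" for a x
    using that assms(4)[OF that] assms(1) by (metis m_comm subsetD)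
qed

text \<open>This ideal decides equality of fractions: \<open>x/1 = y/1\<close> in the localization
  at a prime means that it is not contained in the prime, and in the localization at
  \<open>f\<close> that it contains a power of \<open>f\<close>.\<close>

lemma (in Module.module) ideal_equalizer:
  assumes "x \<in> carrier M" "y \<in> carrier M"
  shows "ideal {t \<in> carrier R. t \<odot>\<^bsub>M\<^esub> x = t \<odot>\<^bsub>M\<^esub> y} R"
  using assms by (intro R.idealI_cring) (auto simp: smult_l_distr smult_assoc1)

lemma fractions_prime:
  fixes A :: "'r ring" and N :: "('r, 'm) module"
  assumes "Module.module A N" "primeideal P A"
  shows "fractions A N (carrier A - P)"
proof -
  interpret Module.module A N by fact
  interpret P: primeideal P A by fact
  have "\<one>\<^bsub>A\<^esub> \<notin> P" using P.one_imp_carrier P.I_notcarr by auto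
  then show ?thesis
    using assms(1) P.I_prime by (auto simp: fractions_def fractions_axioms_def)
qed

lemma fractions_powers:
  fixes A :: "'r ring" and N :: "('r, 'm) module"
  assumes "Module.module A N" "f \<in> carrier A"
  shows "fractions A N (powers A f)"
proof -
  interpret Module.module A N by fact
  have "\<one>\<^bsub>A\<^esub> \<in> powers A f" by (auto simp: powers_def intro!: exI[of _ "0::nat"])
  moreover have "s \<otimes>\<^bsub>A\<^esub> t \<in> powers A f" if "s \<in> powers A f" "t \<in> powers A f" for s t
    using that assms(2) by (auto simp: powers_def R.nat_pow_mult)
  ultimately show ?thesis
    using assms by (auto simp: fractions_def fractions_axioms_def powers_def)
qed

section \<open>Sections of the associated sheaf on a basic open set of the spectrum\<close>

definition prime_basic :: "'r ring \<Rightarrow> 'r \<Rightarrow> 'r set set" where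
  "prime_basic A f = {P. primeideal P A \<and> f \<notin> P}"

text \<open>No prime that misses \<open>f\<close> contains the equalizer ideal of \<open>x\<close>
  and \<open>y\<close>, so \<open>f\<close> lies in its radical. This passes from equality in all
  stalks over the basic open set of \<open>f\<close> to equality in the localization at
  \<open>f\<close>.\<close>

lemma (in Module.module) fraction_equality_powers:
  assumes "x \<in> carrier M" "y \<in> carrier M" "f \<in> carrier R"
    and "\<And>P. \<lbrakk>primeideal P R; f \<notin> P\<rbrakk> \<Longrightarrow> \<exists>t\<in>carrier R - P. t \<odot>\<^bsub>M\<^esub> x = t \<odot>\<^bsub>M\<^esub> y"
  obtains n :: nat where "(f [^]\<^bsub>R\<^esub> n) \<odot>\<^bsub>M\<^esub> x = (f [^]\<^bsub>R\<^esub> n) \<odot>\<^bsub>M\<^esub> y"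
proof -
  obtain n :: nat where "f [^]\<^bsub>R\<^esub> n \<in> {t \<in> carrier R. t \<odot>\<^bsub>M\<^esub> x = t \<odot>\<^bsub>M\<^esub> y}"
    by (rule R.in_radical[OF ideal_equalizer[OF assms(1,2)] assms(3)])
      (use assms(4) in blast)+
  then show ?thesis using that by blast
qed

lemma openin_zariskiE:
  assumes "cring A" "openin (zariski A) V"
  obtains G where "G \<subseteq> carrier A" "V = {P. primeideal P A \<and> \<not> G \<subseteq> P}"
proof -
  obtain G where "G \<subseteq> carrier A \<and> V = {P. primeideal P A \<and> \<not> G \<subseteq> P}"
    using assms(2) unfolding openin_zariski[OF assms(1)] by (rule exE)
  then show ?thesis using that by blast
qed

lemma tilde_locally_frac:
  assumes "s \<in> carrier (tilde A N W)" "P \<in> W"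
  obtains V m f where "openin (zariski A) V" "P \<in> V" "V \<subseteq> W" "m \<in> carrier N" "f \<in> carrier A"
    "\<forall>Q\<in>V. f \<notin> Q \<and> s Q = frac A (carrier A - Q) N m f"
proof -
  have "\<forall>P\<in>W. \<exists>V. openin (zariski A) V \<and> P \<in> V \<and> V \<subseteq> W \<and>
    (\<exists>m\<in>carrier N. \<exists>f\<in>carrier A. \<forall>Q\<in>V. f \<notin> Q \<and> s Q = frac A (carrier A - Q) N m f)"
    using assms(1) by (simp add: tilde_def Let_def)
  from bspec[OF this assms(2)] show ?thesis using that by blast
qed

lemma tilde_ext:
  assumes "s \<in> carrier (tilde A N (h ` W))" "t \<in> carrier (tilde A N (h ` W))"
    "\<And>x. x \<in> W \<Longrightarrow> s (h x) = t (h x)"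
  shows "s = t"
proof -
  have "s \<in> extensional (h ` W)" "t \<in> extensional (h ` W)"
    using assms(1,2) by (auto simp: tilde_def Let_def PiE_def)
  then show ?thesis using assms(3) by (intro extensionalityI[of s "h ` W"]) auto
qed

text \<open>
  The global numerator is found by noting that the scalars \<open>a\<close> for which \<open>a s\<close> comes from \<open>N\<close>
  (after making the local denominators \<open>h\<close> compatible by raising them to a common power) form an ideal.
\<close>

lemma tilde_prime_basic:
  fixes A :: "'r ring" and N :: "('r, 'm) module"
  assumes mod: "Module.module A N" and f: "f \<in> carrier A"
    and s: "s \<in> carrier (tilde A N (prime_basic A f))"
  obtains m and n :: nat where "m \<in> carrier N"
    "\<And>P. P \<in> prime_basic A f \<Longrightarrow> s P = frac A (carrier A - P) N m (f [^]\<^bsub>A\<^esub> n)"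
proof -
  interpret Module.module A N by fact
  note fr = fractions_prime[OF mod]
  \<comment> \<open>\<open>h\<close> belongs to \<open>E\<close> when its basic open set lies in
    that of \<open>f\<close> and \<open>s\<close> is there a single fraction with denominator
    exactly \<open>h\<close>. Such \<open>h\<close> abound: \<open>m/g\<close> on the basic open set
    of \<open>e\<close> is \<open>em/eg\<close> on that of \<open>eg\<close>.\<close>
  define E where "E = {h \<in> carrier A. \<exists>m\<in>carrier N. \<forall>P. primeideal P A \<and> h \<notin> P \<longrightarrow>
    f \<notin> P \<and> s P = frac A (carrier A - P) N m h}"
  have cover: "\<exists>h\<in>E. h \<notin> P" if P: "primeideal P A" "f \<notin> P" for P
  proof -
    have "P \<in> prime_basic A f" using P by (simp add: prime_basic_def)
    then obtain V m g where V: "openin (zariski A) V" "P \<in> V" "V \<subseteq> prime_basic A f"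
      and mg: "m \<in> carrier N" "g \<in> carrier A"
        "\<forall>Q\<in>V. g \<notin> Q \<and> s Q = frac A (carrier A - Q) N m g"
      by (rule tilde_locally_frac[OF s])
    obtain G where G: "G \<subseteq> carrier A" "V = {P. primeideal P A \<and> \<not> G \<subseteq> P}"
      by (rule openin_zariskiE[OF R.is_cring V(1)])
    then obtain e where e: "e \<in> G" "e \<notin> P" using V(2) by blast
    have eA: "e \<in> carrier A" using e G by blast
    have "e \<otimes>\<^bsub>A\<^esub> g \<notin> P" using primeideal.I_prime[OF P(1) eA mg(2)] e bspec[OF mg(3) V(2)] by blast
    moreover have "e \<otimes>\<^bsub>A\<^esub> g \<in> E"
      unfolding E_def
    proof (intro CollectI conjI bexI[of _ "e \<odot>\<^bsub>N\<^esub> m"] allI impI)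
      fix Q assume Q: "primeideal Q A \<and> e \<otimes>\<^bsub>A\<^esub> g \<notin> Q"
      interpret Q: primeideal Q A using Q by blast
      interpret FQ: fractions A N "carrier A - Q" using fr Q by blast
      have e': "e \<notin> Q" "g \<notin> Q" using Q Q.I_r_closed[OF _ mg(2)] Q.I_l_closed[OF _ eA] by blast+
      then have "Q \<in> V" using G e Q by blast
      then show "f \<notin> Q" using V(3) by (auto simp: prime_basic_def)
      have "s Q = frac A (carrier A - Q) N m g" using mg(3) \<open>Q \<in> V\<close> by blast
      also have "\<dots> = frac A (carrier A - Q) N (e \<odot>\<^bsub>N\<^esub> m) (e \<otimes>\<^bsub>A\<^esub> g)"
        using mg eA e' Q by (intro FQ.frac_eqI1) (auto simp: smult_ac)
      finally show "s Q = \<dots>" .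
    qed (use eA mg in auto)
    ultimately show ?thesis by blast
  qed
  have E: "E \<subseteq> carrier A" by (auto simp: E_def)
  obtain n :: nat where "f [^]\<^bsub>A\<^esub> n \<in> genideal A E"
  proof (rule R.in_radical[OF R.genideal_ideal[OF E] f])
    fix P assume "primeideal P A" "genideal A E \<subseteq> P"
    then show "f \<in> P" using cover R.genideal_self[OF E] by blast
  qed
  then obtain F where F: "finite F" "F \<subseteq> E" "f [^]\<^bsub>A\<^esub> n \<in> genideal A F"
    using R.genideal_finite[OF E] by blast
  have FA: "h \<in> carrier A" if "h \<in> F" for h using that F E by blast
  have coverF: "\<exists>h\<in>F. h \<notin> P" if P: "primeideal P A" "f \<notin> P" for P
  proof (rule ccontr)
    assume "\<not> ?thesis"
    then have "genideal A F \<subseteq> P"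
      using R.genideal_minimal primeideal.axioms(1)[OF P(1)] by blast
    then show False using R.ideal_pow_closed[OF P(1) f] F P(2) by blast
  qed
  have "\<forall>h\<in>F. \<exists>m. m \<in> carrier N \<and> (\<forall>P. primeideal P A \<and> h \<notin> P \<longrightarrow>
    f \<notin> P \<and> s P = frac A (carrier A - P) N m h)"
    using F(2) unfolding E_def by blast
  then obtain m where mF: "\<forall>h\<in>F. m h \<in> carrier N \<and> (\<forall>P. primeideal P A \<and> h \<notin> P \<longrightarrow>
    f \<notin> P \<and> s P = frac A (carrier A - P) N (m h) h)"
    by (rule bchoice[THEN exE])
  have m: "m h \<in> carrier N" if "h \<in> F" for h using mF that by blast
  have sm: "s P = frac A (carrier A - P) N (m h) h"
    if "h \<in> F" "primeideal P A" "h \<notin> P" for h P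
    using mF that by blast
  \<comment> \<open>On the basic open set of \<open>h h'\<close> the two fractions agree stalk by
    stalk, hence after multiplication by a power of \<open>h h'\<close>. Below, \<open>K\<close>
    bounds the finitely many exponents.\<close>
  have "\<exists>k::nat. ((h \<otimes>\<^bsub>A\<^esub> h') [^]\<^bsub>A\<^esub> k) \<odot>\<^bsub>N\<^esub> (h' \<odot>\<^bsub>N\<^esub> m h) = ((h \<otimes>\<^bsub>A\<^esub> h') [^]\<^bsub>A\<^esub> k) \<odot>\<^bsub>N\<^esub> (h \<odot>\<^bsub>N\<^esub> m h')"
    if h: "h \<in> F" "h' \<in> F" for h h'
  proof -
    note hA = FA[OF h(1)] FA[OF h(2)]
    show ?thesis
    proof (rule fraction_equality_powers[of "h' \<odot>\<^bsub>N\<^esub> m h" "h \<odot>\<^bsub>N\<^esub> m h'" "h \<otimes>\<^bsub>A\<^esub> h'"])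
      fix Q assume Q: "primeideal Q A" "h \<otimes>\<^bsub>A\<^esub> h' \<notin> Q"
      interpret Q: primeideal Q A using Q by blast
      interpret FQ: fractions A N "carrier A - Q" using fr Q by blast
      have h': "h \<notin> Q" "h' \<notin> Q"
        using Q Q.I_r_closed[OF _ hA(2)] Q.I_l_closed[OF _ hA(1)] by blast+
      then have "frac A (carrier A - Q) N (m h) h = frac A (carrier A - Q) N (m h') h'"
        using sm[OF h(1) Q(1)] sm[OF h(2) Q(1)] by simp
      then show "\<exists>t\<in>carrier A - Q. t \<odot>\<^bsub>N\<^esub> (h' \<odot>\<^bsub>N\<^esub> m h) = t \<odot>\<^bsub>N\<^esub> (h \<odot>\<^bsub>N\<^esub> m h')"
        using FQ.frac_eq_iff[of "m h" "m h'" h h'] m h hA h' by simp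
    qed (use m h hA in auto)
  qed
  then obtain k :: "'r \<Rightarrow> 'r \<Rightarrow> nat" where k: "\<And>h h'. \<lbrakk>h \<in> F; h' \<in> F\<rbrakk> \<Longrightarrow>
    ((h \<otimes>\<^bsub>A\<^esub> h') [^]\<^bsub>A\<^esub> k h h') \<odot>\<^bsub>N\<^esub> (h' \<odot>\<^bsub>N\<^esub> m h) = ((h \<otimes>\<^bsub>A\<^esub> h') [^]\<^bsub>A\<^esub> k h h') \<odot>\<^bsub>N\<^esub> (h \<odot>\<^bsub>N\<^esub> m h')"
    by metis
  have "finite ((\<lambda>(h, h'). k h h') ` (F \<times> F))" using F(1) by simp
  then obtain K where "\<forall>i \<in> (\<lambda>(h, h'). k h h') ` (F \<times> F). i \<le> K"
    using finite_nat_set_iff_bounded_le by blast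
  then have K: "k h h' \<le> K" if "h \<in> F" "h' \<in> F" for h h' using that by auto
  have compat: "(h [^]\<^bsub>A\<^esub> K) \<odot>\<^bsub>N\<^esub> (h' [^]\<^bsub>A\<^esub> K \<odot>\<^bsub>N\<^esub> (h' \<odot>\<^bsub>N\<^esub> m h)) = (h [^]\<^bsub>A\<^esub> K) \<odot>\<^bsub>N\<^esub> (h' [^]\<^bsub>A\<^esub> K \<odot>\<^bsub>N\<^esub> (h \<odot>\<^bsub>N\<^esub> m h'))"
    if h: "h \<in> F" "h' \<in> F" for h h'
  proof -
    note hA = FA[OF h(1)] FA[OF h(2)]
    have *: "((h \<otimes>\<^bsub>A\<^esub> h') [^]\<^bsub>A\<^esub> (K - k h h')) \<otimes>\<^bsub>A\<^esub> ((h \<otimes>\<^bsub>A\<^esub> h') [^]\<^bsub>A\<^esub> k h h') = (h [^]\<^bsub>A\<^esub> K) \<otimes>\<^bsub>A\<^esub> (h' [^]\<^bsub>A\<^esub> K)"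
      using K[OF h] hA by (simp add: R.nat_pow_mult R.nat_pow_distrib[symmetric])
    have "(((h \<otimes>\<^bsub>A\<^esub> h') [^]\<^bsub>A\<^esub> (K - k h h')) \<otimes>\<^bsub>A\<^esub> ((h \<otimes>\<^bsub>A\<^esub> h') [^]\<^bsub>A\<^esub> k h h')) \<odot>\<^bsub>N\<^esub> (h' \<odot>\<^bsub>N\<^esub> m h)
      = (((h \<otimes>\<^bsub>A\<^esub> h') [^]\<^bsub>A\<^esub> (K - k h h')) \<otimes>\<^bsub>A\<^esub> ((h \<otimes>\<^bsub>A\<^esub> h') [^]\<^bsub>A\<^esub> k h h')) \<odot>\<^bsub>N\<^esub> (h \<odot>\<^bsub>N\<^esub> m h')"
      using hA m h by (subst (1 2) smult_assoc1) (simp_all add: k[OF h])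
    then show ?thesis unfolding * using hA m h by (simp add: smult_assoc1)
  qed
  \<comment> \<open>Rewriting \<open>m h / h\<close> as \<open>h^K m h / h^(K+1)\<close> turns
    \<open>compat\<close> into cross relations that hold without a further factor. An element
    \<open>a\<close> is in \<open>J\<close> when \<open>a s\<close> is given by one global
    \<open>x\<close>, with respect to all these fractions at once.\<close>
  define J where "J = {a \<in> carrier A. \<exists>x\<in>carrier N. \<forall>h\<in>F.
    (h [^]\<^bsub>A\<^esub> Suc K) \<odot>\<^bsub>N\<^esub> x = a \<odot>\<^bsub>N\<^esub> ((h [^]\<^bsub>A\<^esub> K) \<odot>\<^bsub>N\<^esub> m h)}"
  have J: "ideal J A"
  proof (rule R.idealI_cring)
    show "\<zero>\<^bsub>A\<^esub> \<in> J" unfolding J_def using FA m by (auto intro!: bexI[of _ "\<zero>\<^bsub>N\<^esub>"])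
    fix a b assume "a \<in> J" "b \<in> J"
    then obtain x y where "a \<in> carrier A" "b \<in> carrier A" "x \<in> carrier N" "y \<in> carrier N"
      "\<forall>h\<in>F. (h [^]\<^bsub>A\<^esub> Suc K) \<odot>\<^bsub>N\<^esub> x = a \<odot>\<^bsub>N\<^esub> ((h [^]\<^bsub>A\<^esub> K) \<odot>\<^bsub>N\<^esub> m h)"
      "\<forall>h\<in>F. (h [^]\<^bsub>A\<^esub> Suc K) \<odot>\<^bsub>N\<^esub> y = b \<odot>\<^bsub>N\<^esub> ((h [^]\<^bsub>A\<^esub> K) \<odot>\<^bsub>N\<^esub> m h)"
      unfolding J_def by blast
    then show "a \<oplus>\<^bsub>A\<^esub> b \<in> J"
      unfolding J_def using FA m
      by (intro CollectI conjI bexI[of _ "x \<oplus>\<^bsub>N\<^esub> y"]) (simp_all add: smult_l_distr smult_r_distr)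
  next
    fix a b assume "a \<in> J" and b: "b \<in> carrier A"
    then obtain x where x: "a \<in> carrier A" "x \<in> carrier N"
      "\<forall>h\<in>F. (h [^]\<^bsub>A\<^esub> Suc K) \<odot>\<^bsub>N\<^esub> x = a \<odot>\<^bsub>N\<^esub> ((h [^]\<^bsub>A\<^esub> K) \<odot>\<^bsub>N\<^esub> m h)"
      unfolding J_def by blast
    then show "b \<otimes>\<^bsub>A\<^esub> a \<in> J"
      unfolding J_def using FA m b
      by (intro CollectI conjI bexI[of _ "b \<odot>\<^bsub>N\<^esub> x"])
        (simp_all add: smult_lcomm[of _ b x] smult_assoc1[of b a] del: R.nat_pow_Suc)
  qed (simp add: J_def)
  \<comment> \<open>For \<open>a = h^(K+1)\<close> the global numerator is \<open>h^K m h\<close>,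
    by \<open>compat\<close>.\<close>
  have FJ: "h [^]\<^bsub>A\<^esub> Suc K \<in> J" if h: "h \<in> F" for h
    unfolding J_def
  proof (intro CollectI conjI bexI[of _ "(h [^]\<^bsub>A\<^esub> K) \<odot>\<^bsub>N\<^esub> m h"] ballI)
    fix h' assume h': "h' \<in> F"
    show "(h' [^]\<^bsub>A\<^esub> Suc K) \<odot>\<^bsub>N\<^esub> ((h [^]\<^bsub>A\<^esub> K) \<odot>\<^bsub>N\<^esub> m h) = (h [^]\<^bsub>A\<^esub> Suc K) \<odot>\<^bsub>N\<^esub> ((h' [^]\<^bsub>A\<^esub> K) \<odot>\<^bsub>N\<^esub> m h')"
      using compat[OF h h'] FA[OF h] FA[OF h'] m[OF h] m[OF h']
      by (simp add: smult_ac)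
  qed (use FA m h in auto)
  \<comment> \<open>A prime over \<open>J\<close> contains every \<open>h\<close> in
    \<open>F\<close> by \<open>FJ\<close>, hence contains \<open>f\<close> by \<open>coverF\<close>.
    The numerator \<open>x\<close> of \<open>f^p s\<close> then gives
    \<open>s = x / f^p\<close>.\<close>
  obtain p :: nat where "f [^]\<^bsub>A\<^esub> p \<in> J"
  proof (rule R.in_radical[OF J f])
    fix P assume P: "primeideal P A" "J \<subseteq> P"
    show "f \<in> P"
    proof (rule ccontr)
      assume "f \<notin> P"
      then obtain h where "h \<in> F" "h \<notin> P" using coverF P by blast
      then show False using R.ideal_pow_closed[OF P(1) FA, of h "Suc K"] FJ P by blast
    qed
  qed
  then obtain x where x: "x \<in> carrier N"
    "\<And>h. h \<in> F \<Longrightarrow> (h [^]\<^bsub>A\<^esub> Suc K) \<odot>\<^bsub>N\<^esub> x = (f [^]\<^bsub>A\<^esub> p) \<odot>\<^bsub>N\<^esub> ((h [^]\<^bsub>A\<^esub> K) \<odot>\<^bsub>N\<^esub> m h)"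
    unfolding J_def by blast
  show ?thesis
  proof (rule that[OF x(1)])
    fix P assume "P \<in> prime_basic A f"
    then have P: "primeideal P A" "f \<notin> P" by (auto simp: prime_basic_def)
    then obtain h where h: "h \<in> F" "h \<notin> P" using coverF by blast
    interpret FP: fractions A N "carrier A - P" using fr P by blast
    have "s P = frac A (carrier A - P) N (m h) h" using sm h P by blast
    also have "\<dots> = frac A (carrier A - P) N x (f [^]\<^bsub>A\<^esub> p)"
    proof (rule FP.frac_eqI)
      note hA = FA[OF h(1)]
      have "q [^]\<^bsub>A\<^esub> i \<in> carrier A - P" if "q \<in> carrier A" "q \<notin> P" for q and i :: nat
        using that R.ideal_pow_closed[OF P(1), of q i] by auto
      then show "h [^]\<^bsub>A\<^esub> K \<in> carrier A - P" "f [^]\<^bsub>A\<^esub> p \<in> carrier A - P"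
        using hA h(2) f P(2) by simp_all
      show "(h [^]\<^bsub>A\<^esub> K) \<odot>\<^bsub>N\<^esub> ((f [^]\<^bsub>A\<^esub> p) \<odot>\<^bsub>N\<^esub> m h) = (h [^]\<^bsub>A\<^esub> K) \<odot>\<^bsub>N\<^esub> (h \<odot>\<^bsub>N\<^esub> x)"
        using x(1) x(2)[OF h(1)] hA m[OF h(1)] f by (simp add: smult_ac)
      show "m h \<in> carrier N" "x \<in> carrier N" "h \<in> carrier A - P"
        using m[OF h(1)] x(1) hA h(2) by simp_all
    qed
    finally show "s P = \<dots>" .
  qed
qed

section \<open>Sheaf axioms for indexed families of sections\<close>

lemma
  assumes sh: "is_sheaf T F res"
  shows is_sheaf_closed: "\<lbrakk>openin T U; openin T V; V \<subseteq> U; x \<in> F U\<rbrakk> \<Longrightarrow> res U V x \<in> F V"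
    and is_sheaf_id: "\<lbrakk>openin T U; x \<in> F U\<rbrakk> \<Longrightarrow> res U U x = x"
    and is_sheaf_comp: "\<lbrakk>openin T U; openin T V; openin T W; W \<subseteq> V; V \<subseteq> U; x \<in> F U\<rbrakk> \<Longrightarrow>
      res V W (res U V x) = res U W x"
    and is_sheaf_ex1: "\<lbrakk>\<forall>W\<in>\<W>. openin T W \<and> s W \<in> F W;
      \<forall>W\<in>\<W>. \<forall>W'\<in>\<W>. res W (W \<inter> W') (s W) = res W' (W \<inter> W') (s W')\<rbrakk> \<Longrightarrow>
      \<exists>!t. t \<in> F (\<Union>\<W>) \<and> (\<forall>W\<in>\<W>. res (\<Union>\<W>) W t = s W)"
proof -
  note c = iffD1[OF is_sheaf_def sh]
  note c1 = conjunct1[OF c] and c2 = conjunct1[OF conjunct2[OF c]]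
    and c3 = conjunct1[OF conjunct2[OF conjunct2[OF c]]]
    and c4 = conjunct2[OF conjunct2[OF conjunct2[OF c]]]
  show "\<lbrakk>openin T U; openin T V; V \<subseteq> U; x \<in> F U\<rbrakk> \<Longrightarrow> res U V x \<in> F V"
    using c1 by blast
  show "\<lbrakk>openin T U; x \<in> F U\<rbrakk> \<Longrightarrow> res U U x = x" using c2 by simp
  show "\<lbrakk>openin T U; openin T V; openin T W; W \<subseteq> V; V \<subseteq> U; x \<in> F U\<rbrakk> \<Longrightarrow>
      res V W (res U V x) = res U W x" using c3 by simp
  show "\<lbrakk>\<forall>W\<in>\<W>. openin T W \<and> s W \<in> F W;
      \<forall>W\<in>\<W>. \<forall>W'\<in>\<W>. res W (W \<inter> W') (s W) = res W' (W \<inter> W') (s W')\<rbrakk> \<Longrightarrow>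
      \<exists>!t. t \<in> F (\<Union>\<W>) \<and> (\<forall>W\<in>\<W>. res (\<Union>\<W>) W t = s W)"
    using c4[rule_format, of \<W> s] by simp
qed

text \<open>In \<open>is_sheaf\<close> the local sections are indexed by the open sets themselves.
  For an arbitrary index set the same open set may occur twice; compatibility on
  \<open>W i = W j\<close> then forces \<open>s i = s j\<close>, so an index may be chosen for each
  set.\<close>

lemma is_sheaf_glue:
  assumes sh: "is_sheaf T F res" and I: "\<And>i. i \<in> I \<Longrightarrow> openin T (W i)" "\<And>i. i \<in> I \<Longrightarrow> s i \<in> F (W i)"
    and compat: "\<And>i j. \<lbrakk>i \<in> I; j \<in> I\<rbrakk> \<Longrightarrow> res (W i) (W i \<inter> W j) (s i) = res (W j) (W i \<inter> W j) (s j)"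
  shows "\<exists>!t. t \<in> F (\<Union>i\<in>I. W i) \<and> (\<forall>i\<in>I. res (\<Union>i\<in>I. W i) (W i) t = s i)"
proof -
  define s' where "s' w = s (SOME i. i \<in> I \<and> W i = w)" for w
  have s': "s' (W i) = s i" if i: "i \<in> I" for i
  proof -
    define j where "j = (SOME j. j \<in> I \<and> W j = W i)"
    have "j \<in> I \<and> W j = W i" unfolding j_def by (rule someI[of _ i]) (use i in simp)
    then show ?thesis using compat[of i j] is_sheaf_id[OF sh I] i unfolding s'_def j_def[symmetric]
      by (metis Int_absorb)
  qed
  have "\<forall>w\<in>W ` I. openin T w \<and> s' w \<in> F w" using I s' by auto
  moreover have "\<forall>w\<in>W ` I. \<forall>w'\<in>W ` I. res w (w \<inter> w') (s' w) = res w' (w \<inter> w') (s' w')"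
    using s' by (auto intro: compat)
  ultimately have "\<exists>!t. t \<in> F (\<Union>(W ` I)) \<and> (\<forall>w\<in>W ` I. res (\<Union>(W ` I)) w t = s' w)"
    by (rule is_sheaf_ex1[OF sh])
  then show ?thesis using s' by simp
qed

text \<open>Uniqueness of gluing is applied to the family of restrictions of \<open>s\<close>, which
  both \<open>s\<close> and \<open>t\<close> glue.\<close>

lemma is_sheaf_unique:
  assumes sh: "is_sheaf T F res" and "\<And>i. i \<in> I \<Longrightarrow> openin T (W i)" "U = (\<Union>i\<in>I. W i)"
    and "s \<in> F U" "t \<in> F U"
    and eq: "\<And>i. i \<in> I \<Longrightarrow> res U (W i) s = res U (W i) t"
  shows "s = t"
proof -
  have U: "openin T U" using assms by auto
  have r: "res U (W i) s \<in> F (W i)" if "i \<in> I" for i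
    using is_sheaf_closed[OF sh U assms(2)[OF that] _ assms(4)] assms(3) that by blast
  have c: "res V W' (res U V s) = res U W' s" if "openin T V" "openin T W'" "W' \<subseteq> V" "V \<subseteq> U" for V W'
    using is_sheaf_comp[OF sh U _ _ _ _ assms(4)] that by blast
  have "\<exists>!t. t \<in> F (\<Union>i\<in>I. W i) \<and> (\<forall>i\<in>I. res (\<Union>i\<in>I. W i) (W i) t = res U (W i) s)"
  proof (rule is_sheaf_glue[OF sh assms(2) r])
    fix i j assume "i \<in> I" "j \<in> I"
    then have "openin T (W i)" "openin T (W j)" "W i \<subseteq> U" "W j \<subseteq> U" using assms(2,3) by auto
    then show "res (W i) (W i \<inter> W j) (res U (W i) s) = res (W j) (W i \<inter> W j) (res U (W j) s)"
      by (subst (1 2) c) auto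
  qed
  then show ?thesis using assms(4,5) eq unfolding assms(3)[symmetric] by metis
qed

lemma (in comm_monoid) Units_factor:
  assumes "a \<in> carrier G" "b \<in> carrier G" "a \<otimes> b \<in> Units G"
  shows "a \<in> Units G"
proof -
  obtain c where c: "c \<in> carrier G" "c \<otimes> (a \<otimes> b) = \<one>" using assms(3) by (auto simp: Units_def)
  then have "(c \<otimes> b) \<otimes> a = \<one>" using assms by (simp add: m_ac)
  then show ?thesis using assms c unfolding Units_def
    by (auto intro!: bexI[of _ "c \<otimes> b"] simp: m_ac)
qed

lemma ring_hom_Units:
  assumes "cring R" "cring S" "h \<in> ring_hom R S" "u \<in> Units R"
  shows "h u \<in> Units S" "h (inv\<^bsub>R\<^esub> u) = inv\<^bsub>S\<^esub> (h u)"
proof -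
  interpret R: cring R by fact
  interpret S: cring S by fact
  have u: "u \<in> carrier R" "inv\<^bsub>R\<^esub> u \<in> carrier R" "inv\<^bsub>R\<^esub> u \<otimes>\<^bsub>R\<^esub> u = \<one>\<^bsub>R\<^esub>" using assms(4) by auto
  have 1: "h (inv\<^bsub>R\<^esub> u) \<otimes>\<^bsub>S\<^esub> h u = \<one>\<^bsub>S\<^esub>"
    using u assms(3) by (metis ring_hom_mult ring_hom_one)
  have c: "h u \<in> carrier S" "h (inv\<^bsub>R\<^esub> u) \<in> carrier S" using u assms(3) by (auto simp: ring_hom_closed)
  show U: "h u \<in> Units S" using 1 c S.m_comm unfolding Units_def by force
  show "h (inv\<^bsub>R\<^esub> u) = inv\<^bsub>S\<^esub> (h u)" using 1 c S.inv_char S.m_comm by metis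
qed

section \<open>Basic open sets of a ringed space\<close>

locale ringed =
  fixes X :: "('x, 'r) ringed_space"
  assumes ringed: "is_ringed_space X"
begin

abbreviation opn :: "'x set \<Rightarrow> bool" where "opn U \<equiv> openin (top_of X) U"
abbreviation D :: "'x set \<Rightarrow> 'r \<Rightarrow> 'x set" where "D U f \<equiv> basic_open X U f"

lemma sec_cring: "opn U \<Longrightarrow> cring (sec X U)"
  and rres_hom: "\<lbrakk>opn U; opn V; V \<subseteq> U\<rbrakk> \<Longrightarrow> rres X U V \<in> ring_hom (sec X U) (sec X V)"
  and sec_sheaf: "is_sheaf (top_of X) (\<lambda>U. carrier (sec X U)) (rres X)"
  using ringed by (auto simp: is_ringed_space_def)

lemma rres_id: "\<lbrakk>opn U; a \<in> carrier (sec X U)\<rbrakk> \<Longrightarrow> rres X U U a = a"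
  by (rule is_sheaf_id[OF sec_sheaf])

lemma rres_comp: "\<lbrakk>opn U; opn V; opn W; W \<subseteq> V; V \<subseteq> U; a \<in> carrier (sec X U)\<rbrakk>
    \<Longrightarrow> rres X V W (rres X U V a) = rres X U W a"
  by (rule is_sheaf_comp[OF sec_sheaf])

lemma
  assumes "opn U" "opn V" "V \<subseteq> U"
  shows rres_closed: "a \<in> carrier (sec X U) \<Longrightarrow> rres X U V a \<in> carrier (sec X V)"
    and rres_mult: "\<lbrakk>a \<in> carrier (sec X U); b \<in> carrier (sec X U)\<rbrakk> \<Longrightarrow>
      rres X U V (a \<otimes>\<^bsub>sec X U\<^esub> b) = rres X U V a \<otimes>\<^bsub>sec X V\<^esub> rres X U V b"
    and rres_add: "\<lbrakk>a \<in> carrier (sec X U); b \<in> carrier (sec X U)\<rbrakk> \<Longrightarrow>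
      rres X U V (a \<oplus>\<^bsub>sec X U\<^esub> b) = rres X U V a \<oplus>\<^bsub>sec X V\<^esub> rres X U V b"
    and rres_one: "rres X U V \<one>\<^bsub>sec X U\<^esub> = \<one>\<^bsub>sec X V\<^esub>"
    and rres_pow: "a \<in> carrier (sec X U) \<Longrightarrow>
      rres X U V (a [^]\<^bsub>sec X U\<^esub> (n::nat)) = rres X U V a [^]\<^bsub>sec X V\<^esub> n"
    and rres_zero: "rres X U V \<zero>\<^bsub>sec X U\<^esub> = \<zero>\<^bsub>sec X V\<^esub>"
    and rres_Units: "a \<in> Units (sec X U) \<Longrightarrow> rres X U V a \<in> Units (sec X V)"
    and rres_inv: "a \<in> Units (sec X U) \<Longrightarrow> rres X U V (inv\<^bsub>sec X U\<^esub> a) = inv\<^bsub>sec X V\<^esub> rres X U V a"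
proof -
  note h = rres_hom[OF assms]
  show "a \<in> carrier (sec X U) \<Longrightarrow> rres X U V a \<in> carrier (sec X V)"
    "\<lbrakk>a \<in> carrier (sec X U); b \<in> carrier (sec X U)\<rbrakk> \<Longrightarrow>
      rres X U V (a \<otimes>\<^bsub>sec X U\<^esub> b) = rres X U V a \<otimes>\<^bsub>sec X V\<^esub> rres X U V b"
    "\<lbrakk>a \<in> carrier (sec X U); b \<in> carrier (sec X U)\<rbrakk> \<Longrightarrow>
      rres X U V (a \<oplus>\<^bsub>sec X U\<^esub> b) = rres X U V a \<oplus>\<^bsub>sec X V\<^esub> rres X U V b"
    "rres X U V \<one>\<^bsub>sec X U\<^esub> = \<one>\<^bsub>sec X V\<^esub>"
    using ring_hom_closed[OF h] ring_hom_mult[OF h] ring_hom_add[OF h] ring_hom_one[OF h] by auto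
  interpret H: ring_hom_cring "sec X U" "sec X V" "rres X U V"
    using h sec_cring assms by (simp add: ring_hom_cring_def ring_hom_cring_axioms_def)
  show "a \<in> carrier (sec X U) \<Longrightarrow>
      rres X U V (a [^]\<^bsub>sec X U\<^esub> (n::nat)) = rres X U V a [^]\<^bsub>sec X V\<^esub> n"
    by (induction n) (simp_all add: H.hom_mult)
  show "rres X U V \<zero>\<^bsub>sec X U\<^esub> = \<zero>\<^bsub>sec X V\<^esub>" by (rule H.hom_zero)
  show "a \<in> Units (sec X U) \<Longrightarrow> rres X U V a \<in> Units (sec X V)"
    "a \<in> Units (sec X U) \<Longrightarrow> rres X U V (inv\<^bsub>sec X U\<^esub> a) = inv\<^bsub>sec X V\<^esub> rres X U V a"
    using ring_hom_Units[OF sec_cring sec_cring h] assms by auto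
qed

lemmas rres_simps = rres_closed rres_mult rres_add rres_one rres_pow rres_zero rres_comp rres_id

lemma D_subset: "D U f \<subseteq> U"
  by (auto simp: basic_open_def)

lemma D_open: "opn (D U f)"
proof -
  have "D U f = \<Union>{W. opn W \<and> W \<subseteq> U \<and> rres X U W f \<in> Units (sec X W)}"
    by (auto simp: basic_open_def)
  then show ?thesis by (metis (no_types, lifting) mem_Collect_eq openin_Union)
qed

lemma D_I: "\<lbrakk>opn W; x \<in> W; W \<subseteq> U; rres X U W f \<in> Units (sec X W)\<rbrakk> \<Longrightarrow> x \<in> D U f"
  by (auto simp: basic_open_def)

text \<open>Inverses are unique and restrict to inverses, so the local inverses of \<open>f\<close>
  agree on overlaps and glue to an inverse on the whole of \<open>D U f\<close>.\<close>

lemma Units_D: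
  assumes U: "opn U" and f: "f \<in> carrier (sec X U)"
  shows "rres X U (D U f) f \<in> Units (sec X (D U f))"
proof -
  define I where "I = {W. opn W \<and> W \<subseteq> U \<and> rres X U W f \<in> Units (sec X W)}"
  have un: "D U f = (\<Union>W\<in>I. W)" by (auto simp: basic_open_def I_def)
  have I: "opn W" "W \<subseteq> U" "rres X U W f \<in> Units (sec X W)" if "W \<in> I" for W
    using that by (auto simp: I_def)
  let ?s = "\<lambda>W. inv\<^bsub>sec X W\<^esub> (rres X U W f)"
  have sI: "?s W \<in> carrier (sec X W)" if "W \<in> I" for W
    using monoid.Units_inv_closed[of "sec X W"] sec_cring I[OF that]
    by (simp add: cring.axioms(1) ring.is_monoid)
  have "\<exists>!t. t \<in> carrier (sec X (\<Union>W\<in>I. W)) \<and> (\<forall>W\<in>I. rres X (\<Union>W\<in>I. W) W t = ?s W)"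
  proof (rule is_sheaf_glue[OF sec_sheaf])
    show "opn W" "?s W \<in> carrier (sec X W)" if "W \<in> I" for W using I sI that by auto
    show "rres X W (W \<inter> W') (?s W) = rres X W' (W \<inter> W') (?s W')" if "W \<in> I" "W' \<in> I" for W W'
    proof -
      have *: "opn (W \<inter> W')" "W \<inter> W' \<subseteq> W" "W \<inter> W' \<subseteq> W'" using I that by auto
      show ?thesis
        using rres_inv[OF I(1) *(1,2) I(3)] rres_inv[OF I(1) *(1,3) I(3)] that
          rres_comp[OF U I(1) *(1,2) I(2) f] rres_comp[OF U I(1) *(1,3) I(2) f]
        by simp
    qed
  qed
  then obtain t where t: "t \<in> carrier (sec X (D U f))" "\<And>W. W \<in> I \<Longrightarrow> rres X (D U f) W t = ?s W"
    unfolding un[symmetric] by blast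
  interpret cring "sec X (D U f)" by (rule sec_cring[OF D_open])
  have fD: "rres X U (D U f) f \<in> carrier (sec X (D U f))"
    by (rule rres_closed[OF U D_open D_subset f])
  have "t \<otimes>\<^bsub>sec X (D U f)\<^esub> rres X U (D U f) f = \<one>\<^bsub>sec X (D U f)\<^esub>"
  proof (rule is_sheaf_unique[OF sec_sheaf I(1) un])
    fix W assume W: "W \<in> I"
    then have WD: "W \<subseteq> D U f" using un by blast
    interpret W: cring "sec X W" using sec_cring I W by blast
    have "rres X (D U f) W (t \<otimes>\<^bsub>sec X (D U f)\<^esub> rres X U (D U f) f) = ?s W \<otimes>\<^bsub>sec X W\<^esub> rres X U W f"
      using rres_mult[OF D_open I(1)[OF W] WD t(1) fD] t(2)[OF W]
        rres_comp[OF U D_open I(1)[OF W] WD D_subset f] by simp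
    also have "\<dots> = \<one>\<^bsub>sec X W\<^esub>" using I(3)[OF W] by simp
    also have "\<dots> = rres X (D U f) W \<one>\<^bsub>sec X (D U f)\<^esub>"
      using rres_one[OF D_open I(1)[OF W] WD] by simp
    finally show "rres X (D U f) W (t \<otimes>\<^bsub>sec X (D U f)\<^esub> rres X U (D U f) f) = \<dots>" .
  qed (use t fD in auto)
  then show ?thesis using t fD m_comm unfolding Units_def by force
qed

text \<open>For the inclusion from right to left the neighborhood is \<open>V \<inter> D U f\<close>
  itself, \<open>f\<close> being invertible on all of \<open>D U f\<close>.\<close>

lemma D_rres:
  assumes "opn U" "opn V" "V \<subseteq> U" "f \<in> carrier (sec X U)"
  shows "D V (rres X U V f) = V \<inter> D U f"
proof
  show "D V (rres X U V f) \<subseteq> V \<inter> D U f"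
    using assms(3) rres_comp[OF assms(1,2) _ _ assms(3,4)] unfolding basic_open_def by fastforce
  show "V \<inter> D U f \<subseteq> D V (rres X U V f)"
  proof
    fix x assume x: "x \<in> V \<inter> D U f"
    let ?W = "V \<inter> D U f"
    have W: "opn ?W" using assms D_open by blast
    have "rres X (D U f) ?W (rres X U (D U f) f) \<in> Units (sec X ?W)"
      using Units_D[OF assms(1,4)] by (intro rres_Units[OF D_open W]) auto
    then have "rres X V ?W (rres X U V f) \<in> Units (sec X ?W)"
      using rres_comp[OF assms(1) D_open W _ D_subset assms(4)] rres_comp[OF assms(1,2) W _ assms(3,4)]
      by simp
    then show "x \<in> D V (rres X U V f)" using x W by (intro D_I[of ?W]) auto
  qed
qed

lemma D_mult:
  assumes "opn U" "f \<in> carrier (sec X U)" "g \<in> carrier (sec X U)"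
  shows "D U (f \<otimes>\<^bsub>sec X U\<^esub> g) = D U f \<inter> D U g"
proof (intro equalityI subsetI)
  fix x assume "x \<in> D U (f \<otimes>\<^bsub>sec X U\<^esub> g)"
  then obtain W where W: "opn W" "x \<in> W" "W \<subseteq> U" "rres X U W (f \<otimes>\<^bsub>sec X U\<^esub> g) \<in> Units (sec X W)"
    by (auto simp: basic_open_def)
  interpret W: cring "sec X W" using sec_cring W by blast
  have "rres X U W f \<in> Units (sec X W)" "rres X U W g \<in> Units (sec X W)"
    using W assms W.Units_factor[of "rres X U W f" "rres X U W g"]
      W.Units_factor[of "rres X U W g" "rres X U W f"]
    by (simp_all add: rres_mult rres_closed W.m_comm)
  then show "x \<in> D U f \<inter> D U g" using W by (auto intro: D_I)
next
  fix x assume x: "x \<in> D U f \<inter> D U g"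
  let ?W = "D U f \<inter> D U g"
  have W: "opn ?W" using D_open by blast
  interpret W: cring "sec X ?W" using sec_cring W by blast
  have "rres X (D U f) ?W (rres X U (D U f) f) \<in> Units (sec X ?W)"
    "rres X (D U g) ?W (rres X U (D U g) g) \<in> Units (sec X ?W)"
    using Units_D assms by (auto intro!: rres_Units[OF D_open W])
  then have "rres X U ?W f \<in> Units (sec X ?W)" "rres X U ?W g \<in> Units (sec X ?W)"
    using rres_comp[OF assms(1) D_open W _ D_subset] assms by auto
  then have "rres X U ?W (f \<otimes>\<^bsub>sec X U\<^esub> g) \<in> Units (sec X ?W)"
    using rres_mult[OF assms(1) W _ assms(2,3)] D_subset[of U f] by (simp add: le_infI1)
  then show "x \<in> D U (f \<otimes>\<^bsub>sec X U\<^esub> g)" using x W D_subset by (intro D_I[of ?W]) auto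
qed

lemma D_Units: "\<lbrakk>opn U; u \<in> Units (sec X U)\<rbrakk> \<Longrightarrow> D U u = U"
proof -
  assume a: "opn U" "u \<in> Units (sec X U)"
  then have "rres X U U u = u" using rres_id by (simp add: Units_def)
  then have "U \<subseteq> D U u" using D_I[of U _ U u] a by auto
  then show "D U u = U" using D_subset[of U u] by blast
qed

lemma D_one: "opn U \<Longrightarrow> D U \<one>\<^bsub>sec X U\<^esub> = U"
  using D_Units[of U] monoid.Units_one_closed[of "sec X U"] sec_cring[of U]
  by (simp add: cring.axioms(1) ring.is_monoid)

lemma D_Units_mult:
  assumes "opn U" "u \<in> Units (sec X U)" "f \<in> carrier (sec X U)"
  shows "D U (u \<otimes>\<^bsub>sec X U\<^esub> f) = D U f"
  using D_mult[OF assms(1) _ assms(3), of u] D_Units[OF assms(1,2)] D_subset[of U f] assms(2)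
  by (auto simp: Units_def)

end

section \<open>Sections over basic open sets as fractions of sections\<close>

definition struct_module :: "('x, 'r) ringed_space \<Rightarrow> ('x, 'r, 'r) module_sheaf" where
  "struct_module X = \<lparr>msec = (\<lambda>U. self_module (sec X U)), mres = rres X\<rparr>"

text \<open>\<open>M(U)\<^sub>f = M(U\<^sub>f)\<close> for all \<open>f\<close>, stated without forming the localization.\<close>

definition localizes :: "('x, 'r) ringed_space \<Rightarrow> ('x, 'r, 'm) module_sheaf \<Rightarrow> 'x set \<Rightarrow> bool" where
  "localizes X M U \<longleftrightarrow> (\<forall>f\<in>carrier (sec X U).
     (\<forall>s\<in>carrier (msec M U). \<forall>s'\<in>carrier (msec M U).
        mres M U (basic_open X U f) s = mres M U (basic_open X U f) s' \<longrightarrow>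
        (\<exists>n::nat. f [^]\<^bsub>sec X U\<^esub> n \<odot>\<^bsub>msec M U\<^esub> s = f [^]\<^bsub>sec X U\<^esub> n \<odot>\<^bsub>msec M U\<^esub> s')) \<and>
     (\<forall>t\<in>carrier (msec M (basic_open X U f)). \<exists>n::nat. \<exists>s\<in>carrier (msec M U).
        mres M U (basic_open X U f) s =
          rres X U (basic_open X U f) f [^]\<^bsub>sec X (basic_open X U f)\<^esub> n \<odot>\<^bsub>msec M (basic_open X U f)\<^esub> t))"

lemma localizes_eq:
  assumes "localizes X M U" "f \<in> carrier (sec X U)" "s \<in> carrier (msec M U)" "s' \<in> carrier (msec M U)"
    "mres M U (basic_open X U f) s = mres M U (basic_open X U f) s'"
  obtains n :: nat where "f [^]\<^bsub>sec X U\<^esub> n \<odot>\<^bsub>msec M U\<^esub> s = f [^]\<^bsub>sec X U\<^esub> n \<odot>\<^bsub>msec M U\<^esub> s'"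
  using assms unfolding localizes_def by blast

lemma localizes_ext:
  assumes "localizes X M U" "f \<in> carrier (sec X U)" "t \<in> carrier (msec M (basic_open X U f))"
  obtains n :: nat and s where "s \<in> carrier (msec M U)"
    "mres M U (basic_open X U f) s = rres X U (basic_open X U f) f [^]\<^bsub>sec X (basic_open X U f)\<^esub> n
      \<odot>\<^bsub>msec M (basic_open X U f)\<^esub> t"
  using assms unfolding localizes_def by blast

locale module_sheaf_on = ringed X for X :: "('x, 'r) ringed_space" +
  fixes M :: "('x, 'r, 'm) module_sheaf"
  assumes module_sheaf: "is_module_sheaf X M"
begin

lemma msec_module: "opn U \<Longrightarrow> Module.module (sec X U) (msec M U)"
  and msec_sheaf: "is_sheaf (top_of X) (\<lambda>U. carrier (msec M U)) (mres M)"
  using module_sheaf by (auto simp: is_module_sheaf_def)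

lemma
  assumes "opn U" "opn V" "V \<subseteq> U"
  shows mres_closed: "s \<in> carrier (msec M U) \<Longrightarrow> mres M U V s \<in> carrier (msec M V)"
    and mres_add: "\<lbrakk>s \<in> carrier (msec M U); t \<in> carrier (msec M U)\<rbrakk> \<Longrightarrow>
      mres M U V (s \<oplus>\<^bsub>msec M U\<^esub> t) = mres M U V s \<oplus>\<^bsub>msec M V\<^esub> mres M U V t"
    and mres_smult: "\<lbrakk>a \<in> carrier (sec X U); s \<in> carrier (msec M U)\<rbrakk> \<Longrightarrow>
      mres M U V (a \<odot>\<^bsub>msec M U\<^esub> s) = rres X U V a \<odot>\<^bsub>msec M V\<^esub> mres M U V s"
proof -
  note ms = module_sheaf[unfolded is_module_sheaf_def, THEN conjunct2, THEN conjunct1, THEN spec, THEN spec, THEN mp, of U V]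
  note ms = ms[OF conjI[OF assms(1) conjI[OF assms(2,3)]]]
  show c: "s \<in> carrier (msec M U) \<Longrightarrow> mres M U V s \<in> carrier (msec M V)" for s
    by (rule is_sheaf_closed[OF msec_sheaf assms])
  show "\<lbrakk>s \<in> carrier (msec M U); t \<in> carrier (msec M U)\<rbrakk> \<Longrightarrow>
      mres M U V (s \<oplus>\<^bsub>msec M U\<^esub> t) = mres M U V s \<oplus>\<^bsub>msec M V\<^esub> mres M U V t"
    using ms by blast
  show sm: "\<lbrakk>a \<in> carrier (sec X U); s \<in> carrier (msec M U)\<rbrakk> \<Longrightarrow>
      mres M U V (a \<odot>\<^bsub>msec M U\<^esub> s) = rres X U V a \<odot>\<^bsub>msec M V\<^esub> mres M U V s" for a s
    using ms by blast
qed

lemma mres_id: "\<lbrakk>opn U; s \<in> carrier (msec M U)\<rbrakk> \<Longrightarrow> mres M U U s = s"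
  by (rule is_sheaf_id[OF msec_sheaf])

lemma mres_comp: "\<lbrakk>opn U; opn V; opn W; W \<subseteq> V; V \<subseteq> U; s \<in> carrier (msec M U)\<rbrakk>
    \<Longrightarrow> mres M V W (mres M U V s) = mres M U W s"
  by (rule is_sheaf_comp[OF msec_sheaf])

end

context ringed
begin

lemma struct_module_sheaf: "module_sheaf_on X (struct_module X)"
  using ringed sec_sheaf
  by unfold_locales
    (auto simp: is_module_sheaf_def struct_module_def module_self_module sec_cring rres_simps)

text \<open>Clearing the denominator of \<open>f\<close> gives an \<open>a\<close> over
  \<open>U\<close> that restricts to \<open>f\<close> times a power of the unit \<open>g\<close>.
  Unit factors do not change basic open sets, so a basic open subset of \<open>D U g\<close> is
  again basic in \<open>U\<close>.\<close>

lemma D_D: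
  assumes U: "opn U" and O: "localizes X (struct_module X) U" and g: "g \<in> carrier (sec X U)"
    and f: "f \<in> carrier (sec X (D U g))"
  obtains a and n :: nat where "a \<in> carrier (sec X U)"
    "rres X U (D U g) a = rres X U (D U g) g [^]\<^bsub>sec X (D U g)\<^esub> n \<otimes>\<^bsub>sec X (D U g)\<^esub> f"
    "D (D U g) f = D U (g \<otimes>\<^bsub>sec X U\<^esub> a)" "D (D U g) f = D U g \<inter> D U a"
proof -
  obtain a and n :: nat where a: "a \<in> carrier (sec X U)"
    "rres X U (D U g) a = rres X U (D U g) g [^]\<^bsub>sec X (D U g)\<^esub> n \<otimes>\<^bsub>sec X (D U g)\<^esub> f"
    by (rule localizes_ext[OF O g, of f]) (simp_all add: struct_module_def f)
  interpret V: cring "sec X (D U g)" by (rule sec_cring[OF D_open])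
  have "D (D U g) f = D (D U g) (rres X U (D U g) a)"
    unfolding a(2) using V.Units_pow_closed[OF Units_D[OF U g]] f
    by (intro D_Units_mult[symmetric] D_open)
  also have "\<dots> = D U g \<inter> D U a" by (rule D_rres[OF U D_open D_subset a(1)])
  finally show ?thesis using that a D_mult[OF U g a(1)] by simp
qed

end

context module_sheaf_on
begin

text \<open>Over \<open>V = D U g\<close> the element \<open>g\<close> becomes a unit
  \<open>u\<close>. Up to powers of \<open>u\<close>, sections over \<open>V\<close> are
  restrictions from \<open>U\<close>, and \<open>f\<close> is replaced by \<open>b = g a\<close>,
  which has \<open>D U b = D V f\<close> and restricts to \<open>w f\<close> with a unit
  \<open>w\<close>. Both clauses for \<open>b\<close> over \<open>U\<close> then restrict to
  \<open>V\<close>, where the units can be cancelled.\<close>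

lemma localizes_D:
  assumes U: "opn U" and O: "localizes X (struct_module X) U" and M: "localizes X M U"
    and g: "g \<in> carrier (sec X U)"
  shows "localizes X M (D U g)"
proof -
  define V where "V = D U g"
  define u where "u = rres X U V g"
  have V: "opn V" "V \<subseteq> U" using D_open D_subset by (auto simp: V_def)
  interpret U: Module.module "sec X U" "msec M U" by (rule msec_module[OF U])
  interpret V: Module.module "sec X V" "msec M V" by (rule msec_module[OF V(1)])
  have u: "u \<in> Units (sec X V)" unfolding u_def V_def by (rule Units_D[OF U g])
  then have uc: "u \<in> carrier (sec X V)" by auto
  have upow: "u [^]\<^bsub>sec X V\<^esub> n \<in> Units (sec X V)" for n :: nat
    using u by (rule V.R.Units_pow_closed)
  show ?thesis
    unfolding localizes_def V_def[symmetric]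
  proof (intro ballI conjI impI)
    fix f assume f: "f \<in> carrier (sec X V)"
    obtain a and n :: nat where a: "a \<in> carrier (sec X U)"
      "rres X U V a = u [^]\<^bsub>sec X V\<^esub> n \<otimes>\<^bsub>sec X V\<^esub> f" "D V f = D U (g \<otimes>\<^bsub>sec X U\<^esub> a)"
      using D_D[OF U O g] f unfolding V_def u_def by metis
    define b where "b = g \<otimes>\<^bsub>sec X U\<^esub> a"
    define w where "w = u \<otimes>\<^bsub>sec X V\<^esub> u [^]\<^bsub>sec X V\<^esub> n"
    define W where "W = D V f"
    have b: "b \<in> carrier (sec X U)" using g a by (simp add: b_def)
    have w: "w \<in> Units (sec X V)" using u upow by (simp add: w_def)
    then have wc: "w \<in> carrier (sec X V)" by auto
    have bV: "rres X U V b = w \<otimes>\<^bsub>sec X V\<^esub> f"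
      using g a U V uc f by (simp add: b_def rres_mult u_def[symmetric] w_def V.R.m_assoc)
    have WU: "W = D U b" by (simp add: W_def a(3) b_def)
    have W: "opn W" "W \<subseteq> V" "W \<subseteq> U" using D_open D_subset[of V f] V(2) by (auto simp: W_def)
    interpret W: Module.module "sec X W" "msec M W" by (rule msec_module[OF W(1)])
    {
      fix s s' assume s: "s \<in> carrier (msec M V)" "s' \<in> carrier (msec M V)"
        and eq: "mres M V (D V f) s = mres M V (D V f) s'"
      obtain k1 :: nat and s1 where s1: "s1 \<in> carrier (msec M U)"
        "mres M U V s1 = u [^]\<^bsub>sec X V\<^esub> k1 \<odot>\<^bsub>msec M V\<^esub> s"
        using localizes_ext[OF M g, of s] s unfolding V_def u_def by blast
      obtain k2 :: nat and s2 where s2: "s2 \<in> carrier (msec M U)"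
        "mres M U V s2 = u [^]\<^bsub>sec X V\<^esub> k2 \<odot>\<^bsub>msec M V\<^esub> s'"
        using localizes_ext[OF M g, of s'] s unfolding V_def u_def by blast
      \<comment> \<open>The sections extending \<open>s\<close> and \<open>s'\<close> carry
        different powers of \<open>u\<close>. Multiplying each by the other power makes both
        restrict to multiples by the same unit \<open>c\<close>.\<close>
      define r1 where "r1 = g [^]\<^bsub>sec X U\<^esub> k2 \<odot>\<^bsub>msec M U\<^esub> s1"
      define r2 where "r2 = g [^]\<^bsub>sec X U\<^esub> k1 \<odot>\<^bsub>msec M U\<^esub> s2"
      define c where "c = u [^]\<^bsub>sec X V\<^esub> k1 \<otimes>\<^bsub>sec X V\<^esub> u [^]\<^bsub>sec X V\<^esub> k2"
      have c: "c \<in> Units (sec X V)" using upow by (simp add: c_def)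
      have r: "r1 \<in> carrier (msec M U)" "r2 \<in> carrier (msec M U)"
        using s1 s2 g by (auto simp: r1_def r2_def)
      have rV: "mres M U V r1 = c \<odot>\<^bsub>msec M V\<^esub> s" "mres M U V r2 = c \<odot>\<^bsub>msec M V\<^esub> s'"
        using s1 s2 g U V uc s
        by (simp_all add: r1_def r2_def c_def mres_smult rres_pow u_def[symmetric] V.smult_ac)
      have "mres M U W r1 = mres M V W (mres M U V r1)"
        using mres_comp[OF U V(1) W(1,2) V(2) r(1)] by simp
      also have "\<dots> = mres M V W (mres M U V r2)"
        unfolding rV using c s eq V W by (simp add: mres_smult W_def V.R.Units_closed)
      also have "\<dots> = mres M U W r2"
        using mres_comp[OF U V(1) W(1,2) V(2) r(2)] by simp
      finally obtain m :: nat
        where "b [^]\<^bsub>sec X U\<^esub> m \<odot>\<^bsub>msec M U\<^esub> r1 = b [^]\<^bsub>sec X U\<^esub> m \<odot>\<^bsub>msec M U\<^esub> r2"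
        using localizes_eq[OF M b r] unfolding WU by blast
      then have "mres M U V (b [^]\<^bsub>sec X U\<^esub> m \<odot>\<^bsub>msec M U\<^esub> r1) = mres M U V (b [^]\<^bsub>sec X U\<^esub> m \<odot>\<^bsub>msec M U\<^esub> r2)"
        by simp
      then have "(w \<otimes>\<^bsub>sec X V\<^esub> f) [^]\<^bsub>sec X V\<^esub> m \<odot>\<^bsub>msec M V\<^esub> (c \<odot>\<^bsub>msec M V\<^esub> s)
          = (w \<otimes>\<^bsub>sec X V\<^esub> f) [^]\<^bsub>sec X V\<^esub> m \<odot>\<^bsub>msec M V\<^esub> (c \<odot>\<^bsub>msec M V\<^esub> s')"
        using b r U V by (simp add: mres_smult rres_pow bV rV)
      then have "(w [^]\<^bsub>sec X V\<^esub> m \<otimes>\<^bsub>sec X V\<^esub> c) \<odot>\<^bsub>msec M V\<^esub> (f [^]\<^bsub>sec X V\<^esub> m \<odot>\<^bsub>msec M V\<^esub> s)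
          = (w [^]\<^bsub>sec X V\<^esub> m \<otimes>\<^bsub>sec X V\<^esub> c) \<odot>\<^bsub>msec M V\<^esub> (f [^]\<^bsub>sec X V\<^esub> m \<odot>\<^bsub>msec M V\<^esub> s')"
        using wc f s V.R.Units_closed[OF c] by (simp add: V.R.nat_pow_distrib V.smult_ac)
      moreover have "w [^]\<^bsub>sec X V\<^esub> m \<otimes>\<^bsub>sec X V\<^esub> c \<in> Units (sec X V)"
        using w c V.R.Units_pow_closed by simp
      ultimately have "f [^]\<^bsub>sec X V\<^esub> m \<odot>\<^bsub>msec M V\<^esub> s = f [^]\<^bsub>sec X V\<^esub> m \<odot>\<^bsub>msec M V\<^esub> s'"
        using V.smult_Units_cancel f s by simp
      then show "\<exists>m::nat. f [^]\<^bsub>sec X V\<^esub> m \<odot>\<^bsub>msec M V\<^esub> s = f [^]\<^bsub>sec X V\<^esub> m \<odot>\<^bsub>msec M V\<^esub> s'" by blast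
    }
    {
      fix t assume t: "t \<in> carrier (msec M (D V f))"
      then have tW: "t \<in> carrier (msec M W)" by (simp add: W_def)
      obtain m :: nat and s1 where s1: "s1 \<in> carrier (msec M U)"
        "mres M U W s1 = rres X U W b [^]\<^bsub>sec X W\<^esub> m \<odot>\<^bsub>msec M W\<^esub> t"
        using localizes_ext[OF M b, of t] tW unfolding WU by blast
      \<comment> \<open>The section over \<open>U\<close> restricts to \<open>b^m t\<close>, and
        \<open>b^m\<close> is \<open>v f^m\<close> on \<open>W\<close>. Since \<open>v\<close> is a
        unit already on \<open>V\<close>, dividing by it there leaves exactly
        \<open>f^m t\<close>.\<close>
      define v where "v = w [^]\<^bsub>sec X V\<^esub> m"
      have v: "v \<in> Units (sec X V)" using w V.R.Units_pow_closed by (simp add: v_def)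
      have vc: "v \<in> carrier (sec X V)" "inv\<^bsub>sec X V\<^esub> v \<in> carrier (sec X V)" using v by auto
      have vinv: "rres X V W (inv\<^bsub>sec X V\<^esub> v) \<otimes>\<^bsub>sec X W\<^esub> rres X V W v = \<one>\<^bsub>sec X W\<^esub>"
        using v vc V W rres_one[OF V(1) W(1,2)] by (simp add: rres_mult[symmetric])
      have fW: "rres X V W f \<in> carrier (sec X W)" "rres X V W v \<in> carrier (sec X W)"
        "rres X V W (inv\<^bsub>sec X V\<^esub> v) \<in> carrier (sec X W)"
        using f vc V W by (auto simp: rres_closed)
      have "rres X U W b = rres X V W (w \<otimes>\<^bsub>sec X V\<^esub> f)"
        using rres_comp[OF U V(1) W(1,2) V(2) b] bV by simp
      then have bW: "rres X U W b [^]\<^bsub>sec X W\<^esub> m = rres X V W v \<otimes>\<^bsub>sec X W\<^esub> rres X V W f [^]\<^bsub>sec X W\<^esub> m"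
        using wc f V W fW rres_closed[OF V(1) W(1,2) wc]
        by (simp add: v_def rres_pow rres_mult W.R.nat_pow_distrib)
      let ?s = "inv\<^bsub>sec X V\<^esub> v \<odot>\<^bsub>msec M V\<^esub> mres M U V s1"
      have s1V: "mres M U V s1 \<in> carrier (msec M V)" by (rule mres_closed[OF U V s1(1)])
      have "mres M V W ?s = rres X V W (inv\<^bsub>sec X V\<^esub> v) \<odot>\<^bsub>msec M W\<^esub> mres M U W s1"
        using mres_smult[OF V(1) W(1,2) vc(2) s1V] mres_comp[OF U V(1) W(1,2) V(2) s1(1)] by simp
      also have "\<dots> = (rres X V W (inv\<^bsub>sec X V\<^esub> v) \<otimes>\<^bsub>sec X W\<^esub> rres X V W v)
          \<odot>\<^bsub>msec M W\<^esub> (rres X V W f [^]\<^bsub>sec X W\<^esub> m \<odot>\<^bsub>msec M W\<^esub> t)"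
        unfolding s1(2) bW using fW tW by (simp add: W.smult_assoc1)
      also have "\<dots> = rres X V W f [^]\<^bsub>sec X W\<^esub> m \<odot>\<^bsub>msec M W\<^esub> t"
        unfolding vinv using fW tW by simp
      finally show "\<exists>m::nat. \<exists>s\<in>carrier (msec M V). mres M V (D V f) s
          = rres X V (D V f) f [^]\<^bsub>sec X (D V f)\<^esub> m \<odot>\<^bsub>msec M (D V f)\<^esub> t"
        using vc s1V unfolding W_def[symmetric] by blast
    }
  qed
qed

end

section \<open>Affine charts\<close>

lemma topspace_zariski: "cring A \<Longrightarrow> topspace (zariski A) = {P. primeideal P A}"
proof -
  assume A: "cring A"
  have "{P. primeideal P A} = {P. primeideal P A \<and> \<not> carrier A \<subseteq> P}"
  proof -
    have "\<not> carrier A \<subseteq> P" if "primeideal P A" for P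
      using primeideal.I_notcarr[OF that] ideal.Icarr[OF primeideal.axioms(1)[OF that]] by blast
    then show ?thesis by blast
  qed
  then have "openin (zariski A) {P. primeideal P A}"
    unfolding openin_zariski[OF A] by (intro exI[of _ "carrier A"]) auto
  then have "{P. primeideal P A} \<subseteq> topspace (zariski A)" by (rule openin_subset)
  moreover have "topspace (zariski A) \<subseteq> {P. primeideal P A}"
  proof -
    have "openin (zariski A) (topspace (zariski A))" by simp
    then show ?thesis unfolding openin_zariski[OF A] by auto
  qed
  ultimately show ?thesis by blast
qed

lemma openin_prime_basic:
  assumes "cring A" "f \<in> carrier A"
  shows "openin (zariski A) (prime_basic A f)"
  unfolding openin_zariski[OF assms(1)] using assms(2)
  by (intro exI[of _ "{f}"]) (auto simp: prime_basic_def)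

text \<open>The functions on \<open>U\<close> that vanish at \<open>x\<close>, vanishing being read
  as not invertible near \<open>x\<close>. For a chart \<open>h\<close> this corresponds to the
  prime \<open>h x\<close>, but no chart enters the formula.\<close>

definition point_ideal :: "('x, 'r) ringed_space \<Rightarrow> 'x set \<Rightarrow> 'x \<Rightarrow> 'r set" where
  "point_ideal X U x = {f \<in> carrier (sec X U). x \<notin> basic_open X U f}"

text \<open>The stalks are local rings, said without forming stalks:
  \<open>x \<in> basic_open X U f\<close> means that the germ of \<open>f\<close> is a unit, and a
  nonzero ring is local when its non-units are closed under addition.\<close>

definition locally_ringed :: "('x, 'r) ringed_space \<Rightarrow> bool" where
  "locally_ringed X \<longleftrightarrow> (\<forall>U x. openin (top_of X) U \<and> x \<in> U \<longrightarrow>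
     x \<notin> basic_open X U \<zero>\<^bsub>sec X U\<^esub> \<and>
     (\<forall>f\<in>carrier (sec X U). \<forall>g\<in>carrier (sec X U).
        x \<in> basic_open X U (f \<oplus>\<^bsub>sec X U\<^esub> g) \<longrightarrow> x \<in> basic_open X U f \<or> x \<in> basic_open X U g))"

text \<open>In a scheme this characterizes the affine open sets; unlike the existence of a chart, it is easily
  seen to pass to basic open sets.\<close>

definition intrinsically_affine :: "('x, 'r) ringed_space \<Rightarrow> 'x set \<Rightarrow> bool" where
  "intrinsically_affine X U \<longleftrightarrow> openin (top_of X) U \<and> inj_on (point_ideal X U) U \<and>
     (\<forall>Q. primeideal Q (sec X U) \<longrightarrow> (\<exists>x\<in>U. Q = point_ideal X U x)) \<and>
     (\<forall>W x. openin (top_of X) W \<and> W \<subseteq> U \<and> x \<in> W \<longrightarrow>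
        (\<exists>f\<in>carrier (sec X U). x \<in> basic_open X U f \<and> basic_open X U f \<subseteq> W)) \<and>
     localizes X (struct_module X) U"

text \<open>One chart with a trivialization of \<open>M\<close> over it. Taking the structure sheaf
  with \<open>self_module A\<close> and \<open>\<theta>\<close> for \<open>\<sigma>\<close> gives
  another instance, so facts proved here for sections of \<open>M\<close> are available for
  functions too.\<close>

locale module_chart = module_sheaf_on X M
  for X :: "('x, 'r) ringed_space" and M :: "('x, 'r, 'm) module_sheaf" +
  fixes U and A :: "'r ring" and h \<theta> and N :: "('r, 'm) module" and \<sigma>
  assumes chart: "spec_chart X U A h \<theta>"
    and N: "Module.module A N"
    and \<sigma>: "\<And>W. \<lbrakk>openin (top_of X) W; W \<subseteq> U\<rbrakk> \<Longrightarrow>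
       semilinear_iso (sec X W) (\<theta> W) (msec M W) (tilde A N (h ` W)) (\<sigma> W)"
    and \<sigma>_res: "\<And>W W' s. \<lbrakk>openin (top_of X) W; openin (top_of X) W'; W' \<subseteq> W; W \<subseteq> U; s \<in> carrier (msec M W)\<rbrakk> \<Longrightarrow>
       \<sigma> W' (mres M W W' s) = restrict (\<sigma> W s) (h ` W')"
begin

sublocale N: Module.module A N by (rule N)

lemma opnU: "opn U" and homeo: "homeomorphic_map (subtopology (top_of X) U) (zariski A) h"
  using chart by (auto simp: spec_chart_def)

lemma topspace_U: "topspace (subtopology (top_of X) U) = U"
  using openin_subset[OF opnU] by auto

lemma inj_h: "inj_on h U"
  using homeomorphic_imp_injective_map[OF homeo] by (simp only: topspace_U)

lemma h_image: "h ` U = {P. primeideal P A}"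
  using homeomorphic_imp_surjective_map[OF homeo]
  by (simp only: topspace_U topspace_zariski[OF N.R.is_cring])

lemma h_prime: "x \<in> U \<Longrightarrow> primeideal (h x) A"
  using h_image by blast

lemma opn_h: "W \<subseteq> U \<Longrightarrow> opn W \<longleftrightarrow> openin (zariski A) (h ` W)"
  using homeomorphic_map_openness[OF homeo, unfolded topspace_U, of W]
    openin_open_subtopology[OF opnU, of W]
  by simp

lemma opn_preimage:
  assumes "openin (zariski A) V"
  obtains W where "opn W" "W \<subseteq> U" "V = h ` W"
proof -
  have "V \<subseteq> h ` U" using openin_subset[OF assms] by (simp add: h_image topspace_zariski[OF N.R.is_cring])
  then obtain W where "W \<subseteq> U" "V = h ` W" by (auto simp: subset_image_iff)
  then show ?thesis using that opn_h assms by blast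
qed

lemma fractions_at: "x \<in> U \<Longrightarrow> fractions A N (carrier A - h x)"
  and fractions_at_self: "x \<in> U \<Longrightarrow> fractions A (self_module A) (carrier A - h x)"
  using fractions_prime[OF _ h_prime] N module_self_module[OF N.R.is_cring] by blast+

lemma one_notin: "x \<in> U \<Longrightarrow> \<one>\<^bsub>A\<^esub> \<in> carrier A - h x"
  by (rule fractions.S_one[OF fractions_at])

lemma \<sigma>_closed: "\<lbrakk>opn W; W \<subseteq> U; s \<in> carrier (msec M W)\<rbrakk> \<Longrightarrow> \<sigma> W s \<in> carrier (tilde A N (h ` W))"
  using \<sigma>[of W] by (auto simp: semilinear_iso_def bij_betw_def)

lemma msec_ext:
  assumes W: "opn W" "W \<subseteq> U" and s: "s \<in> carrier (msec M W)" "t \<in> carrier (msec M W)"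
    and eq: "\<And>x. x \<in> W \<Longrightarrow> \<sigma> W s (h x) = \<sigma> W t (h x)"
  shows "s = t"
proof -
  have "\<sigma> W s = \<sigma> W t" using tilde_ext[OF \<sigma>_closed[OF W s(1)] \<sigma>_closed[OF W s(2)] eq] .
  then show ?thesis using \<sigma>[OF W] s unfolding semilinear_iso_def bij_betw_def by (meson inj_onD)
qed

lemma local_frac:
  assumes W: "opn W" "W \<subseteq> U" and s: "s \<in> carrier (msec M W)" and x: "x \<in> W"
  obtains V m f where "opn V" "x \<in> V" "V \<subseteq> W" "m \<in> carrier N" "f \<in> carrier A"
    "\<forall>y\<in>V. f \<notin> h y \<and> \<sigma> W s (h y) = frac A (carrier A - h y) N m f"
proof -
  have hx: "h x \<in> h ` W" using x by blast
  obtain V m f where V: "openin (zariski A) V" "h x \<in> V" "V \<subseteq> h ` W" "m \<in> carrier N" "f \<in> carrier A"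
    "\<forall>Q\<in>V. f \<notin> Q \<and> \<sigma> W s Q = frac A (carrier A - Q) N m f"
    by (rule tilde_locally_frac[OF \<sigma>_closed[OF W s] hx])
  obtain V' where V': "opn V'" "V' \<subseteq> U" "V = h ` V'" by (rule opn_preimage[OF V(1)])
  have "x \<in> V'" using V(2) V'(2,3) x W(2) inj_onD[OF inj_h] by blast
  moreover have "V' \<subseteq> W" using V(3) V'(2,3) W(2) inj_onD[OF inj_h] by blast
  ultimately show ?thesis using that[of V' m f] V V' by auto
qed

lemma section_of_frac:
  assumes W: "opn W" "W \<subseteq> U" and m: "m \<in> carrier N" and f: "f \<in> carrier A" "\<And>x. x \<in> W \<Longrightarrow> f \<notin> h x"
  obtains s where "s \<in> carrier (msec M W)"
    "\<And>x. x \<in> W \<Longrightarrow> \<sigma> W s (h x) = frac A (carrier A - h x) N m f"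
proof -
  define t where "t = (\<lambda>P\<in>h ` W. frac A (carrier A - P) N m f)"
  have "t \<in> carrier (tilde A N (h ` W))"
    unfolding tilde_def Let_def partial_object.simps
  proof (intro CollectI conjI ballI)
    show "t \<in> (\<Pi>\<^sub>E P\<in>h ` W. carrier (localization A (carrier A - P) N))"
      using fractions.frac_closed[OF fractions_at] W f m by (auto simp: t_def)
    show "\<exists>V. openin (zariski A) V \<and> P \<in> V \<and> V \<subseteq> h ` W \<and>
       (\<exists>m\<in>carrier N. \<exists>f\<in>carrier A. \<forall>Q\<in>V. f \<notin> Q \<and> t Q = frac A (carrier A - Q) N m f)"
      if "P \<in> h ` W" for P
      using that W f m opn_h[OF W(2)]
      by (intro exI[of _ "h ` W"] conjI bexI[of _ m] bexI[of _ f]) (auto simp: t_def)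
  qed
  then obtain s where "s \<in> carrier (msec M W)" "\<sigma> W s = t"
    using \<sigma>[OF W] unfolding semilinear_iso_def bij_betw_def by (metis imageE)
  then show ?thesis using that by (auto simp: t_def)
qed

lemma \<sigma>_res_at:
  assumes "opn W" "opn W'" "W' \<subseteq> W" "W \<subseteq> U" "s \<in> carrier (msec M W)" "x \<in> W'"
  shows "\<sigma> W' (mres M W W' s) (h x) = \<sigma> W s (h x)"
  using \<sigma>_res[OF assms(1-5)] assms(6) by simp

lemma \<sigma>_smult_at:
  assumes W: "opn W" "W \<subseteq> U" "x \<in> W" and a: "a \<in> carrier (sec X W)" and s: "s \<in> carrier (msec M W)"
    and fr: "\<theta> W a (h x) = frac A (carrier A - h x) (self_module A) \<alpha> \<beta>"
      "\<sigma> W s (h x) = frac A (carrier A - h x) N m \<gamma>"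
      "\<alpha> \<in> carrier A" "\<beta> \<in> carrier A - h x" "m \<in> carrier N" "\<gamma> \<in> carrier A - h x"
  shows "\<sigma> W (a \<odot>\<^bsub>msec M W\<^esub> s) (h x) = frac A (carrier A - h x) N (\<alpha> \<odot>\<^bsub>N\<^esub> m) (\<beta> \<otimes>\<^bsub>A\<^esub> \<gamma>)"
proof -
  have "x \<in> U" using W by blast
  have *: "\<sigma> W (a \<odot>\<^bsub>msec M W\<^esub> s) = \<theta> W a \<odot>\<^bsub>tilde A N (h ` W)\<^esub> \<sigma> W s"
    using \<sigma>[OF W(1,2)] a s unfolding semilinear_iso_def by blast
  have "\<sigma> W (a \<odot>\<^bsub>msec M W\<^esub> s) (h x) = \<theta> W a (h x) \<odot>\<^bsub>localization A (carrier A - h x) N\<^esub> \<sigma> W s (h x)"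
    unfolding * using W by (simp add: tilde_def Let_def)
  then show ?thesis
    unfolding fr(1,2) using fractions.frac_smult[OF fractions_at[OF \<open>x \<in> U\<close>] fr(3,5,4,6)] by simp
qed

lemma \<sigma>_add_at:
  assumes W: "opn W" "W \<subseteq> U" "x \<in> W" and s: "s \<in> carrier (msec M W)" "t \<in> carrier (msec M W)"
    and fr: "\<sigma> W s (h x) = frac A (carrier A - h x) N m \<beta>"
      "\<sigma> W t (h x) = frac A (carrier A - h x) N n \<gamma>"
      "m \<in> carrier N" "\<beta> \<in> carrier A - h x" "n \<in> carrier N" "\<gamma> \<in> carrier A - h x"
  shows "\<sigma> W (s \<oplus>\<^bsub>msec M W\<^esub> t) (h x)
    = frac A (carrier A - h x) N (\<gamma> \<odot>\<^bsub>N\<^esub> m \<oplus>\<^bsub>N\<^esub> \<beta> \<odot>\<^bsub>N\<^esub> n) (\<beta> \<otimes>\<^bsub>A\<^esub> \<gamma>)"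
proof -
  have "x \<in> U" using W by blast
  have *: "\<sigma> W (s \<oplus>\<^bsub>msec M W\<^esub> t) = \<sigma> W s \<oplus>\<^bsub>tilde A N (h ` W)\<^esub> \<sigma> W t"
    using \<sigma>[OF W(1,2)] s unfolding semilinear_iso_def by blast
  have "\<sigma> W (s \<oplus>\<^bsub>msec M W\<^esub> t) (h x) = \<sigma> W s (h x) \<oplus>\<^bsub>localization A (carrier A - h x) N\<^esub> \<sigma> W t (h x)"
    unfolding * using W by (simp add: tilde_def Let_def)
  then show ?thesis
    unfolding fr(1,2) using fractions.frac_add[OF fractions_at[OF \<open>x \<in> U\<close>] fr(3,5,4,6)] by simp
qed

text \<open>The result on the spectrum, pulled back along the chart; with \<open>f = 1\<close> it
  describes the sections over all of \<open>U\<close>.\<close>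

lemma section_frac:
  assumes f: "f \<in> carrier A" and W: "W = {x \<in> U. f \<notin> h x}" and s: "s \<in> carrier (msec M W)"
  obtains m and n :: nat where "opn W" "m \<in> carrier N"
    "\<And>x. x \<in> W \<Longrightarrow> \<sigma> W s (h x) = frac A (carrier A - h x) N m (f [^]\<^bsub>A\<^esub> n)"
proof -
  have hW: "h ` W = prime_basic A f"
  proof
    show "h ` W \<subseteq> prime_basic A f" using h_prime by (auto simp: W prime_basic_def)
    show "prime_basic A f \<subseteq> h ` W"
    proof
      fix P assume P: "P \<in> prime_basic A f"
      then have "P \<in> h ` U" by (simp add: h_image prime_basic_def)
      then show "P \<in> h ` W" using P by (auto simp: W prime_basic_def)
    qed
  qed
  have "W \<subseteq> U" by (auto simp: W)
  have "opn W" using opn_h[OF \<open>W \<subseteq> U\<close>] openin_prime_basic[OF N.R.is_cring f] hW by simp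
  have sc: "\<sigma> W s \<in> carrier (tilde A N (prime_basic A f))"
    using \<sigma>_closed[OF \<open>opn W\<close> \<open>W \<subseteq> U\<close> s] hW by simp
  show ?thesis
  proof (rule tilde_prime_basic[OF N f sc])
    fix m and n :: nat assume m: "m \<in> carrier N"
      and eq: "\<And>P. P \<in> prime_basic A f \<Longrightarrow> \<sigma> W s P = frac A (carrier A - P) N m (f [^]\<^bsub>A\<^esub> n)"
    show ?thesis by (rule that[OF \<open>opn W\<close> m]) (use eq hW in blast)
  qed
qed

end

context ringed
begin

lemma struct_chart:
  assumes "spec_chart X U A h \<theta>"
  shows "module_chart X (struct_module X) U A h \<theta> (self_module A) \<theta>"
proof -
  interpret S: module_sheaf_on X "struct_module X" by (rule struct_module_sheaf)
  have A: "cring A" using assms by (simp add: spec_chart_def)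
  show ?thesis
  proof (intro module_chart.intro module_chart_axioms.intro)
    show "module_sheaf_on X (struct_module X)" by (rule struct_module_sheaf)
    show "spec_chart X U A h \<theta>" by fact
    show "Module.module A (self_module A)" by (rule module_self_module[OF A])
    fix W assume W: "opn W" "W \<subseteq> U"
    then have iso: "\<theta> W \<in> ring_iso (sec X W) (spec_sheaf A (h ` W))"
      using assms by (simp add: spec_chart_def)
    then have hom: "\<theta> W \<in> ring_hom (sec X W) (spec_sheaf A (h ` W))" by (simp add: ring_iso_def)
    \<comment> \<open>For \<open>self_module A\<close> the scalar and the ring multiplication of
      fractions are the same formula, so multiplicativity of \<open>\<theta>\<close> is its
      semilinearity.\<close>
    have "s \<odot>\<^bsub>tilde A (self_module A) (h ` W)\<^esub> t = s \<otimes>\<^bsub>tilde A (self_module A) (h ` W)\<^esub> t" for s t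
      by (simp add: tilde_def Let_def localization_def)
    then show "semilinear_iso (sec X W) (\<theta> W) (msec (struct_module X) W)
       (tilde A (self_module A) (h ` W)) (\<theta> W)"
      using iso ring_hom_add[OF hom] ring_hom_mult[OF hom]
      by (simp add: semilinear_iso_def struct_module_def ring_iso_def spec_sheaf_def)
  next
    fix W W' s assume "opn W" "opn W'" "W' \<subseteq> W" "W \<subseteq> U" "s \<in> carrier (msec (struct_module X) W)"
    then show "\<theta> W' (mres (struct_module X) W W' s) = restrict (\<theta> W s) (h ` W')"
      using assms by (simp add: spec_chart_def struct_module_def)
  qed
qed

end

section \<open>Basic open sets and local rings in a chart\<close>

context module_chart
begin

sublocale S: module_chart X "struct_module X" U A h \<theta> "self_module A" \<theta>
  by (rule struct_chart[OF chart])

lemma sec_ext: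
  assumes "opn W" "W \<subseteq> U" "a \<in> carrier (sec X W)" "b \<in> carrier (sec X W)"
    "\<And>x. x \<in> W \<Longrightarrow> \<theta> W a (h x) = \<theta> W b (h x)"
  shows "a = b"
  using S.msec_ext[of W a b] assms by (simp add: struct_module_def)

lemma \<theta>_res_at:
  assumes "opn W" "opn W'" "W' \<subseteq> W" "W \<subseteq> U" "a \<in> carrier (sec X W)" "x \<in> W'"
  shows "\<theta> W' (rres X W W' a) (h x) = \<theta> W a (h x)"
  using S.\<sigma>_res_at[of W W' a x] assms by (simp add: struct_module_def)

lemma \<theta>_one_at:
  assumes "opn W" "W \<subseteq> U" "x \<in> W"
  shows "\<theta> W \<one>\<^bsub>sec X W\<^esub> (h x) = frac A (carrier A - h x) (self_module A) \<one>\<^bsub>A\<^esub> \<one>\<^bsub>A\<^esub>"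
proof -
  have "\<theta> W \<in> ring_hom (sec X W) (spec_sheaf A (h ` W))"
    using chart assms by (simp add: spec_chart_def ring_iso_def)
  then have "\<theta> W \<one>\<^bsub>sec X W\<^esub> = \<one>\<^bsub>spec_sheaf A (h ` W)\<^esub>" by (rule ring_hom_one)
  then show ?thesis using assms by (simp add: spec_sheaf_def tilde_def Let_def localization_def)
qed

lemma \<theta>_mult_at:
  assumes "opn W" "W \<subseteq> U" "x \<in> W" "a \<in> carrier (sec X W)" "b \<in> carrier (sec X W)"
    "\<theta> W a (h x) = frac A (carrier A - h x) (self_module A) \<alpha> \<beta>"
    "\<theta> W b (h x) = frac A (carrier A - h x) (self_module A) \<gamma> \<delta>"
    "\<alpha> \<in> carrier A" "\<beta> \<in> carrier A - h x" "\<gamma> \<in> carrier A" "\<delta> \<in> carrier A - h x"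
  shows "\<theta> W (a \<otimes>\<^bsub>sec X W\<^esub> b) (h x)
    = frac A (carrier A - h x) (self_module A) (\<alpha> \<otimes>\<^bsub>A\<^esub> \<gamma>) (\<beta> \<otimes>\<^bsub>A\<^esub> \<delta>)"
  using S.\<sigma>_smult_at[of W x a b \<alpha> \<beta> \<gamma> \<delta>] assms by (simp add: struct_module_def)

lemma \<theta>_add_at:
  assumes "opn W" "W \<subseteq> U" "x \<in> W" "a \<in> carrier (sec X W)" "b \<in> carrier (sec X W)"
    "\<theta> W a (h x) = frac A (carrier A - h x) (self_module A) \<alpha> \<beta>"
    "\<theta> W b (h x) = frac A (carrier A - h x) (self_module A) \<gamma> \<delta>"
    "\<alpha> \<in> carrier A" "\<beta> \<in> carrier A - h x" "\<gamma> \<in> carrier A" "\<delta> \<in> carrier A - h x"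
  shows "\<theta> W (a \<oplus>\<^bsub>sec X W\<^esub> b) (h x)
    = frac A (carrier A - h x) (self_module A) (\<delta> \<otimes>\<^bsub>A\<^esub> \<alpha> \<oplus>\<^bsub>A\<^esub> \<beta> \<otimes>\<^bsub>A\<^esub> \<gamma>) (\<beta> \<otimes>\<^bsub>A\<^esub> \<delta>)"
  using S.\<sigma>_add_at[of W x a b \<alpha> \<beta> \<gamma> \<delta>] assms by (simp add: struct_module_def)

lemma \<theta>_local_frac:
  assumes "opn W" "W \<subseteq> U" "a \<in> carrier (sec X W)" "x \<in> W"
  obtains V \<alpha> \<beta> where "opn V" "x \<in> V" "V \<subseteq> W" "\<alpha> \<in> carrier A" "\<beta> \<in> carrier A"
    "\<forall>y\<in>V. \<beta> \<notin> h y \<and> \<theta> W a (h y) = frac A (carrier A - h y) (self_module A) \<alpha> \<beta>"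
proof -
  have "a \<in> carrier (msec (struct_module X) W)" using assms by (simp add: struct_module_def)
  from S.local_frac[OF assms(1,2) this assms(4)] obtain V \<alpha> \<beta> where
    "opn V" "x \<in> V" "V \<subseteq> W" "\<alpha> \<in> carrier (self_module A)" "\<beta> \<in> carrier A"
    "\<forall>y\<in>V. \<beta> \<notin> h y \<and> \<theta> W a (h y) = frac A (carrier A - h y) (self_module A) \<alpha> \<beta>"
    by blast
  then show ?thesis using that by (simp only: self_module_simps)
qed

text \<open>In the local ring at \<open>h x\<close> a fraction is a non-unit exactly when its
  numerator lies in \<open>h x\<close>; this shows that the choice of fraction is immaterial. The
  witness \<open>t\<close> and the denominators lie outside the prime and may be stripped
  off.\<close>

lemma frac_self_eqD:
  assumes "x \<in> U" "frac A (carrier A - h x) (self_module A) \<alpha> \<beta> = frac A (carrier A - h x) (self_module A) \<gamma> \<delta>"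
    "\<alpha> \<in> carrier A" "\<beta> \<in> carrier A - h x" "\<gamma> \<in> carrier A" "\<delta> \<in> carrier A - h x"
  shows "\<alpha> \<in> h x \<longleftrightarrow> \<gamma> \<in> h x"
proof -
  interpret F: fractions A "self_module A" "carrier A - h x" by (rule fractions_at_self[OF assms(1)])
  interpret P: primeideal "h x" A by (rule h_prime[OF assms(1)])
  obtain t where t: "t \<in> carrier A - h x" "t \<otimes>\<^bsub>A\<^esub> (\<delta> \<otimes>\<^bsub>A\<^esub> \<alpha>) = t \<otimes>\<^bsub>A\<^esub> (\<beta> \<otimes>\<^bsub>A\<^esub> \<gamma>)"
    using F.frac_eq_iff[of \<alpha> \<gamma> \<beta> \<delta>] assms by auto
  have "t \<otimes>\<^bsub>A\<^esub> (\<delta> \<otimes>\<^bsub>A\<^esub> \<alpha>) \<in> h x \<longleftrightarrow> \<alpha> \<in> h x"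
    using t(1) assms(3,6) P.I_prime P.I_l_closed
    by (metis DiffD1 DiffD2 N.R.m_closed)
  moreover have "t \<otimes>\<^bsub>A\<^esub> (\<beta> \<otimes>\<^bsub>A\<^esub> \<gamma>) \<in> h x \<longleftrightarrow> \<gamma> \<in> h x"
    using t(1) assms(4,5) P.I_prime P.I_l_closed
    by (metis DiffD1 DiffD2 N.R.m_closed)
  ultimately show ?thesis using t(2) by simp
qed

text \<open>An inverse \<open>\<gamma>/\<delta>\<close> of the germ makes
  \<open>(\<alpha>\<gamma>)/(\<beta>\<delta>)\<close> equal to \<open>1/1\<close>, so
  \<open>\<alpha>\<close> is outside the prime. Conversely, \<open>f\<close> is some
  \<open>\<alpha>'/\<beta>'\<close> on a neighborhood, and where \<open>\<alpha>'\<close> does not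
  vanish the fraction \<open>\<beta>'/\<alpha>'\<close> is a section inverse to it.\<close>

lemma D_iff:
  assumes W: "opn W" "W \<subseteq> U" "x \<in> W" and f: "f \<in> carrier (sec X W)"
    and fr: "\<theta> W f (h x) = frac A (carrier A - h x) (self_module A) \<alpha> \<beta>"
      "\<alpha> \<in> carrier A" "\<beta> \<in> carrier A - h x"
  shows "x \<in> D W f \<longleftrightarrow> \<alpha> \<notin> h x"
proof
  have xU: "x \<in> U" using W by blast
  interpret P: primeideal "h x" A by (rule h_prime[OF xU])
  {
    assume "x \<in> D W f"
    then obtain W' where W': "opn W'" "x \<in> W'" "W' \<subseteq> W" "rres X W W' f \<in> Units (sec X W')"
      by (auto simp: basic_open_def)
    interpret W': cring "sec X W'" by (rule sec_cring[OF W'(1)])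
    let ?g = "inv\<^bsub>sec X W'\<^esub> (rres X W W' f)"
    have W'U: "W' \<subseteq> U" using W' W by blast
    have g: "?g \<in> carrier (sec X W')" "rres X W W' f \<in> carrier (sec X W')" using W'(4) by auto
    obtain V \<gamma> \<delta> where V: "x \<in> V" "\<gamma> \<in> carrier A" "\<delta> \<in> carrier A"
      "\<forall>y\<in>V. \<delta> \<notin> h y \<and> \<theta> W' ?g (h y) = frac A (carrier A - h y) (self_module A) \<gamma> \<delta>"
      by (rule \<theta>_local_frac[OF W'(1) W'U g(1) W'(2)])
    have f': "\<theta> W' (rres X W W' f) (h x) = frac A (carrier A - h x) (self_module A) \<alpha> \<beta>"
      using \<theta>_res_at[OF W(1) W'(1,3) W(2) f W'(2)] fr by simp
    have "\<theta> W' (rres X W W' f \<otimes>\<^bsub>sec X W'\<^esub> ?g) (h x)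
      = frac A (carrier A - h x) (self_module A) (\<alpha> \<otimes>\<^bsub>A\<^esub> \<gamma>) (\<beta> \<otimes>\<^bsub>A\<^esub> \<delta>)"
      using V fr by (intro \<theta>_mult_at[OF W'(1) W'U W'(2) g(2,1) f']) auto
    then have "frac A (carrier A - h x) (self_module A) (\<alpha> \<otimes>\<^bsub>A\<^esub> \<gamma>) (\<beta> \<otimes>\<^bsub>A\<^esub> \<delta>)
        = frac A (carrier A - h x) (self_module A) \<one>\<^bsub>A\<^esub> \<one>\<^bsub>A\<^esub>"
      using W'(4) \<theta>_one_at[OF W'(1) W'U W'(2)] by simp
    then have "\<alpha> \<otimes>\<^bsub>A\<^esub> \<gamma> \<notin> h x"
      using frac_self_eqD[OF xU, of "\<alpha> \<otimes>\<^bsub>A\<^esub> \<gamma>" "\<beta> \<otimes>\<^bsub>A\<^esub> \<delta>" "\<one>\<^bsub>A\<^esub>" "\<one>\<^bsub>A\<^esub>"] fr V one_notin[OF xU]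
        fractions.S_mult[OF fractions_at[OF xU], of \<beta> \<delta>] by simp
    then show "\<alpha> \<notin> h x" using P.I_r_closed V(2) by blast
  }
  {
    assume \<alpha>: "\<alpha> \<notin> h x"
    obtain V \<alpha>' \<beta>' where V: "opn V" "x \<in> V" "V \<subseteq> W" "\<alpha>' \<in> carrier A" "\<beta>' \<in> carrier A"
      "\<forall>y\<in>V. \<beta>' \<notin> h y \<and> \<theta> W f (h y) = frac A (carrier A - h y) (self_module A) \<alpha>' \<beta>'"
      by (rule \<theta>_local_frac[OF W(1,2) f W(3)])
    have \<alpha>': "\<alpha>' \<notin> h x"
      using frac_self_eqD[OF xU, of \<alpha> \<beta> \<alpha>' \<beta>'] fr V \<alpha> by simp
    define W' where "W' = {y \<in> V. \<alpha>' \<notin> h y}"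
    have W': "W' \<subseteq> V" "W' \<subseteq> W" "W' \<subseteq> U" "x \<in> W'" using V W \<alpha>' by (auto simp: W'_def)
    have "h ` W' = h ` V \<inter> prime_basic A \<alpha>'"
      using h_prime V(3) W(2) by (auto simp: W'_def prime_basic_def)
    then have oW': "opn W'"
      using opn_h[OF W'(3)] opn_h[of V] V W openin_prime_basic[OF N.R.is_cring V(4)]
      by (metis (no_types, lifting) openin_Int order_trans)
    have "\<alpha>' \<notin> h y" if "y \<in> W'" for y using that by (simp add: W'_def)
    from S.section_of_frac[OF oW' W'(3) _ V(4) this, of \<beta>'] V(5)
    obtain g where g: "g \<in> carrier (sec X W')"
      "\<And>y. y \<in> W' \<Longrightarrow> \<theta> W' g (h y) = frac A (carrier A - h y) (self_module A) \<beta>' \<alpha>'"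
      by (auto simp: struct_module_def)
    interpret W': cring "sec X W'" by (rule sec_cring[OF oW'])
    have f': "rres X W W' f \<in> carrier (sec X W')" by (rule rres_closed[OF W(1) oW' W'(2) f])
    have "rres X W W' f \<otimes>\<^bsub>sec X W'\<^esub> g = \<one>\<^bsub>sec X W'\<^esub>"
    proof (rule sec_ext[OF oW' W'(3)])
      fix y assume y: "y \<in> W'"
      then have yU: "y \<in> U" and yV: "y \<in> V" using W' by auto
      interpret F: fractions A "self_module A" "carrier A - h y" by (rule fractions_at_self[OF yU])
      have c: "\<alpha>' \<in> carrier A - h y" "\<beta>' \<in> carrier A - h y" using y V yV by (auto simp: W'_def)
      have "\<theta> W' (rres X W W' f) (h y) = frac A (carrier A - h y) (self_module A) \<alpha>' \<beta>'"
        using \<theta>_res_at[OF W(1) oW' W'(2) W(2) f y] V(6) yV by simp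
      then have "\<theta> W' (rres X W W' f \<otimes>\<^bsub>sec X W'\<^esub> g) (h y)
          = frac A (carrier A - h y) (self_module A) (\<alpha>' \<otimes>\<^bsub>A\<^esub> \<beta>') (\<beta>' \<otimes>\<^bsub>A\<^esub> \<alpha>')"
        by (rule \<theta>_mult_at[OF oW' W'(3) y f' g(1) _ g(2)[OF y]]) (use c in auto)
      also have "\<dots> = frac A (carrier A - h y) (self_module A) \<one>\<^bsub>A\<^esub> \<one>\<^bsub>A\<^esub>"
        using c F.S_mult[OF c(2,1)] F.S_one by (intro F.frac_eqI1) (auto simp: N.R.m_comm)
      finally show "\<theta> W' (rres X W W' f \<otimes>\<^bsub>sec X W'\<^esub> g) (h y) = \<theta> W' \<one>\<^bsub>sec X W'\<^esub> (h y)"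
        using \<theta>_one_at[OF oW' W'(3) y] by simp
    qed (use f' g in auto)
    then have "rres X W W' f \<in> Units (sec X W')"
      using f' g(1) W'.m_comm unfolding Units_def by force
    then show "x \<in> D W f" by (rule D_I[OF oW' W'(4,2)])
  }
qed

lemma D_local:
  assumes "opn W" "W \<subseteq> U" "x \<in> W"
  shows "x \<notin> D W \<zero>\<^bsub>sec X W\<^esub>"
    and "\<lbrakk>f \<in> carrier (sec X W); g \<in> carrier (sec X W); x \<in> D W (f \<oplus>\<^bsub>sec X W\<^esub> g)\<rbrakk> \<Longrightarrow>
      x \<in> D W f \<or> x \<in> D W g"
proof -
  have xU: "x \<in> U" using assms by blast
  interpret P: primeideal "h x" A by (rule h_prime[OF xU])
  interpret W: cring "sec X W" by (rule sec_cring[OF assms(1)])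
  note S_mult = fractions.S_mult[OF fractions_at[OF xU]]
  obtain V \<alpha> \<beta> where z: "x \<in> V" "\<alpha> \<in> carrier A" "\<beta> \<in> carrier A"
    "\<forall>y\<in>V. \<beta> \<notin> h y \<and> \<theta> W \<zero>\<^bsub>sec X W\<^esub> (h y) = frac A (carrier A - h y) (self_module A) \<alpha> \<beta>"
    by (rule \<theta>_local_frac[OF assms(1,2) W.zero_closed assms(3)])
  have \<beta>: "\<beta> \<in> carrier A - h x" using z by blast
  have z0: "\<theta> W \<zero>\<^bsub>sec X W\<^esub> (h x) = frac A (carrier A - h x) (self_module A) \<alpha> \<beta>" using z by blast
  interpret F: fractions A "self_module A" "carrier A - h x" by (rule fractions_at_self[OF xU])
  \<comment> \<open>The value of the zero section is found from 0 + 0 = 0 and additivity of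
    \<open>\<theta>\<close>: with a factor \<open>q\<close> outside the prime,
    \<open>q \<alpha> + q \<alpha> = q \<alpha>\<close>, so \<open>q \<alpha>\<close> is zero and
    \<open>\<alpha>\<close> lies in the prime.\<close>
  have "\<theta> W (\<zero>\<^bsub>sec X W\<^esub> \<oplus>\<^bsub>sec X W\<^esub> \<zero>\<^bsub>sec X W\<^esub>) (h x) =
    frac A (carrier A - h x) (self_module A) (\<beta> \<otimes>\<^bsub>A\<^esub> \<alpha> \<oplus>\<^bsub>A\<^esub> \<beta> \<otimes>\<^bsub>A\<^esub> \<alpha>) (\<beta> \<otimes>\<^bsub>A\<^esub> \<beta>)"
    using z \<beta> by (intro \<theta>_add_at[OF assms W.zero_closed W.zero_closed z0 z0])
  then have "frac A (carrier A - h x) (self_module A) (\<beta> \<otimes>\<^bsub>A\<^esub> \<alpha> \<oplus>\<^bsub>A\<^esub> \<beta> \<otimes>\<^bsub>A\<^esub> \<alpha>) (\<beta> \<otimes>\<^bsub>A\<^esub> \<beta>) =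
    frac A (carrier A - h x) (self_module A) \<alpha> \<beta>" using z0 by simp
  moreover have "\<beta> \<otimes>\<^bsub>A\<^esub> \<alpha> \<oplus>\<^bsub>A\<^esub> \<beta> \<otimes>\<^bsub>A\<^esub> \<alpha> \<in> carrier A" using z(2,3) by simp
  ultimately obtain t where t: "t \<in> carrier A - h x"
    "t \<otimes>\<^bsub>A\<^esub> (\<beta> \<otimes>\<^bsub>A\<^esub> (\<beta> \<otimes>\<^bsub>A\<^esub> \<alpha> \<oplus>\<^bsub>A\<^esub> \<beta> \<otimes>\<^bsub>A\<^esub> \<alpha>)) = t \<otimes>\<^bsub>A\<^esub> (\<beta> \<otimes>\<^bsub>A\<^esub> \<beta> \<otimes>\<^bsub>A\<^esub> \<alpha>)"
    using F.frac_eq_iff[unfolded self_module_simps, OF _ z(2) S_mult[OF \<beta> \<beta>] \<beta>] by blast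
  define q where "q = t \<otimes>\<^bsub>A\<^esub> (\<beta> \<otimes>\<^bsub>A\<^esub> \<beta>)"
  have q: "q \<in> carrier A - h x" unfolding q_def by (rule S_mult[OF t(1) S_mult[OF \<beta> \<beta>]])
  have qa: "q \<otimes>\<^bsub>A\<^esub> \<alpha> \<in> carrier A" using q z(2) by simp
  have "q \<otimes>\<^bsub>A\<^esub> \<alpha> \<oplus>\<^bsub>A\<^esub> q \<otimes>\<^bsub>A\<^esub> \<alpha> = t \<otimes>\<^bsub>A\<^esub> (\<beta> \<otimes>\<^bsub>A\<^esub> (\<beta> \<otimes>\<^bsub>A\<^esub> \<alpha> \<oplus>\<^bsub>A\<^esub> \<beta> \<otimes>\<^bsub>A\<^esub> \<alpha>))"
    using z(2,3) t(1) by (simp add: q_def N.R.r_distr N.R.m_assoc)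
  also have "\<dots> = q \<otimes>\<^bsub>A\<^esub> \<alpha>"
    unfolding t(2) using z(2,3) t(1) by (simp add: q_def N.R.m_assoc)
  finally have "q \<otimes>\<^bsub>A\<^esub> \<alpha> \<oplus>\<^bsub>A\<^esub> q \<otimes>\<^bsub>A\<^esub> \<alpha> = q \<otimes>\<^bsub>A\<^esub> \<alpha>" .
  then have "q \<otimes>\<^bsub>A\<^esub> \<alpha> = \<zero>\<^bsub>A\<^esub>" using N.R.add.l_cancel_one[OF qa qa] by blast
  then have "q \<otimes>\<^bsub>A\<^esub> \<alpha> \<in> h x" by simp
  then have "\<alpha> \<in> h x" using P.I_prime q z(2) by blast
  then show "x \<notin> D W \<zero>\<^bsub>sec X W\<^esub>"
    using D_iff[OF assms W.zero_closed z0 z(2) \<beta>] by blast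
  assume f: "f \<in> carrier (sec X W)" and g: "g \<in> carrier (sec X W)" and x: "x \<in> D W (f \<oplus>\<^bsub>sec X W\<^esub> g)"
  obtain V1 a b where 1: "x \<in> V1" "a \<in> carrier A" "b \<in> carrier A"
    "\<forall>y\<in>V1. b \<notin> h y \<and> \<theta> W f (h y) = frac A (carrier A - h y) (self_module A) a b"
    by (rule \<theta>_local_frac[OF assms(1,2) f assms(3)])
  obtain V2 c d where 2: "x \<in> V2" "c \<in> carrier A" "d \<in> carrier A"
    "\<forall>y\<in>V2. d \<notin> h y \<and> \<theta> W g (h y) = frac A (carrier A - h y) (self_module A) c d"
    by (rule \<theta>_local_frac[OF assms(1,2) g assms(3)])
  have bd: "b \<in> carrier A - h x" "d \<in> carrier A - h x"
    and v: "\<theta> W f (h x) = frac A (carrier A - h x) (self_module A) a b"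
      "\<theta> W g (h x) = frac A (carrier A - h x) (self_module A) c d" using 1 2 by auto
  \<comment> \<open>The sum of the two germs has the numerator \<open>d a + b c\<close>, which would
    lie in the prime if both \<open>a\<close> and \<open>c\<close> did.\<close>
  have "d \<otimes>\<^bsub>A\<^esub> a \<oplus>\<^bsub>A\<^esub> b \<otimes>\<^bsub>A\<^esub> c \<notin> h x"
    using D_iff[OF assms _ \<theta>_add_at[OF assms f g v 1(2) bd(1) 2(2) bd(2)] _ S_mult[OF bd]] f g x 1 2
    by simp
  then have "a \<notin> h x \<or> c \<notin> h x"
    using P.I_l_closed 1(2,3) 2(2,3) P.a_closed by blast
  then show "x \<in> D W f \<or> x \<in> D W g"
    using D_iff[OF assms f v(1) 1(2) bd(1)] D_iff[OF assms g v(2) 2(2) bd(2)] by blast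
qed

end

section \<open>Global sections of a chart\<close>

context module_chart
begin

text \<open>The map is \<open>a -> a/1\<close>. It is onto by \<open>section_frac\<close> with
  denominator 1, since no prime contains 1; its compatibility with the operations is checked at each
  point of \<open>U\<close>.\<close>

lemma hom_from_chart_ring:
  obtains \<kappa> where "\<kappa> \<in> ring_hom A (sec X U)" "\<kappa> ` carrier A = carrier (sec X U)"
    "\<And>a x. \<lbrakk>a \<in> carrier A; x \<in> U\<rbrakk> \<Longrightarrow>
      \<theta> U (\<kappa> a) (h x) = frac A (carrier A - h x) (self_module A) a \<one>\<^bsub>A\<^esub>"
    "\<And>a. a \<in> carrier A \<Longrightarrow> D U (\<kappa> a) = {x \<in> U. a \<notin> h x}"
proof -
  have "\<forall>a\<in>carrier A. \<exists>f. f \<in> carrier (sec X U) \<and>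
    (\<forall>x\<in>U. \<theta> U f (h x) = frac A (carrier A - h x) (self_module A) a \<one>\<^bsub>A\<^esub>)"
  proof
    fix a assume a: "a \<in> carrier A"
    have a': "a \<in> carrier (self_module A)" using a by simp
    have one: "\<And>x. x \<in> U \<Longrightarrow> \<one>\<^bsub>A\<^esub> \<notin> h x" using one_notin by blast
    show "\<exists>f. f \<in> carrier (sec X U) \<and>
      (\<forall>x\<in>U. \<theta> U f (h x) = frac A (carrier A - h x) (self_module A) a \<one>\<^bsub>A\<^esub>)"
      by (rule S.section_of_frac[OF opnU order_refl a' N.R.one_closed one])
        (auto simp: struct_module_def)
  qed
  then obtain \<kappa> where "\<forall>a\<in>carrier A. \<kappa> a \<in> carrier (sec X U) \<and>
    (\<forall>x\<in>U. \<theta> U (\<kappa> a) (h x) = frac A (carrier A - h x) (self_module A) a \<one>\<^bsub>A\<^esub>)"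
    by (rule bchoice[THEN exE])
  then have c: "\<kappa> a \<in> carrier (sec X U)"
    and v: "x \<in> U \<Longrightarrow> \<theta> U (\<kappa> a) (h x) = frac A (carrier A - h x) (self_module A) a \<one>\<^bsub>A\<^esub>"
    if "a \<in> carrier A" for a x using that by blast+
  interpret U: cring "sec X U" by (rule sec_cring[OF opnU])
  have hom: "\<kappa> \<in> ring_hom A (sec X U)"
  proof (rule ring_hom_memI)
    show "\<kappa> a \<in> carrier (sec X U)" if "a \<in> carrier A" for a by (rule c[OF that])
    show "\<kappa> \<one>\<^bsub>A\<^esub> = \<one>\<^bsub>sec X U\<^esub>"
      by (rule sec_ext[OF opnU order_refl]) (simp_all add: c v \<theta>_one_at opnU)
    fix a b assume ab: "a \<in> carrier A" "b \<in> carrier A"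
    show "\<kappa> (a \<otimes>\<^bsub>A\<^esub> b) = \<kappa> a \<otimes>\<^bsub>sec X U\<^esub> \<kappa> b"
    proof (rule sec_ext[OF opnU order_refl])
      fix x assume x: "x \<in> U"
      show "\<theta> U (\<kappa> (a \<otimes>\<^bsub>A\<^esub> b)) (h x) = \<theta> U (\<kappa> a \<otimes>\<^bsub>sec X U\<^esub> \<kappa> b) (h x)"
        using \<theta>_mult_at[OF opnU order_refl x c[OF ab(1)] c[OF ab(2)] v[OF ab(1) x] v[OF ab(2) x]
          ab(1) one_notin[OF x] ab(2) one_notin[OF x]] ab x by (simp add: v)
    qed (use c ab in auto)
    show "\<kappa> (a \<oplus>\<^bsub>A\<^esub> b) = \<kappa> a \<oplus>\<^bsub>sec X U\<^esub> \<kappa> b"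
    proof (rule sec_ext[OF opnU order_refl])
      fix x assume x: "x \<in> U"
      show "\<theta> U (\<kappa> (a \<oplus>\<^bsub>A\<^esub> b)) (h x) = \<theta> U (\<kappa> a \<oplus>\<^bsub>sec X U\<^esub> \<kappa> b) (h x)"
        using \<theta>_add_at[OF opnU order_refl x c[OF ab(1)] c[OF ab(2)] v[OF ab(1) x] v[OF ab(2) x]
          ab(1) one_notin[OF x] ab(2) one_notin[OF x]] ab x by (simp add: v)
    qed (use c ab in auto)
  qed
  have "f \<in> \<kappa> ` carrier A" if f: "f \<in> carrier (sec X U)" for f
  proof -
    have U: "U = {x \<in> U. \<one>\<^bsub>A\<^esub> \<notin> h x}" using one_notin by blast
    have fm: "f \<in> carrier (msec (struct_module X) U)" using f by (simp add: struct_module_def)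
    show ?thesis
    proof (rule S.section_frac[OF N.R.one_closed U fm])
      fix a and n :: nat assume a: "a \<in> carrier (self_module A)"
        "\<And>x. x \<in> U \<Longrightarrow> \<theta> U f (h x) = frac A (carrier A - h x) (self_module A) a (\<one>\<^bsub>A\<^esub> [^]\<^bsub>A\<^esub> n)"
      then have aA: "a \<in> carrier A" by simp
      have "f = \<kappa> a"
        by (rule sec_ext[OF opnU order_refl f c[OF aA]]) (simp add: a(2) v[OF aA])
      then show ?thesis using aA by blast
    qed
  qed
  then have im: "\<kappa> ` carrier A = carrier (sec X U)" using c by blast
  have D: "D U (\<kappa> a) = {x \<in> U. a \<notin> h x}" if a: "a \<in> carrier A" for a
    using D_iff[OF opnU order_refl _ c[OF a] v[OF a] a one_notin] D_subset[of U "\<kappa> a"] by blast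
  show ?thesis by (rule that[OF hom im v D])
qed

text \<open>With \<open>f\<close> the image of \<open>\<phi>\<close>, sections over \<open>U\<close>
  are \<open>m/1\<close> and sections over \<open>D U f\<close> are \<open>m/\<phi>^n\<close>.
  Equality on \<open>D U f\<close> becomes equality in the stalks off \<open>\<phi>\<close>, hence
  equality in \<open>N\<close> after multiplication by a power of \<open>\<phi>\<close>; and
  \<open>m/1\<close> extends \<open>\<phi>^n\<close> times \<open>m/\<phi>^n\<close>.\<close>

lemma localizes_U: "localizes X M U"
  unfolding localizes_def
proof (intro ballI)
  fix f assume f: "f \<in> carrier (sec X U)"
  show "(\<forall>s\<in>carrier (msec M U). \<forall>s'\<in>carrier (msec M U). mres M U (D U f) s = mres M U (D U f) s' \<longrightarrow>
        (\<exists>n::nat. f [^]\<^bsub>sec X U\<^esub> n \<odot>\<^bsub>msec M U\<^esub> s = f [^]\<^bsub>sec X U\<^esub> n \<odot>\<^bsub>msec M U\<^esub> s')) \<and>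
     (\<forall>t\<in>carrier (msec M (D U f)). \<exists>n::nat. \<exists>s\<in>carrier (msec M U).
        mres M U (D U f) s = rres X U (D U f) f [^]\<^bsub>sec X (D U f)\<^esub> n \<odot>\<^bsub>msec M (D U f)\<^esub> t)"
  proof (rule hom_from_chart_ring)
    fix \<kappa> assume hom: "\<kappa> \<in> ring_hom A (sec X U)" and im: "\<kappa> ` carrier A = carrier (sec X U)"
      and v: "\<And>a x. \<lbrakk>a \<in> carrier A; x \<in> U\<rbrakk> \<Longrightarrow>
        \<theta> U (\<kappa> a) (h x) = frac A (carrier A - h x) (self_module A) a \<one>\<^bsub>A\<^esub>"
      and Dk: "\<And>a. a \<in> carrier A \<Longrightarrow> D U (\<kappa> a) = {x \<in> U. a \<notin> h x}"
    obtain \<phi> where \<phi>: "\<phi> \<in> carrier A" "f = \<kappa> \<phi>" using f im by blast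
    interpret K: ring_hom_cring A "sec X U" \<kappa>
      using hom sec_cring[OF opnU] N.R.is_cring by (simp add: ring_hom_cring_def ring_hom_cring_axioms_def)
    interpret U: Module.module "sec X U" "msec M U" by (rule msec_module[OF opnU])
    define W where "W = D U f"
    have W: "opn W" "W \<subseteq> U" using D_open D_subset by (auto simp: W_def)
    interpret W: Module.module "sec X W" "msec M W" by (rule msec_module[OF W(1)])
    have Wh: "W = {x \<in> U. \<phi> \<notin> h x}" using Dk \<phi> by (simp add: W_def)
    have kpow: "f [^]\<^bsub>sec X U\<^esub> n = \<kappa> (\<phi> [^]\<^bsub>A\<^esub> n)" for n :: nat
      unfolding \<phi>(2) using \<phi>(1) by (induction n) simp_all
    have glob: "\<exists>m. m \<in> carrier N \<and> (\<forall>x\<in>U. \<sigma> U s (h x) = frac A (carrier A - h x) N m \<one>\<^bsub>A\<^esub>)"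
      if s: "s \<in> carrier (msec M U)" for s
    proof -
      have U: "U = {x \<in> U. \<one>\<^bsub>A\<^esub> \<notin> h x}" using one_notin by blast
      show ?thesis
      proof (rule section_frac[OF N.R.one_closed U s])
        fix m and n :: nat assume "m \<in> carrier N"
          "\<And>x. x \<in> U \<Longrightarrow> \<sigma> U s (h x) = frac A (carrier A - h x) N m (\<one>\<^bsub>A\<^esub> [^]\<^bsub>A\<^esub> n)"
        then show ?thesis by auto
      qed
    qed
    have scale: "\<sigma> U (\<kappa> a \<odot>\<^bsub>msec M U\<^esub> s) (h x) = frac A (carrier A - h x) N (a \<odot>\<^bsub>N\<^esub> m) \<one>\<^bsub>A\<^esub>"
      if "s \<in> carrier (msec M U)" "m \<in> carrier N" "a \<in> carrier A" "x \<in> U"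
        "\<sigma> U s (h x) = frac A (carrier A - h x) N m \<one>\<^bsub>A\<^esub>" for s m a x
      using \<sigma>_smult_at[OF opnU order_refl that(4) K.hom_closed[OF that(3)] that(1) v[OF that(3,4)] that(5,3)
        one_notin[OF that(4)] that(2) one_notin[OF that(4)]] by simp
    show ?thesis
      unfolding W_def[symmetric]
    proof (intro conjI ballI impI)
      fix s s' assume s: "s \<in> carrier (msec M U)" "s' \<in> carrier (msec M U)"
        and eq: "mres M U W s = mres M U W s'"
      obtain m where m: "m \<in> carrier N" "\<forall>x\<in>U. \<sigma> U s (h x) = frac A (carrier A - h x) N m \<one>\<^bsub>A\<^esub>"
        using glob[OF s(1)] by blast
      obtain m' where m': "m' \<in> carrier N" "\<forall>x\<in>U. \<sigma> U s' (h x) = frac A (carrier A - h x) N m' \<one>\<^bsub>A\<^esub>"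
        using glob[OF s(2)] by blast
      have "\<exists>t\<in>carrier A - P. t \<odot>\<^bsub>N\<^esub> m = t \<odot>\<^bsub>N\<^esub> m'" if P: "primeideal P A" "\<phi> \<notin> P" for P
      proof -
        have "P \<in> h ` U" using P(1) by (simp add: h_image)
        then obtain x where x: "x \<in> U" "P = h x" by blast
        have xW: "x \<in> W" using P(2) x Wh by blast
        have "\<sigma> U s (h x) = \<sigma> U s' (h x)"
          using \<sigma>_res_at[OF opnU W order_refl s(1) xW] \<sigma>_res_at[OF opnU W order_refl s(2) xW] eq by simp
        then have "frac A (carrier A - P) N m \<one>\<^bsub>A\<^esub> = frac A (carrier A - P) N m' \<one>\<^bsub>A\<^esub>"
          using m m' x by simp
        then show ?thesis
          using fractions.frac_eq_iff[OF fractions_at[OF x(1)] m(1) m'(1) one_notin[OF x(1)] one_notin[OF x(1)]]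
            x(2) m m' by simp
      qed
      then obtain n :: nat where n: "\<phi> [^]\<^bsub>A\<^esub> n \<odot>\<^bsub>N\<^esub> m = \<phi> [^]\<^bsub>A\<^esub> n \<odot>\<^bsub>N\<^esub> m'"
        by (rule N.fraction_equality_powers[OF m(1) m'(1) \<phi>(1)])
      have "f [^]\<^bsub>sec X U\<^esub> n \<odot>\<^bsub>msec M U\<^esub> s = f [^]\<^bsub>sec X U\<^esub> n \<odot>\<^bsub>msec M U\<^esub> s'"
      proof (rule msec_ext[OF opnU order_refl])
        fix x assume x: "x \<in> U"
        show "\<sigma> U (f [^]\<^bsub>sec X U\<^esub> n \<odot>\<^bsub>msec M U\<^esub> s) (h x) = \<sigma> U (f [^]\<^bsub>sec X U\<^esub> n \<odot>\<^bsub>msec M U\<^esub> s') (h x)"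
          unfolding kpow scale[OF s(1) m(1) N.R.nat_pow_closed[OF \<phi>(1)] x bspec[OF m(2) x]]
            scale[OF s(2) m'(1) N.R.nat_pow_closed[OF \<phi>(1)] x bspec[OF m'(2) x]] n ..
      qed (use s f in auto)
      then show "\<exists>n::nat. f [^]\<^bsub>sec X U\<^esub> n \<odot>\<^bsub>msec M U\<^esub> s = f [^]\<^bsub>sec X U\<^esub> n \<odot>\<^bsub>msec M U\<^esub> s'" by blast
    next
      fix t assume t: "t \<in> carrier (msec M W)"
      show "\<exists>n::nat. \<exists>s\<in>carrier (msec M U). mres M U W s = rres X U W f [^]\<^bsub>sec X W\<^esub> n \<odot>\<^bsub>msec M W\<^esub> t"
      proof (rule section_frac[OF \<phi>(1) Wh t])
        fix m and n :: nat assume m: "m \<in> carrier N" and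
          tv: "\<And>x. x \<in> W \<Longrightarrow> \<sigma> W t (h x) = frac A (carrier A - h x) N m (\<phi> [^]\<^bsub>A\<^esub> n)"
        have one: "\<And>x. x \<in> U \<Longrightarrow> \<one>\<^bsub>A\<^esub> \<notin> h x" using one_notin by blast
        show ?thesis
        proof (rule section_of_frac[OF opnU order_refl m N.R.one_closed one])
          fix s assume s: "s \<in> carrier (msec M U)" and
            sv: "\<And>x. x \<in> U \<Longrightarrow> \<sigma> U s (h x) = frac A (carrier A - h x) N m \<one>\<^bsub>A\<^esub>"
          have fW: "rres X U W f [^]\<^bsub>sec X W\<^esub> n = rres X U W (\<kappa> (\<phi> [^]\<^bsub>A\<^esub> n))"
            using rres_pow[OF opnU W f, of n] kpow[of n] by simp
          have kc: "\<kappa> (\<phi> [^]\<^bsub>A\<^esub> n) \<in> carrier (sec X U)" using \<phi> by simp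
          have "mres M U W s = rres X U W f [^]\<^bsub>sec X W\<^esub> n \<odot>\<^bsub>msec M W\<^esub> t"
            unfolding fW
          proof (rule msec_ext[OF W])
            fix x assume x: "x \<in> W"
            then have xU: "x \<in> U" using W by blast
            interpret F: fractions A N "carrier A - h x" by (rule fractions_at[OF xU])
            have pn: "\<phi> [^]\<^bsub>A\<^esub> n \<in> carrier A - h x"
              using N.R.ideal_pow_closed[OF h_prime[OF xU] \<phi>(1), of n] \<phi>(1) x Wh by auto
            have kv: "\<theta> W (rres X U W (\<kappa> (\<phi> [^]\<^bsub>A\<^esub> n))) (h x)
              = frac A (carrier A - h x) (self_module A) (\<phi> [^]\<^bsub>A\<^esub> n) \<one>\<^bsub>A\<^esub>"
              using \<theta>_res_at[OF opnU W order_refl kc x] v[OF _ xU, of "\<phi> [^]\<^bsub>A\<^esub> n"] pn by simp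
            have "\<sigma> W (rres X U W (\<kappa> (\<phi> [^]\<^bsub>A\<^esub> n)) \<odot>\<^bsub>msec M W\<^esub> t) (h x)
              = frac A (carrier A - h x) N (\<phi> [^]\<^bsub>A\<^esub> n \<odot>\<^bsub>N\<^esub> m) (\<one>\<^bsub>A\<^esub> \<otimes>\<^bsub>A\<^esub> \<phi> [^]\<^bsub>A\<^esub> n)"
              using pn m one_notin[OF xU]
              by (intro \<sigma>_smult_at[OF W x rres_closed[OF opnU W kc] t kv tv[OF x]]) auto
            also have "\<dots> = frac A (carrier A - h x) N m \<one>\<^bsub>A\<^esub>"
              using pn m one_notin[OF xU] by (intro F.frac_eqI1) auto
            also have "\<dots> = \<sigma> W (mres M U W s) (h x)"
              using \<sigma>_res_at[OF opnU W order_refl s x] sv[OF xU] by simp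
            finally show "\<sigma> W (mres M U W s) (h x)
              = \<sigma> W (rres X U W (\<kappa> (\<phi> [^]\<^bsub>A\<^esub> n)) \<odot>\<^bsub>msec M W\<^esub> t) (h x)" by simp
          qed (use mres_closed[OF opnU W s] rres_closed[OF opnU W kc] t in auto)
          then show ?thesis using s by blast
        qed
      qed
    qed
  qed
qed

text \<open>Everything is carried along the surjection \<open>\<kappa>\<close>, under which the
  point ideal of \<open>x\<close> corresponds to the prime \<open>h x\<close> and
  \<open>D U (\<kappa> a)\<close> to the basic open set of \<open>a\<close>. A prime of O(U) is the
  image of its preimage, which is some \<open>h x\<close>.\<close>

lemma intrinsically_affine_U: "intrinsically_affine X U"
proof (rule hom_from_chart_ring)
  fix \<kappa> assume hom: "\<kappa> \<in> ring_hom A (sec X U)" and im: "\<kappa> ` carrier A = carrier (sec X U)"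
    and Dk: "\<And>a. a \<in> carrier A \<Longrightarrow> D U (\<kappa> a) = {x \<in> U. a \<notin> h x}"
  interpret K: ring_hom_cring A "sec X U" \<kappa>
    using hom sec_cring[OF opnU] N.R.is_cring by (simp add: ring_hom_cring_def ring_hom_cring_axioms_def)
  have pt: "point_ideal X U x = \<kappa> ` h x" if x: "x \<in> U" for x
  proof -
    have "h x \<subseteq> carrier A" using ideal.Icarr[OF primeideal.axioms(1)[OF h_prime[OF x]]] by blast
    moreover have "x \<notin> D U (\<kappa> a) \<longleftrightarrow> a \<in> h x" if "a \<in> carrier A" for a using Dk[OF that] x by blast
    ultimately show ?thesis unfolding point_ideal_def im[symmetric] by blast
  qed
  have pt_iff: "\<kappa> a \<in> point_ideal X U x \<longleftrightarrow> a \<in> h x" if "a \<in> carrier A" "x \<in> U" for a x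
    using Dk[OF that(1)] that by (auto simp: point_ideal_def)
  show ?thesis
    unfolding intrinsically_affine_def
  proof (intro conjI allI impI)
    show "opn U" by (rule opnU)
    show "inj_on (point_ideal X U) U"
    proof (rule inj_onI)
      fix x y assume xy: "x \<in> U" "y \<in> U" "point_ideal X U x = point_ideal X U y"
      have "h x \<subseteq> carrier A" "h y \<subseteq> carrier A"
        using ideal.Icarr[OF primeideal.axioms(1)[OF h_prime]] xy by blast+
      then have "h x = h y" using pt_iff xy by blast
      then show "x = y" using inj_onD[OF inj_h] xy by blast
    qed
    show "localizes X (struct_module X) U" by (rule module_chart.localizes_U[OF S.module_chart_axioms])
  next
    fix Q assume Q: "primeideal Q (sec X U)"
    have "primeideal {a \<in> carrier A. \<kappa> a \<in> Q} A" by (rule K.ring.primeideal_vimage[OF N.R.is_cring Q])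
    then have "{a \<in> carrier A. \<kappa> a \<in> Q} \<in> h ` U" by (simp add: h_image)
    then obtain x where x: "x \<in> U" "h x = {a \<in> carrier A. \<kappa> a \<in> Q}" by blast
    have "Q \<subseteq> \<kappa> ` carrier A" using ideal.Icarr[OF primeideal.axioms(1)[OF Q]] im by blast
    then have "Q = \<kappa> ` h x" unfolding x(2) by blast
    then show "\<exists>x\<in>U. Q = point_ideal X U x" using pt x(1) by blast
  next
    fix W x assume "opn W \<and> W \<subseteq> U \<and> x \<in> W"
    then have W: "opn W" "W \<subseteq> U" "x \<in> W" by auto
    then have "openin (zariski A) (h ` W)" using opn_h by blast
    then obtain G where G: "G \<subseteq> carrier A" "h ` W = {P. primeideal P A \<and> \<not> G \<subseteq> P}"
      by (rule openin_zariskiE[OF N.R.is_cring])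
    have "h x \<in> h ` W" using W by blast
    then obtain g where g: "g \<in> G" "g \<notin> h x" using G by blast
    have gA: "g \<in> carrier A" using g G by blast
    have "D U (\<kappa> g) \<subseteq> W"
    proof
      fix y assume "y \<in> D U (\<kappa> g)"
      then have y: "y \<in> U" "g \<notin> h y" using Dk[OF gA] by auto
      then have "h y \<in> h ` W" using G g h_prime by blast
      then show "y \<in> W" using inj_onD[OF inj_h] y W by blast
    qed
    moreover have "x \<in> D U (\<kappa> g)" using Dk[OF gA] g W by blast
    ultimately show "\<exists>f\<in>carrier (sec X U). x \<in> D U f \<and> D U f \<subseteq> W"
      using K.hom_closed[OF gA] by blast
  qed
qed

end

lemma (in ringed) spec_chart_intrinsically_affine:
  "spec_chart X U A h \<theta> \<Longrightarrow> intrinsically_affine X U"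
  using module_chart.intrinsically_affine_U[OF struct_chart] .

text \<open>Basic open sets are compatible with restriction, so both conditions at \<open>x\<close>
  may be tested on the intersection of \<open>U\<close> with a chart around
  \<open>x\<close>.\<close>

lemma scheme_locally_ringed:
  assumes "scheme X"
  shows "locally_ringed X"
  unfolding locally_ringed_def
proof (intro allI impI)
  interpret ringed X using assms by (simp add: ringed_def scheme_def)
  fix U x assume a: "opn U \<and> x \<in> U"
  then have U: "opn U" "x \<in> U" by auto
  then have "x \<in> topspace (top_of X)" using openin_subset by blast
  then obtain V A h \<theta> where V: "x \<in> V" "spec_chart X V A h \<theta>"
    using assms unfolding scheme_def affine_open_def by blast
  interpret C: module_chart X "struct_module X" V A h \<theta> "self_module A" \<theta>
    by (rule struct_chart[OF V(2)])
  define W where "W = U \<inter> V"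
  have W: "opn W" "W \<subseteq> U" "W \<subseteq> V" "x \<in> W" using U V C.opnU by (auto simp: W_def)
  have loc: "x \<in> D U f \<longleftrightarrow> x \<in> D W (rres X U W f)" if "f \<in> carrier (sec X U)" for f
    using D_rres[OF U(1) W(1,2) that] W by blast
  interpret U: cring "sec X U" by (rule sec_cring[OF U(1)])
  show "x \<notin> D U \<zero>\<^bsub>sec X U\<^esub> \<and> (\<forall>f\<in>carrier (sec X U). \<forall>g\<in>carrier (sec X U).
        x \<in> D U (f \<oplus>\<^bsub>sec X U\<^esub> g) \<longrightarrow> x \<in> D U f \<or> x \<in> D U g)"
  proof (intro conjI ballI impI)
    show "x \<notin> D U \<zero>\<^bsub>sec X U\<^esub>"
      using C.D_local(1)[OF W(1,3,4)] loc[OF U.zero_closed] rres_zero[OF U(1) W(1,2)] by simp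
    fix f g assume fg: "f \<in> carrier (sec X U)" "g \<in> carrier (sec X U)" "x \<in> D U (f \<oplus>\<^bsub>sec X U\<^esub> g)"
    then have "x \<in> D W (rres X U W f \<oplus>\<^bsub>sec X W\<^esub> rres X U W g)"
      using loc[of "f \<oplus>\<^bsub>sec X U\<^esub> g"] rres_add[OF U(1) W(1,2) fg(1,2)] by simp
    then show "x \<in> D U f \<or> x \<in> D U g"
      using C.D_local(2)[OF W(1,3,4) rres_closed[OF U(1) W(1,2) fg(1)] rres_closed[OF U(1) W(1,2) fg(2)]]
        loc fg by blast
  qed
qed

section \<open>Intrinsically affine open sets\<close>

text \<open>Closure under addition is the local ring condition at \<open>x\<close>; primality and
  closure under multiplication come from \<open>D_mult\<close>.\<close>

lemma (in ringed) point_ideal_prime: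
  assumes loc: "locally_ringed X" and U: "opn U" "x \<in> U"
  shows "primeideal (point_ideal X U x) (sec X U)"
proof -
  interpret U: cring "sec X U" by (rule sec_cring[OF U(1)])
  note l = loc[unfolded locally_ringed_def, rule_format, OF conjI[OF U]]
  show ?thesis
  proof (rule primeidealI)
    show "ideal (point_ideal X U x) (sec X U)"
    proof (rule U.idealI_cring)
      show "point_ideal X U x \<subseteq> carrier (sec X U)" by (auto simp: point_ideal_def)
      show "\<zero>\<^bsub>sec X U\<^esub> \<in> point_ideal X U x" using l by (simp add: point_ideal_def)
      show "a \<oplus>\<^bsub>sec X U\<^esub> b \<in> point_ideal X U x" if "a \<in> point_ideal X U x" "b \<in> point_ideal X U x" for a b
        using that l by (auto simp: point_ideal_def)
      show "b \<otimes>\<^bsub>sec X U\<^esub> a \<in> point_ideal X U x" if "a \<in> point_ideal X U x" "b \<in> carrier (sec X U)" for a b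
        using that D_mult[OF U(1)] by (auto simp: point_ideal_def)
    qed
    show "cring (sec X U)" by (rule U.is_cring)
    show "carrier (sec X U) \<noteq> point_ideal X U x"
      using D_one[OF U(1)] U U.one_closed by (auto simp: point_ideal_def)
    show "a \<in> point_ideal X U x \<or> b \<in> point_ideal X U x"
      if "a \<in> carrier (sec X U)" "b \<in> carrier (sec X U)" "a \<otimes>\<^bsub>sec X U\<^esub> b \<in> point_ideal X U x" for a b
      using that D_mult[OF U(1)] by (auto simp: point_ideal_def)
  qed
qed

locale affine_set = ringed X for X :: "('x, 'r) ringed_space" +
  fixes U :: "'x set"
  assumes loc: "locally_ringed X" and affine: "intrinsically_affine X U"
begin

abbreviation R where "R \<equiv> sec X U"
abbreviation pt where "pt \<equiv> point_ideal X U"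

lemma opnU: "opn U" and inj_pt: "inj_on pt U"
  and localizes_struct: "localizes X (struct_module X) U"
  using affine by (auto simp: intrinsically_affine_def)

sublocale R: cring R by (rule sec_cring[OF opnU])

lemma prime_is_pt: "primeideal Q R \<Longrightarrow> \<exists>x\<in>U. Q = pt x"
  using affine by (simp add: intrinsically_affine_def)

lemma base:
  assumes "opn W" "x \<in> W" "x \<in> U"
  obtains f where "f \<in> carrier R" "x \<in> D U f" "D U f \<subseteq> W"
proof -
  have "opn (W \<inter> U) \<and> W \<inter> U \<subseteq> U \<and> x \<in> W \<inter> U" using assms opnU by blast
  then have "\<exists>f\<in>carrier R. x \<in> D U f \<and> D U f \<subseteq> W \<inter> U"
    using affine unfolding intrinsically_affine_def by meson
  then show ?thesis using that by blast
qed

lemma pt_prime: "x \<in> U \<Longrightarrow> primeideal (pt x) R"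
  by (rule point_ideal_prime[OF loc opnU])

lemma pt_iff: "\<lbrakk>f \<in> carrier R; x \<in> U\<rbrakk> \<Longrightarrow> f \<in> pt x \<longleftrightarrow> x \<notin> D U f"
  by (simp add: point_ideal_def)

text \<open>A prime that contains \<open>E\<close> would be the ideal of a point at which all of
  \<open>E\<close> vanishes, contrary to the covering; so no prime lies over the ideal.\<close>

lemma one_in_genideal:
  assumes E: "E \<subseteq> carrier R" and cover: "\<And>x. x \<in> U \<Longrightarrow> \<exists>f\<in>E. x \<in> D U f"
  shows "\<one>\<^bsub>R\<^esub> \<in> genideal R E"
proof -
  obtain n :: nat where "\<one>\<^bsub>R\<^esub> [^]\<^bsub>R\<^esub> n \<in> genideal R E"
  proof (rule R.in_radical[OF R.genideal_ideal[OF E] R.one_closed])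
    fix P assume P: "primeideal P R" "genideal R E \<subseteq> P"
    then obtain x where x: "x \<in> U" "P = pt x" using prime_is_pt by blast
    then obtain f where "f \<in> E" "x \<in> D U f" using cover by blast
    then show "\<one>\<^bsub>R\<^esub> \<in> P" using P x R.genideal_self[OF E] by (auto simp: point_ideal_def)
  qed
  then show ?thesis by simp
qed

text \<open>Quasi-compactness: 1 already lies in the ideal of finitely many elements of
  \<open>E\<close>, and at a point outside all their basic open sets it would vanish.\<close>

lemma finite_subcover:
  assumes E: "E \<subseteq> carrier R" and cover: "\<And>x. x \<in> U \<Longrightarrow> \<exists>f\<in>E. x \<in> D U f"
  obtains F where "finite F" "F \<subseteq> E" "\<forall>x\<in>U. \<exists>f\<in>F. x \<in> D U f"
proof -
  obtain F where F: "finite F" "F \<subseteq> E" "\<one>\<^bsub>R\<^esub> \<in> genideal R F"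
    by (rule R.genideal_finite[OF E one_in_genideal[OF assms]])
  have "\<exists>f\<in>F. x \<in> D U f" if x: "x \<in> U" for x
  proof (rule ccontr)
    assume "\<not> ?thesis"
    then have "F \<subseteq> pt x" using F E x by (auto simp: point_ideal_def)
    then have "\<one>\<^bsub>R\<^esub> \<in> pt x"
      using R.genideal_minimal[OF primeideal.axioms(1)[OF pt_prime[OF x]]] F(3) by blast
    then show False using D_one[OF opnU] x by (auto simp: point_ideal_def)
  qed
  then show ?thesis using that F by blast
qed

text \<open>Restriction matches the point ideals over \<open>V = D U g\<close> with those over
  \<open>U\<close>. A prime \<open>Q\<close> of O(V) contracts to the ideal of a point of
  \<open>U\<close>, and this point lies in \<open>V\<close> because the unit \<open>u\<close> is not
  in \<open>Q\<close>. To see that \<open>Q\<close> is the ideal of that point over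
  \<open>V\<close>, an arbitrary \<open>b\<close> is replaced, up to a unit, by the restriction of
  some \<open>a\<close> over \<open>U\<close>.\<close>

lemma affine_D:
  assumes g: "g \<in> carrier R"
  shows "intrinsically_affine X (D U g)"
proof -
  define V where "V = D U g"
  define u where "u = rres X U V g"
  have V: "opn V" "V \<subseteq> U" using D_open D_subset by (auto simp: V_def)
  interpret V: cring "sec X V" by (rule sec_cring[OF V(1)])
  have u: "u \<in> Units (sec X V)" unfolding u_def V_def by (rule Units_D[OF opnU g])
  have res_pt: "rres X U V a \<in> point_ideal X V x \<longleftrightarrow> a \<in> pt x" if "a \<in> carrier R" "x \<in> V" for a x
    using D_rres[OF opnU V that(1)] rres_closed[OF opnU V that(1)] that by (auto simp: point_ideal_def)
  show ?thesis
    unfolding intrinsically_affine_def V_def[symmetric]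
  proof (intro conjI allI impI)
    show "opn V" by (rule V(1))
    show "inj_on (point_ideal X V) V"
    proof (rule inj_onI)
      fix x y assume xy: "x \<in> V" "y \<in> V" "point_ideal X V x = point_ideal X V y"
      then have "a \<in> pt x \<longleftrightarrow> a \<in> pt y" if "a \<in> carrier R" for a using res_pt[OF that] by blast
      then have "pt x = pt y" by (auto simp: point_ideal_def)
      then show "x = y" using inj_onD[OF inj_pt] xy V by blast
    qed
    show "localizes X (struct_module X) V"
      unfolding V_def
      by (rule module_sheaf_on.localizes_D[OF struct_module_sheaf opnU localizes_struct localizes_struct g])
  next
    fix Q assume Q: "primeideal Q (sec X V)"
    interpret Q: primeideal Q "sec X V" by (rule Q)
    interpret H: ring_hom_ring R "sec X V" "rres X U V"
      by (rule ring_hom_ringI2[OF R.ring_axioms V.ring_axioms rres_hom[OF opnU V]])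
    have "primeideal {a \<in> carrier R. rres X U V a \<in> Q} R"
      by (rule H.primeideal_vimage[OF R.is_cring Q])
    then obtain x where x: "x \<in> U" "{a \<in> carrier R. rres X U V a \<in> Q} = pt x"
      using prime_is_pt by blast
    have notQ: "w \<notin> Q" if "w \<in> Units (sec X V)" for w
    proof
      assume "w \<in> Q"
      then have "inv\<^bsub>sec X V\<^esub> w \<otimes>\<^bsub>sec X V\<^esub> w \<in> Q" using Q.I_l_closed that by blast
      then show False using that Q.one_imp_carrier Q.I_notcarr by simp
    qed
    have "g \<notin> pt x" using notQ[OF u] x(2) unfolding u_def by blast
    then have xV: "x \<in> V" using g x(1) by (simp add: V_def point_ideal_def)
    have "b \<in> Q \<longleftrightarrow> b \<in> point_ideal X V x" if b: "b \<in> carrier (sec X V)" for b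
    proof (rule D_D[OF opnU localizes_struct g b[unfolded V_def]])
      fix a and n :: nat assume "a \<in> carrier R"
        "rres X U (D U g) a = rres X U (D U g) g [^]\<^bsub>sec X (D U g)\<^esub> n \<otimes>\<^bsub>sec X (D U g)\<^esub> b"
        "D (D U g) b = D U g \<inter> D U a"
      then have a: "a \<in> carrier R" "rres X U V a = u [^]\<^bsub>sec X V\<^esub> n \<otimes>\<^bsub>sec X V\<^esub> b" "D V b = V \<inter> D U a"
        by (simp_all add: V_def u_def)
      have un: "u [^]\<^bsub>sec X V\<^esub> n \<in> Units (sec X V)" by (rule V.Units_pow_closed[OF u])
      have "b \<in> Q \<longleftrightarrow> rres X U V a \<in> Q"
        unfolding a(2) using Q.I_prime[of "u [^]\<^bsub>sec X V\<^esub> n" b] notQ[OF un] un b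
          Q.I_l_closed[of b "u [^]\<^bsub>sec X V\<^esub> n"] by (auto simp: V.Units_closed)
      also have "\<dots> \<longleftrightarrow> a \<in> pt x" using x(2) a(1) by blast
      also have "\<dots> \<longleftrightarrow> b \<in> point_ideal X V x" using a b xV by (simp add: point_ideal_def)
      finally show ?thesis .
    qed
    moreover have "point_ideal X V x \<subseteq> carrier (sec X V)" by (auto simp: point_ideal_def)
    ultimately have "Q = point_ideal X V x" using Q.Icarr by blast
    then show "\<exists>x\<in>V. Q = point_ideal X V x" using xV by blast
  next
    fix W x assume W: "opn W \<and> W \<subseteq> V \<and> x \<in> W"
    then obtain f where f: "f \<in> carrier R" "x \<in> D U f" "D U f \<subseteq> W" using base V by blast
    then have "D V (rres X U V f) = D U f" using D_rres[OF opnU V f(1)] W by blast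
    then show "\<exists>f\<in>carrier (sec X V). x \<in> D V f \<and> D V f \<subseteq> W"
      using f rres_closed[OF opnU V f(1)] by metis
  qed
qed

end

text \<open>The chart of an intrinsically affine set \<open>U\<close> sends a section near \<open>x\<close> to the fraction \<open>b/s\<close> with
  \<open>b, s \<in> \<O>(U)\<close> that it equals near \<open>x\<close>.\<close>

context affine_set
begin

definition represents :: "'x set \<Rightarrow> 'r \<Rightarrow> 'x \<Rightarrow> 'r \<Rightarrow> 'r \<Rightarrow> bool" where
  "represents W a x b s \<longleftrightarrow> b \<in> carrier R \<and> s \<in> carrier R \<and> x \<in> D U s \<and>
     (\<exists>V. opn V \<and> x \<in> V \<and> V \<subseteq> W \<and> rres X U V s \<otimes>\<^bsub>sec X V\<^esub> rres X W V a = rres X U V b)"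

lemma representsI:
  assumes "b \<in> carrier R" "s \<in> carrier R" "x \<in> D U s" "opn V" "x \<in> V" "V \<subseteq> W"
    "rres X U V s \<otimes>\<^bsub>sec X V\<^esub> rres X W V a = rres X U V b"
  shows "represents W a x b s"
  using assms unfolding represents_def by blast

abbreviation fr where "fr x \<equiv> frac R (carrier R - pt x) (self_module R)"

lemma fractions_pt: "x \<in> U \<Longrightarrow> fractions R (self_module R) (carrier R - pt x)"
  by (rule fractions_prime[OF module_self_module[OF R.is_cring] pt_prime])

text \<open>The equation \<open>s a = b\<close> survives on smaller open sets, and the neighborhood
  may be taken inside \<open>D U s\<close>, where \<open>s\<close> is a unit.\<close>

lemma represents_shrink:
  assumes W: "opn W" "W \<subseteq> U" "a \<in> carrier (sec X W)" and r: "represents W a x b s"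
  obtains V where "opn V" "x \<in> V" "V \<subseteq> W" "V \<subseteq> D U s"
    "\<And>V'. \<lbrakk>opn V'; V' \<subseteq> V\<rbrakk> \<Longrightarrow> rres X U V' s \<otimes>\<^bsub>sec X V'\<^esub> rres X W V' a = rres X U V' b"
proof -
  obtain V where V: "opn V" "x \<in> V" "V \<subseteq> W" "rres X U V s \<otimes>\<^bsub>sec X V\<^esub> rres X W V a = rres X U V b"
    and bs: "b \<in> carrier R" "s \<in> carrier R" "x \<in> D U s"
    using r unfolding represents_def by blast
  have *: "rres X U V' s \<otimes>\<^bsub>sec X V'\<^esub> rres X W V' a = rres X U V' b" if V': "opn V'" "V' \<subseteq> V" for V'
  proof -
    have VU: "V \<subseteq> U" using V W by blast
    note c = rres_closed[OF opnU V(1) VU bs(2)] rres_closed[OF W(1) V(1,3) W(3)]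
    have "rres X V V' (rres X U V s \<otimes>\<^bsub>sec X V\<^esub> rres X W V a) = rres X V V' (rres X U V b)"
      using V(4) by simp
    then show ?thesis
      using rres_mult[OF V(1) V' c] rres_comp[OF opnU V(1) V'(1,2) VU bs(2)]
        rres_comp[OF opnU V(1) V'(1,2) VU bs(1)] rres_comp[OF W(1) V(1) V'(1,2) V(3) W(3)] by simp
  qed
  have "opn (V \<inter> D U s)" using V(1) D_open by blast
  then show ?thesis using that[of "V \<inter> D U s"] V(2,3) bs(3) * by blast
qed

lemma represents_local:
  assumes W: "opn W" "W \<subseteq> U" "a \<in> carrier (sec X W)" and r: "represents W a x b s"
  obtains V where "opn V" "x \<in> V" "V \<subseteq> W" "\<And>y. y \<in> V \<Longrightarrow> represents W a y b s"
proof (rule represents_shrink[OF assms])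
  have bs: "b \<in> carrier R" "s \<in> carrier R" using r by (auto simp: represents_def)
  fix V assume V: "opn V" "x \<in> V" "V \<subseteq> W" "V \<subseteq> D U s" and
    eq: "\<And>V'. \<lbrakk>opn V'; V' \<subseteq> V\<rbrakk> \<Longrightarrow> rres X U V' s \<otimes>\<^bsub>sec X V'\<^esub> rres X W V' a = rres X U V' b"
  show ?thesis
    by (rule that[OF V(1-3)], rule representsI[OF bs _ V(1) _ V(3) eq[OF V(1) order_refl]])
      (use V in auto)
qed

text \<open>There is a basic neighborhood \<open>D U f\<close> inside \<open>W\<close>, and over it
  \<open>f^n a\<close> is the restriction of some \<open>b\<close> from \<open>U\<close> by
  \<open>localizes\<close>; so \<open>a\<close> is \<open>b/f^n\<close> near
  \<open>x\<close>.\<close>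

lemma represents_ex:
  assumes W: "opn W" "W \<subseteq> U" "a \<in> carrier (sec X W)" "x \<in> W"
  obtains b s where "represents W a x b s"
proof -
  have xU: "x \<in> U" using W by blast
  obtain f where f: "f \<in> carrier R" "x \<in> D U f" "D U f \<subseteq> W" by (rule base[OF W(1,4) xU])
  have c: "rres X W (D U f) a \<in> carrier (msec (struct_module X) (D U f))"
    using rres_closed[OF W(1) D_open f(3) W(3)] by (simp add: struct_module_def)
  show ?thesis
  proof (rule localizes_ext[OF localizes_struct f(1) c])
    fix n :: nat and b assume b: "b \<in> carrier (msec (struct_module X) U)" and
      eq: "mres (struct_module X) U (D U f) b = rres X U (D U f) f [^]\<^bsub>sec X (D U f)\<^esub> n
        \<odot>\<^bsub>msec (struct_module X) (D U f)\<^esub> rres X W (D U f) a"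
    have "f [^]\<^bsub>R\<^esub> n \<notin> pt x"
      using R.ideal_pow_closed[OF pt_prime[OF xU] f(1)] f(1,2) xU pt_iff by blast
    then have "x \<in> D U (f [^]\<^bsub>R\<^esub> n)" using pt_iff[OF _ xU] f(1) by simp
    then show ?thesis
      using b eq f rres_pow[OF opnU D_open D_subset f(1)]
      by (intro that[of b "f [^]\<^bsub>R\<^esub> n"] representsI[OF _ _ _ D_open f(2,3)]) (simp_all add: struct_module_def)
  qed
qed

text \<open>Near \<open>x\<close> both \<open>s' b\<close> and \<open>s b'\<close> restrict to
  \<open>s s' a\<close>. They agree on a basic neighborhood \<open>D U f\<close>, hence after
  multiplication by a power of \<open>f\<close>, and that power is outside the ideal of
  \<open>x\<close>.\<close>

lemma represents_frac_eq:
  assumes W: "opn W" "W \<subseteq> U" "a \<in> carrier (sec X W)" "x \<in> W"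
    and r: "represents W a x b s" "represents W a x b' s'"
  shows "fr x b s = fr x b' s'"
proof -
  have xU: "x \<in> U" using W by blast
  interpret F: fractions R "self_module R" "carrier R - pt x" by (rule fractions_pt[OF xU])
  have bs: "b \<in> carrier R" "s \<in> carrier R" "x \<in> D U s" "b' \<in> carrier R" "s' \<in> carrier R" "x \<in> D U s'"
    using r by (auto simp: represents_def)
  show ?thesis
  proof (rule represents_shrink[OF W(1-3) r(1)], rule represents_shrink[OF W(1-3) r(2)])
    fix V V' assume V: "opn V" "x \<in> V" "V \<subseteq> W" and V': "opn V'" "x \<in> V'" "V' \<subseteq> W"
      and eq: "\<And>V'. \<lbrakk>opn V'; V' \<subseteq> V\<rbrakk> \<Longrightarrow> rres X U V' s \<otimes>\<^bsub>sec X V'\<^esub> rres X W V' a = rres X U V' b"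
      and eq': "\<And>V''. \<lbrakk>opn V''; V'' \<subseteq> V'\<rbrakk> \<Longrightarrow> rres X U V'' s' \<otimes>\<^bsub>sec X V''\<^esub> rres X W V'' a = rres X U V'' b'"
    have "opn (V \<inter> V')" "x \<in> V \<inter> V'" using V V' by auto
    then obtain f where f: "f \<in> carrier R" "x \<in> D U f" "D U f \<subseteq> V \<inter> V'" by (rule base[OF _ _ xU])
    let ?Z = "D U f"
    interpret Z: cring "sec X ?Z" by (rule sec_cring[OF D_open])
    have ZW: "?Z \<subseteq> W" using f V by blast
    note c = rres_closed[OF opnU D_open D_subset bs(2), of f] rres_closed[OF opnU D_open D_subset bs(5), of f]
      rres_closed[OF W(1) D_open ZW W(3)]
    note e = eq[OF D_open, of U f] eq'[OF D_open, of U f]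
    have "rres X U ?Z (s' \<otimes>\<^bsub>R\<^esub> b) = rres X U ?Z (s \<otimes>\<^bsub>R\<^esub> b')"
      using rres_mult[OF opnU D_open D_subset bs(5,1)] rres_mult[OF opnU D_open D_subset bs(2,4)]
        e(1)[symmetric] e(2)[symmetric] f(3) c by (simp add: Z.m_lcomm)
    then obtain n :: nat where n: "f [^]\<^bsub>R\<^esub> n \<otimes>\<^bsub>R\<^esub> (s' \<otimes>\<^bsub>R\<^esub> b) = f [^]\<^bsub>R\<^esub> n \<otimes>\<^bsub>R\<^esub> (s \<otimes>\<^bsub>R\<^esub> b')"
      using localizes_eq[OF localizes_struct f(1), of "s' \<otimes>\<^bsub>R\<^esub> b" "s \<otimes>\<^bsub>R\<^esub> b'"] bs
      by (auto simp: struct_module_def)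
    have "f \<notin> pt x" using pt_iff[OF f(1) xU] f(2) by simp
    then have "f [^]\<^bsub>R\<^esub> n \<notin> pt x" using R.ideal_pow_closed[OF pt_prime[OF xU] f(1)] by blast
    then have fn: "f [^]\<^bsub>R\<^esub> n \<in> carrier R - pt x" using f(1) by simp
    have "s \<in> carrier R - pt x" "s' \<in> carrier R - pt x"
      using bs pt_iff[OF bs(2) xU] pt_iff[OF bs(5) xU] by simp_all
    then show ?thesis
      using F.frac_eqI[OF _ _ _ _ fn, unfolded self_module_simps, OF bs(1,4) _ _ n] by blast
  qed
qed

lemma represents_res:
  assumes W: "opn W" "W \<subseteq> U" "a \<in> carrier (sec X W)" and W': "opn W'" "W' \<subseteq> W" "x \<in> W'"
  shows "represents W' (rres X W W' a) x b s \<longleftrightarrow> represents W a x b s"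
proof
  assume r: "represents W' (rres X W W' a) x b s"
  have W'U: "W' \<subseteq> U" using W W' by blast
  have bs: "b \<in> carrier R" "s \<in> carrier R" "x \<in> D U s" using r by (auto simp: represents_def)
  show "represents W a x b s"
  proof (rule represents_shrink[OF W'(1) W'U rres_closed[OF W(1) W'(1,2) W(3)] r])
    fix V assume V: "opn V" "x \<in> V" "V \<subseteq> W'" "\<And>V'. \<lbrakk>opn V'; V' \<subseteq> V\<rbrakk> \<Longrightarrow>
      rres X U V' s \<otimes>\<^bsub>sec X V'\<^esub> rres X W' V' (rres X W W' a) = rres X U V' b"
    then show ?thesis
      using rres_comp[OF W(1) W'(1) V(1,3) W'(2) W(3)] V(4)[OF V(1) order_refl] W'(2)
      by (intro representsI[OF bs V(1,2)]) auto
  qed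
next
  assume r: "represents W a x b s"
  have bs: "b \<in> carrier R" "s \<in> carrier R" "x \<in> D U s" using r by (auto simp: represents_def)
  show "represents W' (rres X W W' a) x b s"
  proof (rule represents_shrink[OF W r])
    fix V assume V: "opn V" "x \<in> V" "\<And>V'. \<lbrakk>opn V'; V' \<subseteq> V\<rbrakk> \<Longrightarrow>
      rres X U V' s \<otimes>\<^bsub>sec X V'\<^esub> rres X W V' a = rres X U V' b"
    have VW: "opn (V \<inter> W')" using V W' by blast
    show ?thesis
      using V(2) W' V(3)[OF VW] rres_comp[OF W(1) W'(1) VW _ W'(2) W(3)]
      by (intro representsI[OF bs VW]) auto
  qed
qed

text \<open>A relation \<open>t s' b = t s b'\<close> in O(U) can be divided by \<open>t\<close>,
  \<open>s\<close> and \<open>s'\<close> on a neighborhood where all three are units, which leaves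
  \<open>a = a'\<close>. This is what makes \<open>canonical\<close> injective.\<close>

lemma represents_eq_near:
  assumes W: "opn W" "W \<subseteq> U" "x \<in> W" "a \<in> carrier (sec X W)" "a' \<in> carrier (sec X W)"
    and r: "represents W a x b s" "represents W a' x b' s'" and eq: "fr x b s = fr x b' s'"
  obtains V where "opn V" "x \<in> V" "V \<subseteq> W" "rres X W V a = rres X W V a'"
proof -
  have xU: "x \<in> U" using W by blast
  interpret F: fractions R "self_module R" "carrier R - pt x" by (rule fractions_pt[OF xU])
  have bs: "b \<in> carrier R" "s \<in> carrier R" "x \<in> D U s" "b' \<in> carrier R" "s' \<in> carrier R" "x \<in> D U s'"
    using r by (auto simp: represents_def)
  obtain t where t: "t \<in> carrier R" "t \<notin> pt x" "t \<otimes>\<^bsub>R\<^esub> (s' \<otimes>\<^bsub>R\<^esub> b) = t \<otimes>\<^bsub>R\<^esub> (s \<otimes>\<^bsub>R\<^esub> b')"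
  proof -
    have "s \<in> carrier R - pt x" "s' \<in> carrier R - pt x"
      using bs pt_iff[OF bs(2) xU] pt_iff[OF bs(5) xU] by simp_all
    from F.frac_eq_iff[unfolded self_module_simps, OF bs(1,4) this] eq show ?thesis
      using that by blast
  qed
  have xt: "x \<in> D U t" using t pt_iff[OF _ xU] by blast
  show ?thesis
  proof (rule represents_shrink[OF W(1,2,4) r(1)], rule represents_shrink[OF W(1,2,5) r(2)])
    fix V V' assume V: "opn V" "x \<in> V" "V \<subseteq> W" "V \<subseteq> D U s" and V': "opn V'" "x \<in> V'" "V' \<subseteq> W" "V' \<subseteq> D U s'"
      and eq: "\<And>V'. \<lbrakk>opn V'; V' \<subseteq> V\<rbrakk> \<Longrightarrow> rres X U V' s \<otimes>\<^bsub>sec X V'\<^esub> rres X W V' a = rres X U V' b"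
      and eq': "\<And>V''. \<lbrakk>opn V''; V'' \<subseteq> V'\<rbrakk> \<Longrightarrow> rres X U V'' s' \<otimes>\<^bsub>sec X V''\<^esub> rres X W V'' a' = rres X U V'' b'"
    let ?Z = "V \<inter> V' \<inter> D U t"
    have Z: "opn ?Z" "?Z \<subseteq> V" "?Z \<subseteq> V'" "?Z \<subseteq> W" "?Z \<subseteq> U" using V V' D_open W by auto
    interpret Z: cring "sec X ?Z" by (rule sec_cring[OF Z(1)])
    have unit: "rres X U ?Z f \<in> Units (sec X ?Z)" if "f \<in> carrier R" "?Z \<subseteq> D U f" for f
      using rres_Units[OF D_open Z(1) that(2) Units_D[OF opnU that(1)]]
        rres_comp[OF opnU D_open Z(1) that(2) D_subset that(1)] by simp
    define w where "w = rres X U ?Z t \<otimes>\<^bsub>sec X ?Z\<^esub> (rres X U ?Z s' \<otimes>\<^bsub>sec X ?Z\<^esub> rres X U ?Z s)"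
    have us: "rres X U ?Z t \<in> Units (sec X ?Z)" "rres X U ?Z s \<in> Units (sec X ?Z)" "rres X U ?Z s' \<in> Units (sec X ?Z)"
      using unit[OF t(1)] unit[OF bs(2)] unit[OF bs(5)] V(4) V'(4) by blast+
    then have w: "w \<in> Units (sec X ?Z)" by (simp add: w_def)
    note c = us[THEN Z.Units_closed] rres_closed[OF W(1) Z(1,4) W(4)] rres_closed[OF W(1) Z(1,4) W(5)]
    have "rres X U ?Z (t \<otimes>\<^bsub>R\<^esub> (s' \<otimes>\<^bsub>R\<^esub> b)) = rres X U ?Z (t \<otimes>\<^bsub>R\<^esub> (s \<otimes>\<^bsub>R\<^esub> b'))"
      using t(3) by simp
    then have "rres X U ?Z t \<otimes>\<^bsub>sec X ?Z\<^esub> (rres X U ?Z s' \<otimes>\<^bsub>sec X ?Z\<^esub> rres X U ?Z b)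
        = rres X U ?Z t \<otimes>\<^bsub>sec X ?Z\<^esub> (rres X U ?Z s \<otimes>\<^bsub>sec X ?Z\<^esub> rres X U ?Z b')"
      using t(1) bs rres_mult[OF opnU Z(1,5)] by simp
    then have "w \<otimes>\<^bsub>sec X ?Z\<^esub> rres X W ?Z a = w \<otimes>\<^bsub>sec X ?Z\<^esub> rres X W ?Z a'"
      unfolding eq[OF Z(1,2), symmetric] eq'[OF Z(1,3), symmetric] w_def
      using c by (simp add: Z.m_ac)
    then have "rres X W ?Z a = rres X W ?Z a'" using Z.Units_l_cancel[OF w c(4,5)] by blast
    then show ?thesis using that[OF Z(1) _ Z(4)] V V' xt by blast
  qed
qed

lemma represents_combine:
  assumes W: "opn W" "W \<subseteq> U" "x \<in> W" "a \<in> carrier (sec X W)" "a' \<in> carrier (sec X W)"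
    and r: "represents W a x b s" "represents W a' x b' s'"
  shows "represents W (a \<oplus>\<^bsub>sec X W\<^esub> a') x (s' \<otimes>\<^bsub>R\<^esub> b \<oplus>\<^bsub>R\<^esub> s \<otimes>\<^bsub>R\<^esub> b') (s \<otimes>\<^bsub>R\<^esub> s')"
    and "represents W (a \<otimes>\<^bsub>sec X W\<^esub> a') x (b \<otimes>\<^bsub>R\<^esub> b') (s \<otimes>\<^bsub>R\<^esub> s')"
proof -
  have bs: "b \<in> carrier R" "s \<in> carrier R" "x \<in> D U s" "b' \<in> carrier R" "s' \<in> carrier R" "x \<in> D U s'"
    using r by (auto simp: represents_def)
  obtain V where V: "opn V" "x \<in> V" "V \<subseteq> W"
      and eq: "\<forall>V'. opn V' \<and> V' \<subseteq> V \<longrightarrow> rres X U V' s \<otimes>\<^bsub>sec X V'\<^esub> rres X W V' a = rres X U V' b"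
    by (rule represents_shrink[OF W(1,2,4) r(1)], rule that) auto
  obtain V' where V': "opn V'" "x \<in> V'" "V' \<subseteq> W"
      and eq': "\<forall>V''. opn V'' \<and> V'' \<subseteq> V' \<longrightarrow> rres X U V'' s' \<otimes>\<^bsub>sec X V''\<^esub> rres X W V'' a' = rres X U V'' b'"
    by (rule represents_shrink[OF W(1,2,5) r(2)], rule that) auto
  let ?Z = "V \<inter> V'"
  have Z: "opn ?Z" "?Z \<subseteq> V" "?Z \<subseteq> V'" "?Z \<subseteq> W" "?Z \<subseteq> U" "x \<in> ?Z" using V V' D_open W by auto
  interpret Z: cring "sec X ?Z" by (rule sec_cring[OF Z(1)])
  have e: "rres X U ?Z s \<otimes>\<^bsub>sec X ?Z\<^esub> rres X W ?Z a = rres X U ?Z b"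
    "rres X U ?Z s' \<otimes>\<^bsub>sec X ?Z\<^esub> rres X W ?Z a' = rres X U ?Z b'"
    using eq eq' Z by blast+
  note c = rres_closed[OF opnU Z(1,5) bs(2)] rres_closed[OF opnU Z(1,5) bs(5)]
    rres_closed[OF W(1) Z(1,4) W(4)] rres_closed[OF W(1) Z(1,4) W(5)]
  have x: "x \<in> D U (s \<otimes>\<^bsub>R\<^esub> s')" using D_mult[OF opnU bs(2,5)] bs by simp
  show "represents W (a \<oplus>\<^bsub>sec X W\<^esub> a') x (s' \<otimes>\<^bsub>R\<^esub> b \<oplus>\<^bsub>R\<^esub> s \<otimes>\<^bsub>R\<^esub> b') (s \<otimes>\<^bsub>R\<^esub> s')"
  proof (rule representsI[OF _ _ x Z(1,6,4)])
    show "rres X U ?Z (s \<otimes>\<^bsub>R\<^esub> s') \<otimes>\<^bsub>sec X ?Z\<^esub> rres X W ?Z (a \<oplus>\<^bsub>sec X W\<^esub> a')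
      = rres X U ?Z (s' \<otimes>\<^bsub>R\<^esub> b \<oplus>\<^bsub>R\<^esub> s \<otimes>\<^bsub>R\<^esub> b')"
      using bs c by (simp add: rres_mult[OF opnU Z(1,5)] rres_add[OF opnU Z(1,5)]
          rres_add[OF W(1) Z(1,4) W(4,5)] e[symmetric] Z.r_distr Z.m_ac)
  qed (use bs in auto)
  show "represents W (a \<otimes>\<^bsub>sec X W\<^esub> a') x (b \<otimes>\<^bsub>R\<^esub> b') (s \<otimes>\<^bsub>R\<^esub> s')"
  proof (rule representsI[OF _ _ x Z(1,6,4)])
    show "rres X U ?Z (s \<otimes>\<^bsub>R\<^esub> s') \<otimes>\<^bsub>sec X ?Z\<^esub> rres X W ?Z (a \<otimes>\<^bsub>sec X W\<^esub> a') = rres X U ?Z (b \<otimes>\<^bsub>R\<^esub> b')"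
      using bs c by (simp add: rres_mult[OF opnU Z(1,5)]
          rres_mult[OF W(1) Z(1,4) W(4,5)] e[symmetric] Z.m_ac)
  qed (use bs in auto)
qed

end

section \<open>The canonical chart of an intrinsically affine set\<close>

context affine_set
begin

lemma representsD:
  assumes "represents W a x b s"
  shows "b \<in> carrier R" "s \<in> carrier R" "x \<in> D U s" "s \<in> carrier R - pt x"
  using assms unfolding represents_def by (simp_all add: point_ideal_def)

text \<open>The value at \<open>pt x\<close> is the class of any fraction representing
  \<open>a\<close> near \<open>x\<close>. The choice is harmless: \<open>inj_pt\<close> recovers
  \<open>x\<close> from the prime and \<open>represents_frac_eq\<close> makes the class unique. Off
  the image of \<open>W\<close> the function is undefined, as sections in \<open>tilde\<close> are
  extensional.\<close>

definition canonical :: "'x set \<Rightarrow> 'r \<Rightarrow> 'r set \<Rightarrow> ('r \<times> 'r) set" where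
  "canonical W a = (\<lambda>Q\<in>pt ` W. SOME C. \<exists>x b s. x \<in> W \<and> Q = pt x \<and> represents W a x b s \<and> C = fr x b s)"

lemma canonical_at:
  assumes W: "opn W" "W \<subseteq> U" "a \<in> carrier (sec X W)" "x \<in> W" and r: "represents W a x b s"
  shows "canonical W a (pt x) = fr x b s"
proof -
  have "\<exists>x' b s. x' \<in> W \<and> pt x = pt x' \<and> represents W a x' b s \<and> canonical W a (pt x) = fr x' b s"
  proof -
    let ?P = "\<lambda>C. \<exists>x' b s. x' \<in> W \<and> pt x = pt x' \<and> represents W a x' b s \<and> C = fr x' b s"
    have "?P (SOME C. ?P C)" by (rule someI[of ?P "fr x b s"]) (use W(4) r in blast)
    moreover have "canonical W a (pt x) = (SOME C. ?P C)" using W(4) by (simp add: canonical_def)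
    ultimately show ?thesis by simp
  qed
  then obtain x' b' s' where x': "x' \<in> W" "pt x = pt x'" "represents W a x' b' s'"
    "canonical W a (pt x) = fr x' b' s'" by blast
  have "x' = x" by (rule inj_onD[OF inj_pt x'(2)[symmetric]]) (use x'(1) W in auto)
  then have "represents W a x b' s'" "canonical W a (pt x) = fr x b' s'" using x'(3,4) by simp_all
  then show ?thesis using represents_frac_eq[OF W r] by simp
qed

text \<open>Under \<open>pt\<close> the basic open set of \<open>f\<close> in \<open>U\<close>
  becomes the set of primes that miss \<open>f\<close>. These sets form a basis on both sides, by
  \<open>base\<close> on one and by the definition of \<open>zariski\<close> on the other.\<close>

lemma pt_homeomorphic: "homeomorphic_map (subtopology (top_of X) U) (zariski R) pt"
proof -
  have top: "topspace (subtopology (top_of X) U) = U" using openin_subset[OF opnU] by auto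
  have im: "pt ` U = {P. primeideal P R}" using pt_prime prime_is_pt by blast
  have open_im: "openin (zariski R) (pt ` W)" if W: "opn W" "W \<subseteq> U" for W
    unfolding openin_zariski[OF R.is_cring]
  proof (intro exI conjI)
    \<comment> \<open>The largest candidate: \<open>pt x\<close> misses some member of it exactly
      when \<open>x\<close> has a basic neighborhood inside \<open>W\<close>.\<close>
    let ?E = "{f \<in> carrier R. D U f \<subseteq> W}"
    show "?E \<subseteq> carrier R" by blast
    show "pt ` W = {P. primeideal P R \<and> \<not> ?E \<subseteq> P}"
    proof (intro equalityI subsetI)
      fix P assume "P \<in> pt ` W"
      then obtain x where x: "x \<in> W" "P = pt x" by blast
      then have xU: "x \<in> U" using W by blast
      obtain f where "f \<in> carrier R" "x \<in> D U f" "D U f \<subseteq> W" by (rule base[OF W(1) x(1) xU])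
      then show "P \<in> {P. primeideal P R \<and> \<not> ?E \<subseteq> P}" using x pt_prime[OF xU] pt_iff[OF _ xU] by blast
    next
      fix P assume P: "P \<in> {P. primeideal P R \<and> \<not> ?E \<subseteq> P}"
      then obtain x where x: "x \<in> U" "P = pt x" using prime_is_pt by blast
      then show "P \<in> pt ` W" using P pt_iff by blast
    qed
  qed
  have open_pre: "opn {x \<in> U. pt x \<in> V}" if V: "openin (zariski R) V" for V
  proof (rule openin_zariskiE[OF R.is_cring V])
    fix E assume E: "E \<subseteq> carrier R" "V = {P. primeideal P R \<and> \<not> E \<subseteq> P}"
    have "{x \<in> U. pt x \<in> V} = (\<Union>f\<in>E. D U f)"
    proof (intro equalityI subsetI)
      fix x assume "x \<in> {x \<in> U. pt x \<in> V}"
      then show "x \<in> (\<Union>f\<in>E. D U f)" using E pt_iff by blast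
    next
      fix x assume "x \<in> (\<Union>f\<in>E. D U f)"
      then obtain f where "f \<in> E" "x \<in> D U f" by blast
      moreover then have "x \<in> U" using D_subset by blast
      ultimately show "x \<in> {x \<in> U. pt x \<in> V}" using E pt_iff pt_prime by blast
    qed
    then show ?thesis using D_open by auto
  qed
  show ?thesis
  proof (rule bijective_open_imp_homeomorphic_map)
    show "continuous_map (subtopology (top_of X) U) (zariski R) pt"
      unfolding continuous_map top
    proof (intro conjI allI impI)
      show "pt ` U \<subseteq> topspace (zariski R)" by (simp add: im topspace_zariski[OF R.is_cring])
      show "openin (subtopology (top_of X) U) {x \<in> U. pt x \<in> V}" if "openin (zariski R) V" for V
        using open_pre[OF that] openin_open_subtopology[OF opnU] by auto
    qed
    show "open_map (subtopology (top_of X) U) (zariski R) pt"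
      unfolding open_map_def using open_im openin_open_subtopology[OF opnU] by simp
    show "pt ` topspace (subtopology (top_of X) U) = topspace (zariski R)"
      unfolding top by (simp add: im topspace_zariski[OF R.is_cring])
    show "inj_on pt (topspace (subtopology (top_of X) U))"
      unfolding top by (rule inj_pt)
  qed
qed

lemma opn_pt: "W \<subseteq> U \<Longrightarrow> opn W \<longleftrightarrow> openin (zariski R) (pt ` W)"
proof -
  assume W: "W \<subseteq> U"
  have "topspace (subtopology (top_of X) U) = U" using openin_subset[OF opnU] by auto
  then show ?thesis
    using homeomorphic_map_openness[OF pt_homeomorphic, of W] openin_open_subtopology[OF opnU, of W] W
    by simp
qed

lemma canonical_closed:
  assumes W: "opn W" "W \<subseteq> U" and a: "a \<in> carrier (sec X W)"
  shows "canonical W a \<in> carrier (tilde R (self_module R) (pt ` W))"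
  unfolding tilde_def Let_def partial_object.simps
proof (intro CollectI conjI ballI)
  show "canonical W a \<in> (\<Pi>\<^sub>E P\<in>pt ` W. carrier (localization R (carrier R - P) (self_module R)))"
  proof (rule PiE_I)
    fix P assume "P \<in> pt ` W"
    then obtain x where x: "x \<in> W" "P = pt x" by blast
    then have xU: "x \<in> U" using W by blast
    interpret F: fractions R "self_module R" "carrier R - pt x" by (rule fractions_pt[OF xU])
    obtain b s where r: "represents W a x b s" by (rule represents_ex[OF W a x(1)])
    note bs = representsD(1,4)[OF r]
    then show "canonical W a P \<in> carrier (localization R (carrier R - P) (self_module R))"
      unfolding x(2) canonical_at[OF W a x(1) r] using F.frac_closed bs by simp
  qed (simp add: canonical_def)
  fix P assume "P \<in> pt ` W"
  then obtain x where x: "x \<in> W" "P = pt x" by blast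
  obtain b s where r: "represents W a x b s" by (rule represents_ex[OF W a x(1)])
  note bs = representsD(1,2)[OF r]
  show "\<exists>V. openin (zariski R) V \<and> P \<in> V \<and> V \<subseteq> pt ` W \<and>
    (\<exists>m\<in>carrier (self_module R). \<exists>f\<in>carrier R. \<forall>Q\<in>V. f \<notin> Q \<and>
      canonical W a Q = frac R (carrier R - Q) (self_module R) m f)"
  proof (rule represents_local[OF W a r])
    fix V assume V: "opn V" "x \<in> V" "V \<subseteq> W" and rV: "\<And>y. y \<in> V \<Longrightarrow> represents W a y b s"
    have "s \<notin> Q \<and> canonical W a Q = frac R (carrier R - Q) (self_module R) b s" if "Q \<in> pt ` V" for Q
    proof -
      obtain y where y: "y \<in> V" "Q = pt y" using \<open>Q \<in> pt ` V\<close> by blast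
      then have "s \<notin> pt y" using representsD(4)[OF rV] by blast
      moreover have "canonical W a (pt y) = fr y b s"
        by (rule canonical_at[OF W a _ rV[OF y(1)]]) (use y V in blast)
      ultimately show ?thesis using y(2) by simp
    qed
    moreover have "openin (zariski R) (pt ` V)" using opn_pt[of V] V W by blast
    ultimately show ?thesis using V x bs by (intro exI[of _ "pt ` V"]) auto
  qed
qed

text \<open>Equal classes at \<open>x\<close> give equal restrictions near \<open>x\<close>, and
  sections of a sheaf that agree locally are equal.\<close>

lemma canonical_inj:
  assumes W: "opn W" "W \<subseteq> U" and a: "a \<in> carrier (sec X W)" "a' \<in> carrier (sec X W)"
    and eq: "canonical W a = canonical W a'"
  shows "a = a'"
proof -
  have "\<exists>V. opn V \<and> x \<in> V \<and> V \<subseteq> W \<and> rres X W V a = rres X W V a'" if x: "x \<in> W" for x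
  proof (rule represents_ex[OF W a(1) x], rule represents_ex[OF W a(2) x])
    fix b s b' s' assume r: "represents W a x b s" "represents W a' x b' s'"
    have "fr x b s = fr x b' s'"
      using canonical_at[OF W a(1) x r(1)] canonical_at[OF W a(2) x r(2)] eq by simp
    then show ?thesis by (rule represents_eq_near[OF W x a r]) blast
  qed
  then obtain V where V: "\<And>x. x \<in> W \<Longrightarrow> opn (V x) \<and> x \<in> V x \<and> V x \<subseteq> W \<and>
    rres X W (V x) a = rres X W (V x) a'" by metis
  show ?thesis
  proof (rule is_sheaf_unique[OF sec_sheaf, of W V W])
    show "W = (\<Union>x\<in>W. V x)" using V by blast
  qed (use V a in auto)
qed

text \<open>Near each point \<open>t\<close> is a fraction \<open>b/f\<close> with \<open>f\<close>
  invertible there, which is an honest section. On overlaps these sections have the same image under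
  \<open>canonical\<close>, so they agree by injectivity and can be glued.\<close>

lemma canonical_surj:
  assumes W: "opn W" "W \<subseteq> U" and t: "t \<in> carrier (tilde R (self_module R) (pt ` W))"
  shows "t \<in> canonical W ` carrier (sec X W)"
proof -
  have "\<exists>V b f. opn V \<and> x \<in> V \<and> V \<subseteq> W \<and> b \<in> carrier R \<and> f \<in> carrier R \<and> V \<subseteq> D U f \<and>
    (\<forall>y\<in>V. t (pt y) = fr y b f)" if x: "x \<in> W" for x
  proof (rule tilde_locally_frac[OF t imageI[OF x]])
    fix V b f assume V: "openin (zariski R) V" "pt x \<in> V" "V \<subseteq> pt ` W"
      and bf: "b \<in> carrier (self_module R)" "f \<in> carrier R"
        "\<forall>Q\<in>V. f \<notin> Q \<and> t Q = frac R (carrier R - Q) (self_module R) b f"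
    define V' where "V' = {y \<in> W. pt y \<in> V}"
    have "pt ` V' = V" using V(3) by (auto simp: V'_def)
    then have "opn V'" using opn_pt[of V'] V(1) W by (auto simp: V'_def)
    moreover have "V' \<subseteq> D U f"
    proof
      fix y assume "y \<in> V'"
      then have "y \<in> U" "f \<notin> pt y" using bf(3) W by (auto simp: V'_def)
      then show "y \<in> D U f" using pt_iff[OF bf(2)] by blast
    qed
    ultimately show ?thesis
      using V(2) bf x by (intro exI[of _ V'] exI[of _ b] exI[of _ f] conjI ballI) (simp_all add: V'_def subset_iff)
  qed
  then obtain V b f where V: "\<And>x. x \<in> W \<Longrightarrow> opn (V x) \<and> x \<in> V x \<and> V x \<subseteq> W \<and> b x \<in> carrier R \<and>
    f x \<in> carrier R \<and> V x \<subseteq> D U (f x) \<and> (\<forall>y\<in>V x. t (pt y) = fr y (b x) (f x))" by metis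
  have un: "W = (\<Union>x\<in>W. V x)" using V by blast
  define a where "a x = inv\<^bsub>sec X (V x)\<^esub> (rres X U (V x) (f x)) \<otimes>\<^bsub>sec X (V x)\<^esub> rres X U (V x) (b x)" for x
  have a: "a x \<in> carrier (sec X (V x))"
    and ra: "\<And>y. y \<in> V x \<Longrightarrow> represents (V x) (a x) y (b x) (f x)" if x: "x \<in> W" for x
  proof -
    have Vx: "opn (V x)" "V x \<subseteq> U" "V x \<subseteq> D U (f x)" "b x \<in> carrier R" "f x \<in> carrier R"
      using V[OF x] W by auto
    interpret Vx: cring "sec X (V x)" by (rule sec_cring[OF Vx(1)])
    have u: "rres X U (V x) (f x) \<in> Units (sec X (V x))"
      using rres_Units[OF D_open Vx(1,3) Units_D[OF opnU Vx(5)]]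
        rres_comp[OF opnU D_open Vx(1,3) D_subset Vx(5)] by simp
    have bV: "rres X U (V x) (b x) \<in> carrier (sec X (V x))" by (rule rres_closed[OF opnU Vx(1,2,4)])
    show ac: "a x \<in> carrier (sec X (V x))" using u bV by (simp add: a_def)
    have "rres X U (V x) (f x) \<otimes>\<^bsub>sec X (V x)\<^esub> a x = rres X U (V x) (b x)"
      using u bV by (simp add: a_def Vx.m_assoc[symmetric] Vx.Units_closed)
    then show "represents (V x) (a x) y (b x) (f x)" if "y \<in> V x" for y
      using Vx that rres_id[OF Vx(1) ac] by (intro representsI[OF Vx(4,5) _ Vx(1)]) auto
  qed
  have "\<exists>!c. c \<in> carrier (sec X (\<Union>x\<in>W. V x)) \<and> (\<forall>x\<in>W. rres X (\<Union>x\<in>W. V x) (V x) c = a x)"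
  proof (rule is_sheaf_glue[OF sec_sheaf])
    show "opn (V x)" "a x \<in> carrier (sec X (V x))" if "x \<in> W" for x using V a that by auto
    fix x y assume x: "x \<in> W" and y: "y \<in> W"
    let ?Z = "V x \<inter> V y"
    have Vx: "opn (V x)" "V x \<subseteq> U" and Vy: "opn (V y)" "V y \<subseteq> U" using V[OF x] V[OF y] W by auto
    have Z: "opn ?Z" "?Z \<subseteq> U" "?Z \<subseteq> V x" "?Z \<subseteq> V y" using Vx Vy by auto
    show "rres X (V x) ?Z (a x) = rres X (V y) ?Z (a y)"
    proof (rule canonical_inj[OF Z(1,2) rres_closed[OF Vx(1) Z(1,3) a[OF x]] rres_closed[OF Vy(1) Z(1,4) a[OF y]]])
      show "canonical ?Z (rres X (V x) ?Z (a x)) = canonical ?Z (rres X (V y) ?Z (a y))"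
      proof (rule tilde_ext[OF canonical_closed[OF Z(1,2) rres_closed[OF Vx(1) Z(1,3) a[OF x]]]
            canonical_closed[OF Z(1,2) rres_closed[OF Vy(1) Z(1,4) a[OF y]]]])
        fix z assume z: "z \<in> ?Z"
        have "canonical ?Z (rres X (V x) ?Z (a x)) (pt z) = fr z (b x) (f x)"
          using ra[OF x, of z] represents_res[OF Vx a[OF x] Z(1,3) z] z
          by (intro canonical_at[OF Z(1,2) rres_closed[OF Vx(1) Z(1,3) a[OF x]] z]) auto
        moreover have "canonical ?Z (rres X (V y) ?Z (a y)) (pt z) = fr z (b y) (f y)"
          using ra[OF y, of z] represents_res[OF Vy a[OF y] Z(1,4) z] z
          by (intro canonical_at[OF Z(1,2) rres_closed[OF Vy(1) Z(1,4) a[OF y]] z]) auto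
        moreover have "t (pt z) = fr z (b x) (f x)" "t (pt z) = fr z (b y) (f y)"
          using V[OF x] V[OF y] z by auto
        ultimately show "canonical ?Z (rres X (V x) ?Z (a x)) (pt z) = canonical ?Z (rres X (V y) ?Z (a y)) (pt z)"
          by simp
      qed
    qed
  qed
  then obtain c where c: "c \<in> carrier (sec X W)" "\<And>x. x \<in> W \<Longrightarrow> rres X W (V x) c = a x"
    unfolding un[symmetric] by blast
  have "canonical W c = t"
  proof (rule tilde_ext[OF canonical_closed[OF W c(1)] t])
    fix x assume x: "x \<in> W"
    have Vx: "opn (V x)" "V x \<subseteq> W" "x \<in> V x" using V[OF x] by auto
    have "represents W c x (b x) (f x)"
      using represents_res[OF W c(1) Vx] ra[OF x Vx(3)] c(2)[OF x] by simp
    then have "canonical W c (pt x) = fr x (b x) (f x)" by (rule canonical_at[OF W c(1) x])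
    then show "canonical W c (pt x) = t (pt x)" using V[OF x] by simp
  qed
  then show ?thesis using c(1) by blast
qed

lemma canonical_hom:
  assumes W: "opn W" "W \<subseteq> U"
  shows "canonical W \<in> ring_hom (sec X W) (spec_sheaf R (pt ` W))"
proof -
  interpret W: cring "sec X W" by (rule sec_cring[OF W(1)])
  let ?T = "tilde R (self_module R) (pt ` W)"
  have ext: "s = t" if "s \<in> extensional (pt ` W)" "t \<in> extensional (pt ` W)"
    "\<And>x. x \<in> W \<Longrightarrow> s (pt x) = t (pt x)" for s t :: "'r set \<Rightarrow> ('r \<times> 'r) set"
    using that by (intro extensionalityI[of s "pt ` W"]) auto
  have ce: "canonical W a \<in> extensional (pt ` W)" for a by (simp add: canonical_def)
  show ?thesis
    unfolding spec_sheaf_def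
  proof (rule ring_hom_memI)
    show "canonical W a \<in> carrier ?T" if "a \<in> carrier (sec X W)" for a
      by (rule canonical_closed[OF W that])
    show "canonical W \<one>\<^bsub>sec X W\<^esub> = \<one>\<^bsub>?T\<^esub>"
    proof (rule ext[OF ce])
      show "\<one>\<^bsub>?T\<^esub> \<in> extensional (pt ` W)" by (simp add: tilde_def Let_def)
      fix x assume x: "x \<in> W"
      then have xU: "x \<in> U" using W by blast
      have "represents W \<one>\<^bsub>sec X W\<^esub> x \<one>\<^bsub>R\<^esub> \<one>\<^bsub>R\<^esub>"
        using D_one[OF opnU] xU rres_one[OF opnU W] rres_one[OF W(1) W(1) order_refl] x
        by (intro representsI[OF _ _ _ W(1) x order_refl]) simp_all
      then show "canonical W \<one>\<^bsub>sec X W\<^esub> (pt x) = \<one>\<^bsub>?T\<^esub> (pt x)"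
        using canonical_at[OF W _ x] x by (simp add: tilde_def Let_def localization_def)
    qed
    fix a a' assume a: "a \<in> carrier (sec X W)" "a' \<in> carrier (sec X W)"
    have at: "canonical W (a \<otimes>\<^bsub>sec X W\<^esub> a') (pt x) = (canonical W a \<otimes>\<^bsub>?T\<^esub> canonical W a') (pt x)"
      "canonical W (a \<oplus>\<^bsub>sec X W\<^esub> a') (pt x) = (canonical W a \<oplus>\<^bsub>?T\<^esub> canonical W a') (pt x)"
      if x: "x \<in> W" for x
    proof -
      have xU: "x \<in> U" using x W by blast
      interpret F: fractions R "self_module R" "carrier R - pt x" by (rule fractions_pt[OF xU])
      obtain b s where r: "represents W a x b s" by (rule represents_ex[OF W a(1) x])
      obtain b' s' where r': "represents W a' x b' s'" by (rule represents_ex[OF W a(2) x])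
      note bs = representsD(1,4)[OF r] representsD(1,4)[OF r']
      note comb = represents_combine[OF W x a r r']
      have m: "a \<otimes>\<^bsub>sec X W\<^esub> a' \<in> carrier (sec X W)" and p: "a \<oplus>\<^bsub>sec X W\<^esub> a' \<in> carrier (sec X W)"
        using a by auto
      have pw: "(canonical W a \<otimes>\<^bsub>?T\<^esub> canonical W a') (pt x)
          = fr x b s \<otimes>\<^bsub>localization R (carrier R - pt x) (self_module R)\<^esub> fr x b' s'"
        "(canonical W a \<oplus>\<^bsub>?T\<^esub> canonical W a') (pt x)
          = fr x b s \<oplus>\<^bsub>localization R (carrier R - pt x) (self_module R)\<^esub> fr x b' s'"
        using x canonical_at[OF W a(1) x r] canonical_at[OF W a(2) x r']
        by (simp_all add: tilde_def Let_def)
      show "canonical W (a \<otimes>\<^bsub>sec X W\<^esub> a') (pt x) = (canonical W a \<otimes>\<^bsub>?T\<^esub> canonical W a') (pt x)"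
        unfolding pw canonical_at[OF W m x comb(2)] using F.frac_mult[OF bs(1,3,2,4)] by simp
      show "canonical W (a \<oplus>\<^bsub>sec X W\<^esub> a') (pt x) = (canonical W a \<oplus>\<^bsub>?T\<^esub> canonical W a') (pt x)"
        unfolding pw canonical_at[OF W p x comb(1)]
        using F.frac_add[unfolded self_module_simps, OF bs(1,3,2,4)] by simp
    qed
    show "canonical W (a \<otimes>\<^bsub>sec X W\<^esub> a') = canonical W a \<otimes>\<^bsub>?T\<^esub> canonical W a'"
      by (rule ext[OF ce _ at(1)]) (simp add: tilde_def Let_def extensional_def)
    show "canonical W (a \<oplus>\<^bsub>sec X W\<^esub> a') = canonical W a \<oplus>\<^bsub>?T\<^esub> canonical W a'"
      by (rule ext[OF ce _ at(2)]) (simp add: tilde_def Let_def extensional_def)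
  qed
qed

text \<open>The chart is \<open>pt\<close> with \<open>canonical\<close>. Its ring is O(U) itself,
  so it has the type that \<open>affine_open\<close> prescribes.\<close>

lemma affine_open_U: "affine_open X U"
  unfolding affine_open_def
proof (intro exI)
  show "spec_chart X U R pt canonical"
    unfolding spec_chart_def
  proof (intro conjI allI impI ballI)
    show "opn U" "cring R" by (rule opnU, rule R.is_cring)
    show "homeomorphic_map (subtopology (top_of X) U) (zariski R) pt" by (rule pt_homeomorphic)
    fix W assume "opn W \<and> W \<subseteq> U"
    then have W: "opn W" "W \<subseteq> U" by auto
    have "bij_betw (canonical W) (carrier (sec X W)) (carrier (spec_sheaf R (pt ` W)))"
      unfolding bij_betw_def spec_sheaf_def
      using canonical_inj[OF W] canonical_surj[OF W] canonical_closed[OF W]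
      by (auto intro!: inj_onI)
    then show "canonical W \<in> ring_iso (sec X W) (spec_sheaf R (pt ` W))"
      using canonical_hom[OF W] by (simp add: ring_iso_def)
  next
    fix W W' a assume "opn W \<and> opn W' \<and> W' \<subseteq> W \<and> W \<subseteq> U" and a: "a \<in> carrier (sec X W)"
    then have W: "opn W" "W \<subseteq> U" and W': "opn W'" "W' \<subseteq> W" "W' \<subseteq> U" by auto
    have a': "rres X W W' a \<in> carrier (sec X W')" by (rule rres_closed[OF W(1) W'(1,2) a])
    show "canonical W' (rres X W W' a) = restrict (canonical W a) (pt ` W')"
    proof (rule extensionalityI[of _ "pt ` W'"])
      show "canonical W' (rres X W W' a) \<in> extensional (pt ` W')" by (simp add: canonical_def)
      fix Q assume "Q \<in> pt ` W'"
      then obtain x where x: "x \<in> W'" "Q = pt x" by blast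
      have xW: "x \<in> W" using x W' by blast
      obtain b s where r: "represents W a x b s" by (rule represents_ex[OF W a xW])
      have r': "represents W' (rres X W W' a) x b s"
        using r represents_res[OF W a W'(1,2) x(1)] by simp
      show "canonical W' (rres X W W' a) Q = restrict (canonical W a) (pt ` W') Q"
        using canonical_at[OF W a xW r] canonical_at[OF W'(1,3) a' x(1) r'] x by simp
    qed simp
  qed
qed

end

lemma affine_open_iff:
  assumes "scheme X"
  shows "affine_open X U \<longleftrightarrow> intrinsically_affine X U"
proof -
  interpret ringed X using assms by (simp add: ringed_def scheme_def)
  show ?thesis
  proof
    show "affine_open X U \<Longrightarrow> intrinsically_affine X U"
      unfolding affine_open_def using spec_chart_intrinsically_affine by blast
    assume "intrinsically_affine X U"
    then interpret affine_set X U
      by unfold_locales (use scheme_locally_ringed[OF assms] in auto)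
    show "affine_open X U" by (rule affine_open_U)
  qed
qed

lemma affine_set_of_affine_open:
  assumes "scheme X" "affine_open X U"
  shows "affine_set X U"
  using assms affine_open_iff[OF assms(1), of U] scheme_locally_ringed[OF assms(1)]
  by (simp add: affine_set_def affine_set_axioms_def ringed_def scheme_def)

text \<open>Shrink twice: a basic open set of \<open>V\<close> inside \<open>U\<close>, and in it a
  basic open set of \<open>U\<close>. The latter is basic in the former by restriction of
  \<open>f\<close>, hence basic in \<open>V\<close> by \<open>D_D\<close>.\<close>

lemma common_basic_open:
  assumes "affine_set X U" "affine_set X V" "x \<in> U" "x \<in> V"
  obtains f g where "f \<in> carrier (sec X U)" "g \<in> carrier (sec X V)"
    "basic_open X U f = basic_open X V g" "x \<in> basic_open X U f"
proof -
  interpret U: affine_set X U by fact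
  interpret V: affine_set X V by fact
  obtain g where g: "g \<in> carrier (sec X V)" "x \<in> basic_open X V g" "basic_open X V g \<subseteq> U"
    by (rule V.base[OF U.opnU assms(3,4)])
  let ?W = "basic_open X V g"
  obtain f where f: "f \<in> carrier (sec X U)" "x \<in> basic_open X U f" "basic_open X U f \<subseteq> ?W"
    by (rule U.base[OF U.D_open g(2) assms(3)])
  have fW: "rres X U ?W f \<in> carrier (sec X ?W)" by (rule U.rres_closed[OF U.opnU U.D_open g(3) f(1)])
  have "basic_open X ?W (rres X U ?W f) = basic_open X U f"
    using U.D_rres[OF U.opnU U.D_open g(3) f(1)] f(3) by blast
  then show ?thesis
    using U.D_D[OF V.opnU V.localizes_struct g(1) fW] that[OF f(1) _ _ f(2)] g(1)
    by (metis V.R.m_closed)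
qed

section \<open>Quasi-coherent modules on affine open sets\<close>

lemma finite_uniform_nat:
  assumes "finite F" "\<And>h. h \<in> F \<Longrightarrow> \<exists>n::nat. P h n" "\<And>h m n. \<lbrakk>h \<in> F; P h m; m \<le> n\<rbrakk> \<Longrightarrow> P h n"
  shows "\<exists>N. \<forall>h\<in>F. P h N"
proof -
  obtain n where n: "\<And>h. h \<in> F \<Longrightarrow> P h (n h)" using assms(2) by metis
  obtain N where "\<forall>i\<in>n ` F. i \<le> N" using finite_nat_set_iff_bounded_le assms(1) by blast
  then have "P h N" if "h \<in> F" for h using assms(3)[OF that n[OF that]] that by blast
  then show ?thesis by blast
qed

context module_sheaf_on
begin

lemma localizes_eq_sub:
  assumes lo: "localizes X M V" and UV: "opn U" "opn V" "V \<subseteq> U" and f: "f \<in> carrier (sec X U)"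
    and s: "s \<in> carrier (msec M V)" "s' \<in> carrier (msec M V)"
    and eq: "mres M V (V \<inter> D U f) s = mres M V (V \<inter> D U f) s'"
  shows "\<exists>n::nat. rres X U V f [^]\<^bsub>sec X V\<^esub> n \<odot>\<^bsub>msec M V\<^esub> s = rres X U V f [^]\<^bsub>sec X V\<^esub> n \<odot>\<^bsub>msec M V\<^esub> s'"
proof -
  have "mres M V (D V (rres X U V f)) s = mres M V (D V (rres X U V f)) s'"
    using eq D_rres[OF UV f] by simp
  then show ?thesis using localizes_eq[OF lo rres_closed[OF UV f] s] by blast
qed

lemma localizes_ext_sub:
  assumes lo: "localizes X M V" and UV: "opn U" "opn V" "V \<subseteq> U" and f: "f \<in> carrier (sec X U)"
    and t: "t \<in> carrier (msec M (V \<inter> D U f))"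
  shows "\<exists>n::nat. \<exists>s\<in>carrier (msec M V). mres M V (V \<inter> D U f) s
    = rres X U (V \<inter> D U f) f [^]\<^bsub>sec X (V \<inter> D U f)\<^esub> n \<odot>\<^bsub>msec M (V \<inter> D U f)\<^esub> t"
proof -
  have DV: "D V (rres X U V f) = V \<inter> D U f" by (rule D_rres[OF UV f])
  have "opn (V \<inter> D U f)" using UV D_open by blast
  then have "rres X V (V \<inter> D U f) (rres X U V f) = rres X U (V \<inter> D U f) f"
    using rres_comp[OF UV(1,2) _ _ UV(3) f] by simp
  then show ?thesis
    using localizes_ext[OF lo rres_closed[OF UV f], unfolded DV, OF t] by metis
qed

text \<open>Finitely many \<open>D U h\<close> with the property cover \<open>U\<close>. For the
  first clause a common power of \<open>f\<close> works on all of them. For the second,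
  \<open>f^N t\<close> extends to sections \<open>s h\<close> over each \<open>D U h\<close>; on
  overlaps these agree over \<open>D U f\<close>, hence after a further factor \<open>f^K\<close>,
  and the sections \<open>f^K s h\<close> glue to an extension of \<open>f^(K+N) t\<close>.\<close>

lemma localizes_from_cover:
  assumes aff: "affine_set X U"
    and cover: "\<And>x. x \<in> U \<Longrightarrow> \<exists>f\<in>carrier (sec X U). x \<in> D U f \<and> localizes X M (D U f)"
  shows "localizes X M U"
proof -
  interpret affine_set X U by (rule aff)
  interpret U: Module.module R "msec M U" by (rule msec_module[OF opnU])
  let ?E = "{f \<in> carrier R. localizes X M (D U f)}"
  have "?E \<subseteq> carrier R" "\<And>x. x \<in> U \<Longrightarrow> \<exists>f\<in>?E. x \<in> D U f" using cover by blast+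
  then obtain F where F: "finite F" "F \<subseteq> ?E" "\<forall>x\<in>U. \<exists>f\<in>F. x \<in> D U f"
    by (rule finite_subcover)
  have FR: "h \<in> carrier R" and Fl: "localizes X M (D U h)" if "h \<in> F" for h using F(2) that by auto
  have un: "U = (\<Union>h\<in>F. D U h)" using F(3) D_subset by blast
  show ?thesis
    unfolding localizes_def
  proof (intro ballI conjI impI)
    fix f assume f: "f \<in> carrier R"
    define Z where "Z h = D U h \<inter> D U f" for h
    have Z: "opn (Z h)" "Z h \<subseteq> D U h" "Z h \<subseteq> D U f" "Z h \<subseteq> U" for h
      using D_open D_subset[of U] by (auto simp: Z_def)
    {
      fix s s' assume s: "s \<in> carrier (msec M U)" "s' \<in> carrier (msec M U)"
        and eq: "mres M U (D U f) s = mres M U (D U f) s'"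
      have "\<exists>N::nat. \<forall>h\<in>F. mres M U (D U h) (f [^]\<^bsub>R\<^esub> N \<odot>\<^bsub>msec M U\<^esub> s) = mres M U (D U h) (f [^]\<^bsub>R\<^esub> N \<odot>\<^bsub>msec M U\<^esub> s')"
      proof (rule finite_uniform_nat[OF F(1)])
        fix h assume h: "h \<in> F"
        have "mres M (D U h) (Z h) (mres M U (D U h) s) = mres M (D U f) (Z h) (mres M U (D U f) s)"
          using mres_comp[OF opnU D_open Z(1,2) D_subset s(1)] mres_comp[OF opnU D_open Z(1,3) D_subset s(1)] by simp
        also have "\<dots> = mres M (D U h) (Z h) (mres M U (D U h) s')"
          unfolding eq
          using mres_comp[OF opnU D_open Z(1,2) D_subset s(2)] mres_comp[OF opnU D_open Z(1,3) D_subset s(2)] by simp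
        finally show "\<exists>N::nat. mres M U (D U h) (f [^]\<^bsub>R\<^esub> N \<odot>\<^bsub>msec M U\<^esub> s) = mres M U (D U h) (f [^]\<^bsub>R\<^esub> N \<odot>\<^bsub>msec M U\<^esub> s')"
          using localizes_eq_sub[OF Fl[OF h] opnU D_open D_subset f mres_closed[OF opnU D_open D_subset s(1)]
              mres_closed[OF opnU D_open D_subset s(2)]] s f
          by (simp add: Z_def mres_smult[OF opnU D_open D_subset] rres_pow[OF opnU D_open D_subset])
      next
        fix h and m n :: nat
        assume h: "h \<in> F" and mn: "m \<le> n"
          and e: "mres M U (D U h) (f [^]\<^bsub>R\<^esub> m \<odot>\<^bsub>msec M U\<^esub> s) = mres M U (D U h) (f [^]\<^bsub>R\<^esub> m \<odot>\<^bsub>msec M U\<^esub> s')"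
        have "f [^]\<^bsub>R\<^esub> n \<odot>\<^bsub>msec M U\<^esub> y = f [^]\<^bsub>R\<^esub> (n - m) \<odot>\<^bsub>msec M U\<^esub> (f [^]\<^bsub>R\<^esub> m \<odot>\<^bsub>msec M U\<^esub> y)"
          if "y \<in> carrier (msec M U)" for y
          using that f mn by (simp add: U.smult_assoc1[symmetric] R.nat_pow_mult)
        then show "mres M U (D U h) (f [^]\<^bsub>R\<^esub> n \<odot>\<^bsub>msec M U\<^esub> s) = mres M U (D U h) (f [^]\<^bsub>R\<^esub> n \<odot>\<^bsub>msec M U\<^esub> s')"
          using s f e by (simp add: mres_smult[OF opnU D_open D_subset])
      qed
      then obtain N :: nat where N: "\<And>h. h \<in> F \<Longrightarrow>
        mres M U (D U h) (f [^]\<^bsub>R\<^esub> N \<odot>\<^bsub>msec M U\<^esub> s) = mres M U (D U h) (f [^]\<^bsub>R\<^esub> N \<odot>\<^bsub>msec M U\<^esub> s')" by blast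
      have "f [^]\<^bsub>R\<^esub> N \<odot>\<^bsub>msec M U\<^esub> s = f [^]\<^bsub>R\<^esub> N \<odot>\<^bsub>msec M U\<^esub> s'"
        by (rule is_sheaf_unique[OF msec_sheaf D_open un _ _ N]) (use s f in auto)
      then show "\<exists>n::nat. f [^]\<^bsub>R\<^esub> n \<odot>\<^bsub>msec M U\<^esub> s = f [^]\<^bsub>R\<^esub> n \<odot>\<^bsub>msec M U\<^esub> s'" by blast
    }
    fix t assume t: "t \<in> carrier (msec M (D U f))"
    have fc: "rres X U V f \<in> carrier (sec X V)" if "opn V" "V \<subseteq> U" for V by (rule rres_closed[OF opnU that f])
    have pow_split: "rres X U V f [^]\<^bsub>sec X V\<^esub> (m + n) \<odot>\<^bsub>msec M V\<^esub> y
      = rres X U V f [^]\<^bsub>sec X V\<^esub> m \<odot>\<^bsub>msec M V\<^esub> (rres X U V f [^]\<^bsub>sec X V\<^esub> n \<odot>\<^bsub>msec M V\<^esub> y)"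
      if V: "opn V" "V \<subseteq> U" and y: "y \<in> carrier (msec M V)" for V y and m n :: nat
    proof -
      interpret V: Module.module "sec X V" "msec M V" by (rule msec_module[OF V(1)])
      show ?thesis using fc[OF V] y by (simp add: V.smult_assoc1[symmetric] V.R.nat_pow_mult)
    qed
    have pow_closed: "rres X U V f [^]\<^bsub>sec X V\<^esub> n \<odot>\<^bsub>msec M V\<^esub> y \<in> carrier (msec M V)"
      if V: "opn V" "V \<subseteq> U" and y: "y \<in> carrier (msec M V)" for V y and n :: nat
    proof -
      interpret V: Module.module "sec X V" "msec M V" by (rule msec_module[OF V(1)])
      show ?thesis using fc[OF V] y by simp
    qed
    have pow_res: "mres M V W (rres X U V f [^]\<^bsub>sec X V\<^esub> n \<odot>\<^bsub>msec M V\<^esub> y)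
      = rres X U W f [^]\<^bsub>sec X W\<^esub> n \<odot>\<^bsub>msec M W\<^esub> mres M V W y"
      if V: "opn V" "V \<subseteq> U" and W: "opn W" "W \<subseteq> V" and y: "y \<in> carrier (msec M V)" for V W y and n :: nat
    proof -
      interpret V: Module.module "sec X V" "msec M V" by (rule msec_module[OF V(1)])
      show ?thesis
        using fc[OF V] y rres_comp[OF opnU V(1) W V(2) f]
        by (simp add: mres_smult[OF V(1) W] rres_pow[OF V(1) W])
    qed
    have tZ: "mres M (D U f) (Z h) t \<in> carrier (msec M (Z h))" for h by (rule mres_closed[OF D_open Z(1,3) t])
    have "\<exists>N::nat. \<forall>h\<in>F. \<exists>s\<in>carrier (msec M (D U h)). mres M (D U h) (Z h) s
      = rres X U (Z h) f [^]\<^bsub>sec X (Z h)\<^esub> N \<odot>\<^bsub>msec M (Z h)\<^esub> mres M (D U f) (Z h) t"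
    proof (rule finite_uniform_nat[OF F(1)])
      fix h assume h: "h \<in> F"
      show "\<exists>N::nat. \<exists>s\<in>carrier (msec M (D U h)). mres M (D U h) (Z h) s
        = rres X U (Z h) f [^]\<^bsub>sec X (Z h)\<^esub> N \<odot>\<^bsub>msec M (Z h)\<^esub> mres M (D U f) (Z h) t"
        using localizes_ext_sub[OF Fl[OF h] opnU D_open D_subset f tZ[of h, unfolded Z_def]] unfolding Z_def .
    next
      fix h and m n :: nat
      assume mn: "m \<le> n" and "\<exists>s\<in>carrier (msec M (D U h)). mres M (D U h) (Z h) s
        = rres X U (Z h) f [^]\<^bsub>sec X (Z h)\<^esub> m \<odot>\<^bsub>msec M (Z h)\<^esub> mres M (D U f) (Z h) t"
      then obtain s where s: "s \<in> carrier (msec M (D U h))" "mres M (D U h) (Z h) s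
        = rres X U (Z h) f [^]\<^bsub>sec X (Z h)\<^esub> m \<odot>\<^bsub>msec M (Z h)\<^esub> mres M (D U f) (Z h) t" by blast
      show "\<exists>s\<in>carrier (msec M (D U h)). mres M (D U h) (Z h) s
        = rres X U (Z h) f [^]\<^bsub>sec X (Z h)\<^esub> n \<odot>\<^bsub>msec M (Z h)\<^esub> mres M (D U f) (Z h) t"
        using pow_res[OF D_open D_subset Z(1,2) s(1), where n = "n - m"] s(2)
          pow_split[OF Z(1,4) tZ, where m = "n - m" and n = m] mn pow_closed[OF D_open D_subset s(1), where n = "n - m"]
        by (intro bexI) auto
    qed
    then obtain N :: nat where "\<forall>h\<in>F. \<exists>s. s \<in> carrier (msec M (D U h)) \<and> mres M (D U h) (Z h) s
      = rres X U (Z h) f [^]\<^bsub>sec X (Z h)\<^esub> N \<odot>\<^bsub>msec M (Z h)\<^esub> mres M (D U f) (Z h) t" by blast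
    then obtain s where "\<forall>h\<in>F. s h \<in> carrier (msec M (D U h)) \<and> mres M (D U h) (Z h) (s h)
      = rres X U (Z h) f [^]\<^bsub>sec X (Z h)\<^esub> N \<odot>\<^bsub>msec M (Z h)\<^esub> mres M (D U f) (Z h) t"
      by (rule bchoice[THEN exE])
    then have s: "s h \<in> carrier (msec M (D U h))" and sZ: "mres M (D U h) (Z h) (s h)
      = rres X U (Z h) f [^]\<^bsub>sec X (Z h)\<^esub> N \<odot>\<^bsub>msec M (Z h)\<^esub> mres M (D U f) (Z h) t" if "h \<in> F" for h
      using that by blast+
    define Y where "Y h k = D U h \<inter> D U k" for h k
    have Y: "opn (Y h k)" "Y h k \<subseteq> D U h" "Y h k \<subseteq> D U k" "Y h k \<subseteq> U" for h k
      using D_open D_subset[of U] by (auto simp: Y_def)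
    let ?P = "\<lambda>p (n::nat). case p of (h, k) \<Rightarrow>
      rres X U (Y h k) f [^]\<^bsub>sec X (Y h k)\<^esub> n \<odot>\<^bsub>msec M (Y h k)\<^esub> mres M (D U h) (Y h k) (s h)
      = rres X U (Y h k) f [^]\<^bsub>sec X (Y h k)\<^esub> n \<odot>\<^bsub>msec M (Y h k)\<^esub> mres M (D U k) (Y h k) (s k)"
    have "\<exists>n. \<forall>p\<in>F \<times> F. ?P p n"
    proof (rule finite_uniform_nat)
      show "finite (F \<times> F)" using F(1) by simp
      fix p assume "p \<in> F \<times> F"
      then obtain h k where p: "p = (h, k)" and h: "h \<in> F" and k: "k \<in> F" by blast
      \<comment> \<open>The property is needed on the overlap \<open>Y h k\<close>, which is basic
        in \<open>D U h\<close> and inherits it from there.\<close>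
      interpret H: affine_set X "D U h"
        by unfold_locales (use affine_D[OF FR[OF h]] loc in auto)
      have kH: "rres X U (D U h) k \<in> carrier (sec X (D U h))"
        by (rule rres_closed[OF opnU D_open D_subset FR[OF k]])
      have YD: "Y h k = D (D U h) (rres X U (D U h) k)"
        using D_rres[OF opnU D_open D_subset FR[OF k]] by (simp add: Y_def)
      have lY: "localizes X M (Y h k)"
        unfolding YD by (rule localizes_D[OF D_open H.localizes_struct Fl[OF h] kH])
      let ?T = "Y h k \<inter> D U f"
      have T: "opn ?T" "?T \<subseteq> Y h k" "?T \<subseteq> Z h" "?T \<subseteq> Z k" "?T \<subseteq> D U f"
        using Y D_open by (auto simp: Y_def Z_def)
      have *: "mres M (D U i) ?T (s i) = rres X U ?T f [^]\<^bsub>sec X ?T\<^esub> N \<odot>\<^bsub>msec M ?T\<^esub> mres M (D U f) ?T t"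
        if i: "i \<in> F" "?T \<subseteq> Z i" for i
      proof -
        have "mres M (D U i) ?T (s i) = mres M (Z i) ?T (mres M (D U i) (Z i) (s i))"
          by (rule mres_comp[OF D_open Z(1) T(1) i(2) Z(2) s[OF i(1)], symmetric])
        also have "\<dots> = rres X U ?T f [^]\<^bsub>sec X ?T\<^esub> N \<odot>\<^bsub>msec M ?T\<^esub> mres M (Z i) ?T (mres M (D U f) (Z i) t)"
          unfolding sZ[OF i(1)] by (rule pow_res[OF Z(1,4) T(1) i(2) tZ])
        also have "mres M (Z i) ?T (mres M (D U f) (Z i) t) = mres M (D U f) ?T t"
          by (rule mres_comp[OF D_open Z(1) T(1) i(2) Z(3) t])
        finally show ?thesis .
      qed
      have "mres M (Y h k) ?T (mres M (D U h) (Y h k) (s h)) = mres M (Y h k) ?T (mres M (D U k) (Y h k) (s k))"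
        using mres_comp[OF D_open Y(1) T(1,2) Y(2) s[OF h]] mres_comp[OF D_open Y(1) T(1,2) Y(3) s[OF k]]
          *[OF h T(3)] *[OF k T(4)] by simp
      from localizes_eq_sub[OF lY opnU Y(1,4) f mres_closed[OF D_open Y(1,2) s[OF h]]
          mres_closed[OF D_open Y(1,3) s[OF k]] this]
      show "\<exists>n. ?P p n" by (simp add: p)
    next
      fix p and m n :: nat assume "p \<in> F \<times> F" and e: "?P p m" and mn: "m \<le> n"
      then obtain h k where p: "p = (h, k)" and h: "h \<in> F" and k: "k \<in> F" by blast
      show "?P p n"
        using pow_split[OF Y(1,4) mres_closed[OF D_open Y(1,2) s[OF h]], where m = "n - m" and n = m]
          pow_split[OF Y(1,4) mres_closed[OF D_open Y(1,3) s[OF k]], where m = "n - m" and n = m] mn e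
        by (simp add: p)
    qed
    then obtain K :: nat where K: "rres X U (Y h k) f [^]\<^bsub>sec X (Y h k)\<^esub> K \<odot>\<^bsub>msec M (Y h k)\<^esub> mres M (D U h) (Y h k) (s h)
      = rres X U (Y h k) f [^]\<^bsub>sec X (Y h k)\<^esub> K \<odot>\<^bsub>msec M (Y h k)\<^esub> mres M (D U k) (Y h k) (s k)"
      if "h \<in> F" "k \<in> F" for h k by fast
    define r where "r h = rres X U (D U h) f [^]\<^bsub>sec X (D U h)\<^esub> K \<odot>\<^bsub>msec M (D U h)\<^esub> s h" for h
    have r: "r h \<in> carrier (msec M (D U h))" if "h \<in> F" for h
      unfolding r_def by (rule pow_closed[OF D_open D_subset s[OF that]])
    have "\<exists>!y. y \<in> carrier (msec M (\<Union>h\<in>F. D U h)) \<and> (\<forall>h\<in>F. mres M (\<Union>h\<in>F. D U h) (D U h) y = r h)"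
    proof (rule is_sheaf_glue[OF msec_sheaf D_open r])
      fix h k assume h: "h \<in> F" and k: "k \<in> F"
      show "mres M (D U h) (D U h \<inter> D U k) (r h) = mres M (D U k) (D U h \<inter> D U k) (r k)"
        using K[OF h k] pow_res[OF D_open D_subset Y(1,2) s[OF h]] pow_res[OF D_open D_subset Y(1,3) s[OF k]]
        unfolding r_def Y_def[symmetric] by simp
    qed
    then obtain y where y: "y \<in> carrier (msec M U)" "\<And>h. h \<in> F \<Longrightarrow> mres M U (D U h) y = r h"
      unfolding un[symmetric] by blast
    have unf: "D U f = (\<Union>h\<in>F. Z h)" using F(3) D_subset[of U f] by (auto simp: Z_def)
    have "mres M U (D U f) y = rres X U (D U f) f [^]\<^bsub>sec X (D U f)\<^esub> (K + N) \<odot>\<^bsub>msec M (D U f)\<^esub> t"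
    proof (rule is_sheaf_unique[OF msec_sheaf Z(1) unf])
      show "mres M U (D U f) y \<in> carrier (msec M (D U f))" by (rule mres_closed[OF opnU D_open D_subset y(1)])
      show "rres X U (D U f) f [^]\<^bsub>sec X (D U f)\<^esub> (K + N) \<odot>\<^bsub>msec M (D U f)\<^esub> t \<in> carrier (msec M (D U f))"
        by (rule pow_closed[OF D_open D_subset t])
      fix h assume h: "h \<in> F"
      have "mres M (D U f) (Z h) (mres M U (D U f) y) = mres M (D U h) (Z h) (mres M U (D U h) y)"
        using mres_comp[OF opnU D_open Z(1,2) D_subset y(1)] mres_comp[OF opnU D_open Z(1,3) D_subset y(1)] by simp
      also have "\<dots> = rres X U (Z h) f [^]\<^bsub>sec X (Z h)\<^esub> K \<odot>\<^bsub>msec M (Z h)\<^esub> mres M (D U h) (Z h) (s h)"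
        unfolding y(2)[OF h] r_def by (rule pow_res[OF D_open D_subset Z(1,2) s[OF h]])
      also have "\<dots> = mres M (D U f) (Z h) (rres X U (D U f) f [^]\<^bsub>sec X (D U f)\<^esub> (K + N) \<odot>\<^bsub>msec M (D U f)\<^esub> t)"
        unfolding sZ[OF h] pow_res[OF D_open D_subset Z(1,3) t] by (rule pow_split[OF Z(1,4) tZ, symmetric])
      finally show "mres M (D U f) (Z h) (mres M U (D U f) y)
        = mres M (D U f) (Z h) (rres X U (D U f) f [^]\<^bsub>sec X (D U f)\<^esub> (K + N) \<odot>\<^bsub>msec M (D U f)\<^esub> t)" .
    qed
    then show "\<exists>n::nat. \<exists>s\<in>carrier (msec M U). mres M U (D U f) s
      = rres X U (D U f) f [^]\<^bsub>sec X (D U f)\<^esub> n \<odot>\<^bsub>msec M (D U f)\<^esub> t" using y(1) by blast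
  qed
qed

end

text \<open>The charts in \<open>quasi_coherent\<close> are tied to points, not to \<open>U\<close>.
  Around each point there is an open set basic both in \<open>U\<close> and in such a chart; it has
  the property through the chart, and \<open>U\<close> gets it from the cover by these sets.\<close>

lemma quasi_coherent_localizes:
  fixes X :: "('x, 'r) ringed_space" and M :: "('x, 'r, 'm) module_sheaf"
  assumes X: "scheme X" and M: "quasi_coherent X M" and U: "affine_set X U"
  shows "localizes X M U"
proof -
  interpret affine_set X U by (rule U)
  interpret module_sheaf_on X M
    using M by unfold_locales (simp add: quasi_coherent_def)
  show ?thesis
  proof (rule localizes_from_cover[OF U])
    fix x assume x: "x \<in> U"
    then have "x \<in> topspace (top_of X)" using openin_subset[OF opnU] by blast
    from M[unfolded quasi_coherent_def, THEN conjunct2, THEN bspec, OF this]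
    show "\<exists>f\<in>carrier (sec X U). x \<in> D U f \<and> localizes X M (D U f)"
    proof (elim exE conjE)
      fix W A h \<theta> and N :: "('r, 'm) module" and \<sigma>
      assume W: "x \<in> W" "spec_chart X W A h \<theta>" "Module.module A N" and
        iso: "\<forall>W'. openin (top_of X) W' \<and> W' \<subseteq> W \<longrightarrow>
             semilinear_iso (sec X W') (\<theta> W') (msec M W') (tilde A N (h ` W')) (\<sigma> W')" and
        res: "\<forall>W1 W'. openin (top_of X) W1 \<and> openin (top_of X) W' \<and> W' \<subseteq> W1 \<and> W1 \<subseteq> W \<longrightarrow>
             (\<forall>s\<in>carrier (msec M W1). \<sigma> W' (mres M W1 W' s) = restrict (\<sigma> W1 s) (h ` W'))"
      interpret C: module_chart X M W A h \<theta> N \<sigma>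
        by (intro module_chart.intro module_chart_axioms.intro module_sheaf_on_axioms)
          (use W iso res in blast)+
      interpret W: affine_set X W
        by unfold_locales (use loc C.intrinsically_affine_U in auto)
      obtain f g where fg: "f \<in> carrier (sec X U)" "g \<in> carrier (sec X W)" "D U f = D W g" "x \<in> D U f"
        by (rule common_basic_open[OF U W.affine_set_axioms x W(1)])
      have "localizes X M (D W g)"
        by (rule localizes_D[OF W.opnU W.localizes_struct C.localizes_U fg(2)])
      then show ?thesis using fg by auto
    qed
  qed
qed

section \<open>Recognizing localizations and base changes\<close>

lemma (in Module.module) smult_Units_inv:
  assumes "u \<in> Units R" "x \<in> carrier M"
  shows "u \<odot>\<^bsub>M\<^esub> (inv\<^bsub>R\<^esub> u \<odot>\<^bsub>M\<^esub> x) = x" "inv\<^bsub>R\<^esub> u \<odot>\<^bsub>M\<^esub> (u \<odot>\<^bsub>M\<^esub> x) = x"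
proof -
  have u: "u \<in> carrier R" "inv\<^bsub>R\<^esub> u \<in> carrier R" using assms(1) by auto
  show "u \<odot>\<^bsub>M\<^esub> (inv\<^bsub>R\<^esub> u \<odot>\<^bsub>M\<^esub> x) = x"
    unfolding smult_assoc1[OF u assms(2), symmetric] R.Units_r_inv[OF assms(1)] by (rule smult_one[OF assms(2)])
  show "inv\<^bsub>R\<^esub> u \<odot>\<^bsub>M\<^esub> (u \<odot>\<^bsub>M\<^esub> x) = x"
    unfolding smult_assoc1[OF u(2,1) assms(2), symmetric] R.Units_l_inv[OF assms(1)] by (rule smult_one[OF assms(2)])
qed

text \<open>The map \<open>m/s -> \<mu> m / \<rho> s\<close> induced on fractions, with the quotient
  given as the solution \<open>y\<close> of \<open>\<rho> s y = \<mu> m\<close>. It will be used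
  with restriction maps for \<open>\<rho>\<close> and \<open>\<mu>\<close>.\<close>

definition fraction_map :: "('r \<Rightarrow> 's) \<Rightarrow> ('s, 'n) module \<Rightarrow> ('m \<Rightarrow> 'n) \<Rightarrow> ('m \<times> 'r) set \<Rightarrow> 'n" where
  "fraction_map \<rho> N \<mu> C = (SOME y. y \<in> carrier N \<and> (\<exists>m s. (m, s) \<in> C \<and> \<rho> s \<odot>\<^bsub>N\<^esub> y = \<mu> m))"

text \<open>A criterion for \<open>N\<close> to be \<open>M\<close> localized at \<open>f\<close>,
  phrased for a map \<open>\<mu>\<close> instead of a construction: \<open>f\<close> acts
  invertibly, \<open>\<mu>\<close> identifies only elements that agree after a power of
  \<open>f\<close>, and each element of \<open>N\<close> is a fraction. For restriction from
  \<open>U\<close> to \<open>D U f\<close> the last two axioms are the two clauses of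
  \<open>localizes\<close>.\<close>

locale localized = M: Module.module R M + N: Module.module R' N
  for R :: "'r ring" and R' :: "'s ring" and M :: "('r, 'm) module" and N :: "('s, 'n) module" +
  fixes \<rho> :: "'r \<Rightarrow> 's" and \<mu> :: "'m \<Rightarrow> 'n" and f :: 'r
  assumes \<rho>: "\<rho> \<in> ring_hom R R'" and f: "f \<in> carrier R" and unit: "\<rho> f \<in> Units R'"
    and \<mu>_closed: "x \<in> carrier M \<Longrightarrow> \<mu> x \<in> carrier N"
    and \<mu>_add: "\<lbrakk>x \<in> carrier M; y \<in> carrier M\<rbrakk> \<Longrightarrow> \<mu> (x \<oplus>\<^bsub>M\<^esub> y) = \<mu> x \<oplus>\<^bsub>N\<^esub> \<mu> y"
    and \<mu>_smult: "\<lbrakk>a \<in> carrier R; x \<in> carrier M\<rbrakk> \<Longrightarrow> \<mu> (a \<odot>\<^bsub>M\<^esub> x) = \<rho> a \<odot>\<^bsub>N\<^esub> \<mu> x"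
    and \<mu>_eq: "\<lbrakk>x \<in> carrier M; y \<in> carrier M; \<mu> x = \<mu> y\<rbrakk> \<Longrightarrow>
      \<exists>n::nat. f [^]\<^bsub>R\<^esub> n \<odot>\<^bsub>M\<^esub> x = f [^]\<^bsub>R\<^esub> n \<odot>\<^bsub>M\<^esub> y"
    and \<mu>_ext: "z \<in> carrier N \<Longrightarrow> \<exists>n::nat. \<exists>x\<in>carrier M. \<mu> x = \<rho> f [^]\<^bsub>R'\<^esub> n \<odot>\<^bsub>N\<^esub> z"
begin

sublocale rho: ring_hom_cring R R' \<rho>
  using \<rho> M.R.is_cring N.R.is_cring by (simp add: ring_hom_cring_def ring_hom_cring_axioms_def)

sublocale F: fractions R M "powers R f"
  by (rule fractions_powers[OF M.module_axioms f])

abbreviation \<psi> where "\<psi> \<equiv> fraction_map \<rho> N \<mu>"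

lemma \<rho>_pow: "\<rho> (f [^]\<^bsub>R\<^esub> n) = \<rho> f [^]\<^bsub>R'\<^esub> (n::nat)"
  using f by (induction n) simp_all

lemma \<rho>_powers_Units: "s \<in> powers R f \<Longrightarrow> \<rho> s \<in> Units R'"
  unfolding powers_def using \<rho>_pow N.R.Units_pow_closed[OF unit] by auto

lemma \<mu>_zero: "\<mu> \<zero>\<^bsub>M\<^esub> = \<zero>\<^bsub>N\<^esub>"
  using \<mu>_smult[of "\<zero>\<^bsub>R\<^esub>" "\<zero>\<^bsub>M\<^esub>"] \<mu>_closed by simp

lemma fraction_map_ex:
  assumes "m \<in> carrier M" "s \<in> powers R f"
  obtains y where "y \<in> carrier N" "\<rho> s \<odot>\<^bsub>N\<^esub> y = \<mu> m"
proof
  note u = \<rho>_powers_Units[OF assms(2)]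
  show "inv\<^bsub>R'\<^esub> (\<rho> s) \<odot>\<^bsub>N\<^esub> \<mu> m \<in> carrier N" using u \<mu>_closed[OF assms(1)] by simp
  show "\<rho> s \<odot>\<^bsub>N\<^esub> (inv\<^bsub>R'\<^esub> (\<rho> s) \<odot>\<^bsub>N\<^esub> \<mu> m) = \<mu> m"
    by (rule N.smult_Units_inv(1)[OF u \<mu>_closed[OF assms(1)]])
qed

text \<open>The choice in \<open>fraction_map\<close> ranges over all pairs in the class. Any other
  pair is tied to \<open>(m, s)\<close> by some \<open>t\<close>, and cancelling the units
  \<open>\<rho> t\<close>, \<open>\<rho> s\<close> and \<open>\<rho> s'\<close> shows that it yields
  the same \<open>y\<close>.\<close>

lemma fraction_map_frac:
  assumes m: "m \<in> carrier M" and s: "s \<in> powers R f" and y: "y \<in> carrier N" "\<rho> s \<odot>\<^bsub>N\<^esub> y = \<mu> m"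
  shows "\<psi> (frac R (powers R f) M m s) = y"
  unfolding fraction_map_def
proof (rule some_equality)
  let ?C = "frac R (powers R f) M m s"
  show "y \<in> carrier N \<and> (\<exists>m' s'. (m', s') \<in> ?C \<and> \<rho> s' \<odot>\<^bsub>N\<^esub> y = \<mu> m')"
    using F.frac_mem[OF m s] y by blast
  fix y' assume "y' \<in> carrier N \<and> (\<exists>m' s'. (m', s') \<in> ?C \<and> \<rho> s' \<odot>\<^bsub>N\<^esub> y' = \<mu> m')"
  then obtain m' s' where y': "y' \<in> carrier N" "(m', s') \<in> ?C" "\<rho> s' \<odot>\<^bsub>N\<^esub> y' = \<mu> m'" by blast
  note d = F.frac_memD[OF m s y'(2)]
  obtain t where t: "t \<in> powers R f" "t \<odot>\<^bsub>M\<^esub> (s' \<odot>\<^bsub>M\<^esub> m) = t \<odot>\<^bsub>M\<^esub> (s \<odot>\<^bsub>M\<^esub> m')"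
    using F.frac_cong[OF m d(1) s d(2) d(3)[symmetric]] .
  note u = \<rho>_powers_Units[OF s] \<rho>_powers_Units[OF d(2)] \<rho>_powers_Units[OF t(1)]
  note uc = u[THEN N.R.Units_closed]
  have "\<mu> (t \<odot>\<^bsub>M\<^esub> (s' \<odot>\<^bsub>M\<^esub> m)) = \<mu> (t \<odot>\<^bsub>M\<^esub> (s \<odot>\<^bsub>M\<^esub> m'))" using t(2) by simp
  then have "\<rho> t \<odot>\<^bsub>N\<^esub> (\<rho> s' \<odot>\<^bsub>N\<^esub> (\<rho> s \<odot>\<^bsub>N\<^esub> y)) = \<rho> t \<odot>\<^bsub>N\<^esub> (\<rho> s \<odot>\<^bsub>N\<^esub> (\<rho> s' \<odot>\<^bsub>N\<^esub> y'))"
    using m d s t(1) y y' by (simp add: \<mu>_smult)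
  then have "\<rho> t \<odot>\<^bsub>N\<^esub> (\<rho> s \<odot>\<^bsub>N\<^esub> (\<rho> s' \<odot>\<^bsub>N\<^esub> y)) = \<rho> t \<odot>\<^bsub>N\<^esub> (\<rho> s \<odot>\<^bsub>N\<^esub> (\<rho> s' \<odot>\<^bsub>N\<^esub> y'))"
    using N.smult_lcomm[OF uc(2,1) y(1)] by simp
  then have "\<rho> s \<odot>\<^bsub>N\<^esub> (\<rho> s' \<odot>\<^bsub>N\<^esub> y) = \<rho> s \<odot>\<^bsub>N\<^esub> (\<rho> s' \<odot>\<^bsub>N\<^esub> y')"
    by (rule N.smult_Units_cancel[OF u(3), rotated 2]) (use uc y(1) y'(1) in auto)
  then have "\<rho> s' \<odot>\<^bsub>N\<^esub> y = \<rho> s' \<odot>\<^bsub>N\<^esub> y'"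
    by (rule N.smult_Units_cancel[OF u(1), rotated 2]) (use uc y(1) y'(1) in auto)
  then have "y = y'"
    by (rule N.smult_Units_cancel[OF u(2), rotated 2]) (use y(1) y'(1) in auto)
  then show "y' = y" by simp
qed

lemma fraction_map_one: "m \<in> carrier M \<Longrightarrow> \<psi> (frac R (powers R f) M m \<one>\<^bsub>R\<^esub>) = \<mu> m"
  by (rule fraction_map_frac[OF _ F.S_one]) (simp_all add: \<mu>_closed)

text \<open>Injectivity is \<open>\<mu>_eq\<close> after cross-multiplication, surjectivity is
  \<open>\<mu>_ext\<close>.\<close>

lemma fraction_map_bij: "bij_betw \<psi> (carrier (localization R (powers R f) M)) (carrier N)"
  unfolding bij_betw_def
proof
  show "inj_on \<psi> (carrier (localization R (powers R f) M))"
  proof (rule inj_onI)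
    fix C C' assume "C \<in> carrier (localization R (powers R f) M)" "C' \<in> carrier (localization R (powers R f) M)"
      and eq: "\<psi> C = \<psi> C'"
    then obtain m s m' s' where C: "C = frac R (powers R f) M m s" "m \<in> carrier M" "s \<in> powers R f"
      and C': "C' = frac R (powers R f) M m' s'" "m' \<in> carrier M" "s' \<in> powers R f"
      unfolding F.carrier_localization by blast
    obtain y where y: "y \<in> carrier N" "\<rho> s \<odot>\<^bsub>N\<^esub> y = \<mu> m" by (rule fraction_map_ex[OF C(2,3)])
    obtain y' where y': "y' \<in> carrier N" "\<rho> s' \<odot>\<^bsub>N\<^esub> y' = \<mu> m'" by (rule fraction_map_ex[OF C'(2,3)])
    have "y = y'" using eq fraction_map_frac[OF C(2,3) y] fraction_map_frac[OF C'(2,3) y'] C(1) C'(1) by simp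
    then have "\<mu> (s' \<odot>\<^bsub>M\<^esub> m) = \<mu> (s \<odot>\<^bsub>M\<^esub> m')"
      using y y' C C' N.smult_lcomm[of "\<rho> s" "\<rho> s'" y] by (simp add: \<mu>_smult flip: y(2) y'(2))
    then obtain n :: nat where "f [^]\<^bsub>R\<^esub> n \<odot>\<^bsub>M\<^esub> (s' \<odot>\<^bsub>M\<^esub> m) = f [^]\<^bsub>R\<^esub> n \<odot>\<^bsub>M\<^esub> (s \<odot>\<^bsub>M\<^esub> m')"
      using \<mu>_eq C C' by (meson F.S_carr M.smult_closed)
    then show "C = C'"
      unfolding C(1) C'(1) using C C'
      by (intro F.frac_eqI[where t = "f [^]\<^bsub>R\<^esub> n"]) (auto simp: powers_def)
  qed
  show "\<psi> ` carrier (localization R (powers R f) M) = carrier N"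
  proof (intro equalityI subsetI)
    fix y assume "y \<in> \<psi> ` carrier (localization R (powers R f) M)"
    then obtain m s where C: "y = \<psi> (frac R (powers R f) M m s)" "m \<in> carrier M" "s \<in> powers R f"
      unfolding F.carrier_localization by blast
    obtain z where z: "z \<in> carrier N" "\<rho> s \<odot>\<^bsub>N\<^esub> z = \<mu> m" by (rule fraction_map_ex[OF C(2,3)])
    then show "y \<in> carrier N" using C fraction_map_frac by simp
  next
    fix y assume y: "y \<in> carrier N"
    then obtain n :: nat and x where x: "x \<in> carrier M" "\<mu> x = \<rho> f [^]\<^bsub>R'\<^esub> n \<odot>\<^bsub>N\<^esub> y"
      using \<mu>_ext by blast
    have s: "f [^]\<^bsub>R\<^esub> n \<in> powers R f" by (auto simp: powers_def)
    have "\<psi> (frac R (powers R f) M x (f [^]\<^bsub>R\<^esub> n)) = y"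
      by (rule fraction_map_frac[OF x(1) s y]) (simp add: \<rho>_pow x(2))
    then show "y \<in> \<psi> ` carrier (localization R (powers R f) M)"
      using F.frac_closed[OF x(1) s] by (metis imageI)
  qed
qed

lemma fraction_map_add:
  assumes "C \<in> carrier (localization R (powers R f) M)" "C' \<in> carrier (localization R (powers R f) M)"
  shows "\<psi> (C \<oplus>\<^bsub>localization R (powers R f) M\<^esub> C') = \<psi> C \<oplus>\<^bsub>N\<^esub> \<psi> C'"
proof -
  obtain m s m' s' where C: "C = frac R (powers R f) M m s" "m \<in> carrier M" "s \<in> powers R f"
    and C': "C' = frac R (powers R f) M m' s'" "m' \<in> carrier M" "s' \<in> powers R f"
    using assms unfolding F.carrier_localization by blast
  obtain y where y: "y \<in> carrier N" "\<rho> s \<odot>\<^bsub>N\<^esub> y = \<mu> m" by (rule fraction_map_ex[OF C(2,3)])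
  obtain y' where y': "y' \<in> carrier N" "\<rho> s' \<odot>\<^bsub>N\<^esub> y' = \<mu> m'" by (rule fraction_map_ex[OF C'(2,3)])
  have "\<psi> (frac R (powers R f) M ((s' \<odot>\<^bsub>M\<^esub> m) \<oplus>\<^bsub>M\<^esub> (s \<odot>\<^bsub>M\<^esub> m')) (s \<otimes>\<^bsub>R\<^esub> s')) = y \<oplus>\<^bsub>N\<^esub> y'"
    using C C' y(1) y'(1)
    by (intro fraction_map_frac)
      (simp_all add: F.S_mult \<mu>_add \<mu>_smult N.smult_r_distr N.smult_ac flip: y(2) y'(2))
  then show ?thesis
    unfolding C(1) C'(1) F.frac_add[OF C(2) C'(2) C(3) C'(3)]
      fraction_map_frac[OF C(2,3) y] fraction_map_frac[OF C'(2,3) y'] .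
qed

text \<open>Identifies the localization of \<open>L\<close> inside that of \<open>M\<close>. The
  assumptions say that \<open>\<mu>\<close> maps \<open>L\<close> into \<open>L'\<close> and that
  elements of \<open>L'\<close> are fractions of elements of \<open>L\<close>; for sheaves the
  second is quasi-coherence of the subsheaf.\<close>

lemma fraction_map_image:
  assumes L: "L \<subseteq> carrier M" and L': "submodule L' R' N" and im: "\<And>l. l \<in> L \<Longrightarrow> \<mu> l \<in> L'"
    and ext: "\<And>y. y \<in> L' \<Longrightarrow> \<exists>n::nat. \<exists>l\<in>L. \<mu> l = \<rho> f [^]\<^bsub>R'\<^esub> n \<odot>\<^bsub>N\<^esub> y"
  shows "\<psi> ` loc_image R f M L = L'"
proof (intro equalityI subsetI)
  interpret L': submodule L' R' N by (rule L')
  have L'N: "L' \<subseteq> carrier N" using L'.subset by simp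
  fix y assume "y \<in> \<psi> ` loc_image R f M L"
  then obtain m s where C: "y = \<psi> (frac R (powers R f) M m s)" "m \<in> L" "s \<in> powers R f"
    unfolding loc_image_def by blast
  have mM: "m \<in> carrier M" using C L by blast
  note u = \<rho>_powers_Units[OF C(3)]
  let ?z = "inv\<^bsub>R'\<^esub> (\<rho> s) \<odot>\<^bsub>N\<^esub> \<mu> m"
  have z: "?z \<in> L'" using u im[OF C(2)] by (intro L'.smult_closed) auto
  have "\<rho> s \<odot>\<^bsub>N\<^esub> ?z = \<mu> m" by (rule N.smult_Units_inv(1)[OF u \<mu>_closed[OF mM]])
  then have "y = ?z" unfolding C(1) using L'N z by (intro fraction_map_frac[OF mM C(3)]) auto
  then show "y \<in> L'" using z by simp
next
  interpret L': submodule L' R' N by (rule L')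
  fix y assume y: "y \<in> L'"
  then have yN: "y \<in> carrier N" using L'.subset by auto
  obtain n :: nat and l where l: "l \<in> L" "\<mu> l = \<rho> f [^]\<^bsub>R'\<^esub> n \<odot>\<^bsub>N\<^esub> y" using ext[OF y] by blast
  have s: "f [^]\<^bsub>R\<^esub> n \<in> powers R f" by (auto simp: powers_def)
  have "\<psi> (frac R (powers R f) M l (f [^]\<^bsub>R\<^esub> n)) = y"
    by (rule fraction_map_frac[OF _ s yN]) (use l L in \<open>auto simp: \<rho>_pow\<close>)
  then show "y \<in> \<psi> ` loc_image R f M L" using l(1) s unfolding loc_image_def by blast
qed

end

text \<open>Adds that the ring \<open>R'\<close> is \<open>R\<close> localized at \<open>f\<close>,
  by the same criterion for the rings as modules over themselves. This allows scalars from
  \<open>R'\<close> to be moved across a tensor product, up to powers of \<open>f\<close>.\<close>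

locale localized_pair = localized R R' M N \<rho> \<mu> f
  for R :: "'r ring" and R' :: "'s ring" and M :: "('r, 'm) module" and N :: "('s, 'n) module"
    and \<rho> :: "'r \<Rightarrow> 's" and \<mu> :: "'m \<Rightarrow> 'n" and f :: 'r +
  assumes ring_localized: "localized R R' (self_module R) (self_module R') \<rho> \<rho> f"
begin

interpretation S: localized R R' "self_module R" "self_module R'" \<rho> \<rho> f
  by (rule ring_localized)

abbreviation ring_map where "ring_map \<equiv> fraction_map \<rho> (self_module R') \<rho>"

text \<open>The module criterion gives bijectivity and additivity; multiplicativity is checked on
  fractions by solving \<open>\<rho> s y = \<rho> a\<close> for both factors.\<close>

lemma ring_map_iso: "ring_map \<in> ring_iso (ring_localization R (powers R f)) R'"
proof -
  let ?S = "powers R f"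
  let ?Loc = "localization R ?S (self_module R)"
  have "ring_map \<in> ring_hom ?Loc R'"
  proof (rule ring_hom_memI)
    fix C assume C: "C \<in> carrier ?Loc"
    show "ring_map C \<in> carrier R'" using S.fraction_map_bij C by (auto simp: bij_betw_def)
    fix C' assume C': "C' \<in> carrier ?Loc"
    show "ring_map (C \<oplus>\<^bsub>?Loc\<^esub> C') = ring_map C \<oplus>\<^bsub>R'\<^esub> ring_map C'"
      using S.fraction_map_add[OF C C'] by simp
    obtain a s a' s' where a: "C = frac R ?S (self_module R) a s" "a \<in> carrier R" "s \<in> ?S"
      and a': "C' = frac R ?S (self_module R) a' s'" "a' \<in> carrier R" "s' \<in> ?S"
      using C C' unfolding S.F.carrier_localization self_module_simps by blast
    obtain y where y: "y \<in> carrier R'" "\<rho> s \<otimes>\<^bsub>R'\<^esub> y = \<rho> a"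
      using S.fraction_map_ex[of a s] a unfolding self_module_simps by blast
    obtain y' where y': "y' \<in> carrier R'" "\<rho> s' \<otimes>\<^bsub>R'\<^esub> y' = \<rho> a'"
      using S.fraction_map_ex[of a' s'] a' unfolding self_module_simps by blast
    note sf = S.fraction_map_frac[unfolded self_module_simps]
    have sc: "\<rho> s \<in> carrier R'" "\<rho> s' \<in> carrier R'" using a(3) a'(3) by auto
    have "\<rho> (s \<otimes>\<^bsub>R\<^esub> s') \<otimes>\<^bsub>R'\<^esub> (y \<otimes>\<^bsub>R'\<^esub> y') = \<rho> (a \<otimes>\<^bsub>R\<^esub> a')"
      using a a' y(1) y'(1) sc by (simp add: N.R.m_ac flip: y(2) y'(2))
    then have "ring_map (frac R ?S (self_module R) (a \<otimes>\<^bsub>R\<^esub> a') (s \<otimes>\<^bsub>R\<^esub> s')) = y \<otimes>\<^bsub>R'\<^esub> y'"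
      using a a' y y' by (intro sf) (auto simp: F.S_mult)
    then show "ring_map (C \<otimes>\<^bsub>?Loc\<^esub> C') = ring_map C \<otimes>\<^bsub>R'\<^esub> ring_map C'"
      unfolding a(1) a'(1) F.frac_mult[OF a(2) a'(2) a(3) a'(3)] sf[OF a(2,3) y] sf[OF a'(2,3) y'] .
  next
    show "ring_map \<one>\<^bsub>?Loc\<^esub> = \<one>\<^bsub>R'\<^esub>"
      using S.fraction_map_one[of "\<one>\<^bsub>R\<^esub>"] by (simp add: localization_def)
  qed
  then show ?thesis
    using S.fraction_map_bij by (simp add: ring_iso_def ring_localization_def)
qed

lemma ring_map_one: "a \<in> carrier R \<Longrightarrow> ring_map (frac R (powers R f) (self_module R) a \<one>\<^bsub>R\<^esub>) = \<rho> a"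
  using S.fraction_map_one by simp

lemma fraction_map_semilinear:
  "semilinear_iso (ring_localization R (powers R f)) ring_map (localization R (powers R f) M) N \<psi>"
  unfolding semilinear_iso_def ring_localization_def
proof (intro conjI ballI)
  show "bij_betw \<psi> (carrier (localization R (powers R f) M)) (carrier N)" by (rule fraction_map_bij)
  let ?S = "powers R f"
  fix C' assume C': "C' \<in> carrier (localization R ?S M)"
  show "\<psi> (C \<oplus>\<^bsub>localization R ?S M\<^esub> C') = \<psi> C \<oplus>\<^bsub>N\<^esub> \<psi> C'"
    if "C \<in> carrier (localization R ?S M)" for C using fraction_map_add that C' by blast
  fix C assume C: "C \<in> carrier (localization R ?S (self_module R))"
  obtain a s m t where a: "C = frac R ?S (self_module R) a s" "a \<in> carrier R" "s \<in> ?S"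
    and m: "C' = frac R ?S M m t" "m \<in> carrier M" "t \<in> ?S"
    using C C' unfolding S.F.carrier_localization F.carrier_localization self_module_simps by blast
  obtain u where u: "u \<in> carrier R'" "\<rho> s \<otimes>\<^bsub>R'\<^esub> u = \<rho> a"
    using S.fraction_map_ex[of a s] a unfolding self_module_simps by blast
  obtain y where y: "y \<in> carrier N" "\<rho> t \<odot>\<^bsub>N\<^esub> y = \<mu> m" by (rule fraction_map_ex[OF m(2,3)])
  have sc: "\<rho> s \<in> carrier R'" "\<rho> t \<in> carrier R'" using a(3) m(3) by auto
  have "\<rho> (s \<otimes>\<^bsub>R\<^esub> t) \<odot>\<^bsub>N\<^esub> (u \<odot>\<^bsub>N\<^esub> y) = \<mu> (a \<odot>\<^bsub>M\<^esub> m)"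
    using a m u(1) y(1) sc by (simp add: \<mu>_smult N.smult_ac flip: u(2) y(2))
  then have "\<psi> (frac R ?S M (a \<odot>\<^bsub>M\<^esub> m) (s \<otimes>\<^bsub>R\<^esub> t)) = u \<odot>\<^bsub>N\<^esub> y"
    using a m u y by (intro fraction_map_frac) (auto simp: F.S_mult)
  then show "\<psi> (C \<odot>\<^bsub>localization R ?S M\<^esub> C') = ring_map C \<odot>\<^bsub>N\<^esub> \<psi> C'"
    unfolding a(1) m(1) F.frac_smult[OF a(2) m(2) a(3) m(3)] fraction_map_frac[OF m(2,3) y]
      S.fraction_map_frac[unfolded self_module_simps, OF a(2,3) u] .
qed

section \<open>Base change to a localization\<close>

abbreviation G where "G \<equiv> free_Abelian_group (carrier M \<times> carrier R')"
abbreviation K where "K \<equiv> tensor_kernel R \<rho> R' M"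

lemma tensor_relations_closed: "tensor_relations R \<rho> R' M \<subseteq> carrier G"
proof -
  have "Poly_Mapping.keys (frag_of p - frag_of q) \<subseteq> carrier M \<times> carrier R'"
    "Poly_Mapping.keys (frag_of p - frag_of q - frag_of r) \<subseteq> carrier M \<times> carrier R'"
    if "p \<in> carrier M \<times> carrier R'" "q \<in> carrier M \<times> carrier R'" "r \<in> carrier M \<times> carrier R'" for p q r
    using that keys_diff[of "frag_of p" "frag_of q"] keys_diff[of "frag_of p - frag_of q" "frag_of r"]
    by (auto simp: keys_frag_of)
  then show ?thesis by (auto simp: tensor_relations_def)
qed

lemma K_subgroup: "subgroup K G"
  unfolding tensor_kernel_def
  by (rule group.generate_is_subgroup[OF group_free_Abelian_group tensor_relations_closed])

lemma K_closed: "c \<in> K \<Longrightarrow> Poly_Mapping.keys c \<subseteq> carrier M \<times> carrier R'"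
  using subgroup.mem_carrier[OF K_subgroup, of c] by (simp only: carrier_free_Abelian_group_iff)

lemma K_zero: "0 \<in> K"
  using subgroup.one_closed[OF K_subgroup] by simp

lemma K_add: "\<lbrakk>c \<in> K; d \<in> K\<rbrakk> \<Longrightarrow> c + d \<in> K"
  using subgroup.m_closed[OF K_subgroup, of c d] by simp

lemma K_neg: "c \<in> K \<Longrightarrow> - c \<in> K"
  using subgroup.m_inv_closed[OF K_subgroup, of c] K_closed by simp

lemma K_diff: "\<lbrakk>c \<in> K; d \<in> K\<rbrakk> \<Longrightarrow> c - d \<in> K"
  using K_add[of c "- d"] K_neg[of d] by simp

lemma
  shows K_rel_add: "\<lbrakk>m \<in> carrier M; m' \<in> carrier M; s \<in> carrier R'\<rbrakk> \<Longrightarrow>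
      frag_of (m \<oplus>\<^bsub>M\<^esub> m', s) - frag_of (m, s) - frag_of (m', s) \<in> K"
    and K_rel_smult: "\<lbrakk>r \<in> carrier R; m \<in> carrier M; s \<in> carrier R'\<rbrakk> \<Longrightarrow>
      frag_of (r \<odot>\<^bsub>M\<^esub> m, s) - frag_of (m, \<rho> r \<otimes>\<^bsub>R'\<^esub> s) \<in> K"
proof -
  have rel: "c \<in> tensor_relations R \<rho> R' M \<Longrightarrow> c \<in> K" for c
    unfolding tensor_kernel_def by (rule generate.incl)
  show "\<lbrakk>m \<in> carrier M; m' \<in> carrier M; s \<in> carrier R'\<rbrakk> \<Longrightarrow>
      frag_of (m \<oplus>\<^bsub>M\<^esub> m', s) - frag_of (m, s) - frag_of (m', s) \<in> K"
    "\<lbrakk>r \<in> carrier R; m \<in> carrier M; s \<in> carrier R'\<rbrakk> \<Longrightarrow>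
      frag_of (r \<odot>\<^bsub>M\<^esub> m, s) - frag_of (m, \<rho> r \<otimes>\<^bsub>R'\<^esub> s) \<in> K"
    by (rule rel, unfold tensor_relations_def, blast)+
qed

text \<open>The additivity relation for \<open>0 + 0 = 0\<close> is the negative of this
  generator.\<close>

lemma frag_zero_in_K: "s \<in> carrier R' \<Longrightarrow> frag_of (\<zero>\<^bsub>M\<^esub>, s) \<in> K"
  using K_neg[OF K_rel_add[of "\<zero>\<^bsub>M\<^esub>" "\<zero>\<^bsub>M\<^esub>" s]] by simp

text \<open>The additive extension of \<open>m \<otimes> s -> s \<mu> m\<close> to formal
  combinations, chosen from the universal property of the free group.\<close>

definition \<Phi> :: "('m \<times> 's \<Rightarrow>\<^sub>0 int) \<Rightarrow> 'n" where
  "\<Phi> = (SOME h. h \<in> hom G (add_monoid N) \<and>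
     (\<forall>p\<in>carrier M \<times> carrier R'. h (frag_of p) = snd p \<odot>\<^bsub>N\<^esub> \<mu> (fst p)))"

lemma \<Phi>: "\<Phi> \<in> hom G (add_monoid N)"
    "\<lbrakk>m \<in> carrier M; s \<in> carrier R'\<rbrakk> \<Longrightarrow> \<Phi> (frag_of (m, s)) = s \<odot>\<^bsub>N\<^esub> \<mu> m"
proof -
  have "comm_group (add_monoid N)" by (rule N.a_comm_group)
  moreover have "(\<lambda>p. snd p \<odot>\<^bsub>N\<^esub> \<mu> (fst p)) ` (carrier M \<times> carrier R') \<subseteq> carrier (add_monoid N)"
    using \<mu>_closed by auto
  ultimately have "\<exists>h. h \<in> hom G (add_monoid N) \<and>
     (\<forall>p\<in>carrier M \<times> carrier R'. h (frag_of p) = snd p \<odot>\<^bsub>N\<^esub> \<mu> (fst p))"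
    by (rule comm_group.free_Abelian_group_universal) blast
  from someI_ex[OF this] have *: "\<Phi> \<in> hom G (add_monoid N) \<and>
     (\<forall>p\<in>carrier M \<times> carrier R'. \<Phi> (frag_of p) = snd p \<odot>\<^bsub>N\<^esub> \<mu> (fst p))" unfolding \<Phi>_def .
  then show "\<Phi> \<in> hom G (add_monoid N)" by blast
  show "\<lbrakk>m \<in> carrier M; s \<in> carrier R'\<rbrakk> \<Longrightarrow> \<Phi> (frag_of (m, s)) = s \<odot>\<^bsub>N\<^esub> \<mu> m" using * by simp
qed

interpretation \<Phi>: group_hom G "add_monoid N" \<Phi>
  using \<Phi>(1) N.a_group by (simp add: group_hom_def group_hom_axioms_def)

lemma \<Phi>_closed: "c \<in> carrier G \<Longrightarrow> \<Phi> c \<in> carrier N"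
  using \<Phi>.hom_closed[of c] by simp

lemma \<Phi>_add: "\<lbrakk>c \<in> carrier G; d \<in> carrier G\<rbrakk> \<Longrightarrow> \<Phi> (c + d) = \<Phi> c \<oplus>\<^bsub>N\<^esub> \<Phi> d"
  using \<Phi>.hom_mult[of c d] by simp

lemma \<Phi>_zero: "\<Phi> 0 = \<zero>\<^bsub>N\<^esub>"
  using \<Phi>.hom_one by simp

lemma \<Phi>_neg: "c \<in> carrier G \<Longrightarrow> \<Phi> (- c) = \<ominus>\<^bsub>N\<^esub> \<Phi> c"
  using \<Phi>.hom_inv[of c] by (simp add: a_inv_def)

lemma G_closed: "\<lbrakk>c \<in> carrier G; d \<in> carrier G\<rbrakk> \<Longrightarrow> c - d \<in> carrier G"
  using keys_diff[of c d] by auto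

lemma \<Phi>_diff: "\<lbrakk>c \<in> carrier G; d \<in> carrier G\<rbrakk> \<Longrightarrow> \<Phi> (c - d) = \<Phi> c \<ominus>\<^bsub>N\<^esub> \<Phi> d"
  using \<Phi>_add[of c "- d"] \<Phi>_neg[of d] by (simp add: a_minus_def keys_minus)

lemma \<Phi>_diff_zero: "\<lbrakk>c \<in> carrier G; d \<in> carrier G\<rbrakk> \<Longrightarrow> \<Phi> (c - d) = \<zero>\<^bsub>N\<^esub> \<longleftrightarrow> \<Phi> c = \<Phi> d"
proof -
  assume "c \<in> carrier G" "d \<in> carrier G"
  note * = \<Phi>_diff[OF this] \<Phi>_closed[OF this(1)] \<Phi>_closed[OF this(2)]
  show ?thesis
    unfolding *(1) a_minus_def
    using *(2,3) N.M.minus_equality N.M.minus_minus N.M.a_inv_closed N.M.r_neg by metis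
qed

lemma \<Phi>_K: "c \<in> K \<Longrightarrow> \<Phi> c = \<zero>\<^bsub>N\<^esub>"
  unfolding tensor_kernel_def
proof (induction rule: generate.induct)
  case one
  then show ?case by (simp add: \<Phi>_zero)
next
  have rel: "\<Phi> h = \<zero>\<^bsub>N\<^esub>" if "h \<in> tensor_relations R \<rho> R' M" for h
  proof -
    note fc = frag_of_in_free_Abelian_group[of _ "carrier M \<times> carrier R'"]
    \<comment> \<open>The three families of relations reflect additivity of \<open>\<mu>\<close>,
      distributivity over sums of scalars, and semilinearity of \<open>\<mu>\<close>.\<close>
    consider (1) m m' s where "h = frag_of (m \<oplus>\<^bsub>M\<^esub> m', s) - frag_of (m, s) - frag_of (m', s)"
        "m \<in> carrier M" "m' \<in> carrier M" "s \<in> carrier R'"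
      | (2) m s s' where "h = frag_of (m, s \<oplus>\<^bsub>R'\<^esub> s') - frag_of (m, s) - frag_of (m, s')"
        "m \<in> carrier M" "s \<in> carrier R'" "s' \<in> carrier R'"
      | (3) r m s where "h = frag_of (r \<odot>\<^bsub>M\<^esub> m, s) - frag_of (m, \<rho> r \<otimes>\<^bsub>R'\<^esub> s)"
        "r \<in> carrier R" "m \<in> carrier M" "s \<in> carrier R'"
      using \<open>h \<in> tensor_relations R \<rho> R' M\<close> unfolding tensor_relations_def by blast
    then show ?thesis
    proof cases
      case 1
      have "frag_of (m, s) + frag_of (m', s) \<in> carrier G"
        using keys_add[of "frag_of (m, s)" "frag_of (m', s)"] 1 by (auto simp: keys_frag_of)
      then show ?thesis
        unfolding 1(1) diff_diff_eq using 1(2-) \<mu>_closed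
        by (simp add: \<Phi>_diff_zero \<Phi>_add fc \<Phi>(2) \<mu>_add N.smult_r_distr del: carrier_free_Abelian_group_iff)
    next
      case 2
      have "frag_of (m, s) + frag_of (m, s') \<in> carrier G"
        using keys_add[of "frag_of (m, s)" "frag_of (m, s')"] 2 by (auto simp: keys_frag_of)
      then show ?thesis
        unfolding 2(1) diff_diff_eq using 2(2-) \<mu>_closed
        by (simp add: \<Phi>_diff_zero \<Phi>_add fc \<Phi>(2) N.smult_l_distr del: carrier_free_Abelian_group_iff)
    next
      case 3
      then show ?thesis
        using \<mu>_closed N.smult_ac by (simp add: \<Phi>_diff_zero fc \<Phi>(2) \<mu>_smult del: carrier_free_Abelian_group_iff)
    qed
  qed
  case (incl h)
  then show ?case by (rule rel)
  case (inv h)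
  then show ?case using rel[OF inv] tensor_relations_closed \<Phi>.hom_inv[of h] by (auto simp: a_inv_def)
next
  case (eng h1 h2)
  then have "h1 \<in> carrier G" "h2 \<in> carrier G"
    using subgroup.subset[OF K_subgroup] unfolding tensor_kernel_def by blast+
  then show ?case using eng \<Phi>.hom_mult[of h1 h2] by simp
qed

text \<open>The factor \<open>f^k\<close> crosses the tensor sign and cancels against the
  denominator. This brings tensors to a common denominator and, when \<open>f^k x\<close> is zero,
  kills \<open>x \<otimes> 1/f^n\<close>.\<close>

lemma frag_scale:
  assumes "x \<in> carrier M"
  shows "frag_of (x, inv\<^bsub>R'\<^esub> (\<rho> f) [^]\<^bsub>R'\<^esub> (n::nat))
    - frag_of (f [^]\<^bsub>R\<^esub> k \<odot>\<^bsub>M\<^esub> x, inv\<^bsub>R'\<^esub> (\<rho> f) [^]\<^bsub>R'\<^esub> (n + k)) \<in> K"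
proof -
  let ?v = "inv\<^bsub>R'\<^esub> (\<rho> f)"
  have v: "?v \<in> carrier R'" using unit by simp
  have vk: "\<rho> f [^]\<^bsub>R'\<^esub> k \<otimes>\<^bsub>R'\<^esub> ?v [^]\<^bsub>R'\<^esub> k = \<one>\<^bsub>R'\<^esub>"
    using unit v by (simp add: N.R.nat_pow_distrib[symmetric] N.R.Units_closed)
  have "\<rho> (f [^]\<^bsub>R\<^esub> k) \<otimes>\<^bsub>R'\<^esub> ?v [^]\<^bsub>R'\<^esub> (n + k) = ?v [^]\<^bsub>R'\<^esub> n \<otimes>\<^bsub>R'\<^esub> (\<rho> f [^]\<^bsub>R'\<^esub> k \<otimes>\<^bsub>R'\<^esub> ?v [^]\<^bsub>R'\<^esub> k)"
    using v f by (simp add: \<rho>_pow N.R.nat_pow_mult[symmetric] N.R.m_lcomm)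
  then have "\<rho> (f [^]\<^bsub>R\<^esub> k) \<otimes>\<^bsub>R'\<^esub> ?v [^]\<^bsub>R'\<^esub> (n + k) = ?v [^]\<^bsub>R'\<^esub> n" using vk v by simp
  then show ?thesis
    using K_neg[OF K_rel_smult[of "f [^]\<^bsub>R\<^esub> k" x "?v [^]\<^bsub>R'\<^esub> (n + k)"]] assms f v by simp
qed

text \<open>Modulo the tensor relations every formal combination is a single \<open>x \<otimes> 1/f\<^sup>n\<close>, so that the kernel of \<open>\<Phi>\<close>
  can be computed in \<open>M\<close>.\<close>

lemma frag_normal_form:
  assumes "c \<in> carrier G"
  shows "\<exists>x\<in>carrier M. \<exists>n::nat. c - frag_of (x, inv\<^bsub>R'\<^esub> (\<rho> f) [^]\<^bsub>R'\<^esub> n) \<in> K"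
proof -
  let ?v = "inv\<^bsub>R'\<^esub> (\<rho> f)"
  have v: "?v \<in> carrier R'" using unit by simp
  have "Poly_Mapping.keys c \<subseteq> carrier M \<times> carrier R'" using assms by simp
  then show ?thesis
  proof (induction rule: free_Abelian_group_induct[consumes 1])
    case 1
    have "0 - frag_of (\<zero>\<^bsub>M\<^esub>, ?v [^]\<^bsub>R'\<^esub> (0::nat)) \<in> K"
      using K_diff[OF K_zero frag_zero_in_K] by simp
    then show ?case by blast
  next
    case (2 c d)
    then obtain a p b q where a: "a \<in> carrier M" "c - frag_of (a, ?v [^]\<^bsub>R'\<^esub> (p::nat)) \<in> K"
      and b: "b \<in> carrier M" "d - frag_of (b, ?v [^]\<^bsub>R'\<^esub> (q::nat)) \<in> K" by blast
    define a' where "a' = f [^]\<^bsub>R\<^esub> q \<odot>\<^bsub>M\<^esub> a"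
    define b' where "b' = f [^]\<^bsub>R\<^esub> p \<odot>\<^bsub>M\<^esub> b"
    define w where "w = ?v [^]\<^bsub>R'\<^esub> (p + q)"
    have ab: "a' \<in> carrier M" "b' \<in> carrier M" "w \<in> carrier R'"
      using a b f v by (auto simp: a'_def b'_def w_def)
    have "c - frag_of (a', w) \<in> K"
      using K_add[OF a(2) frag_scale[OF a(1), of p q]] by (simp add: a'_def w_def)
    moreover have "d - frag_of (b', w) \<in> K"
      using K_add[OF b(2) frag_scale[OF b(1), of q p]] by (simp add: b'_def w_def add.commute)
    ultimately have 1: "(c - frag_of (a', w)) - (d - frag_of (b', w)) \<in> K" by (rule K_diff)
    \<comment> \<open>The induction builds combinations by differences, so the additivity relation
      is used in the form \<open>(a' - b') + b' = a'\<close>.\<close>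
    have "(a' \<ominus>\<^bsub>M\<^esub> b') \<oplus>\<^bsub>M\<^esub> b' = a'" using ab by (simp add: a_minus_def M.M.a_assoc M.M.l_neg)
    then have 2: "frag_of (a', w) - frag_of (a' \<ominus>\<^bsub>M\<^esub> b', w) - frag_of (b', w) \<in> K"
      using K_rel_add[of "a' \<ominus>\<^bsub>M\<^esub> b'" b' w] ab by simp
    have "(c - frag_of (a', w)) - (d - frag_of (b', w))
        + (frag_of (a', w) - frag_of (a' \<ominus>\<^bsub>M\<^esub> b', w) - frag_of (b', w))
      = (c - d) - frag_of (a' \<ominus>\<^bsub>M\<^esub> b', w)" by simp
    with K_add[OF 1 2] have "(c - d) - frag_of (a' \<ominus>\<^bsub>M\<^esub> b', w) \<in> K" by (simp only:)
    then show ?case using ab unfolding w_def by (intro bexI[of _ "a' \<ominus>\<^bsub>M\<^esub> b'"]) auto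
  next
    case (3 p)
    then obtain m b where p: "p = (m, b)" "m \<in> carrier M" "b \<in> carrier R'" by blast
    \<comment> \<open>A scalar \<open>b\<close> of \<open>R'\<close> is a fraction
      \<open>a/f^n\<close>, since \<open>R'\<close> is \<open>R\<close> localized at
      \<open>f\<close>; so \<open>m \<otimes> b\<close> equals
      \<open>a m \<otimes> 1/f^n\<close>.\<close>
    obtain n :: nat and a where a: "a \<in> carrier R" "\<rho> a = \<rho> f [^]\<^bsub>R'\<^esub> n \<otimes>\<^bsub>R'\<^esub> b"
      using S.\<mu>_ext[of b] p(3) by auto
    have "?v [^]\<^bsub>R'\<^esub> n \<otimes>\<^bsub>R'\<^esub> \<rho> f [^]\<^bsub>R'\<^esub> n = \<one>\<^bsub>R'\<^esub>"
      using unit v by (simp add: N.R.nat_pow_distrib[symmetric] N.R.Units_closed)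
    moreover have "\<rho> a \<otimes>\<^bsub>R'\<^esub> ?v [^]\<^bsub>R'\<^esub> n = (?v [^]\<^bsub>R'\<^esub> n \<otimes>\<^bsub>R'\<^esub> \<rho> f [^]\<^bsub>R'\<^esub> n) \<otimes>\<^bsub>R'\<^esub> b"
      unfolding a(2) using p v f by (simp add: N.R.m_ac)
    ultimately have "\<rho> a \<otimes>\<^bsub>R'\<^esub> ?v [^]\<^bsub>R'\<^esub> n = b" using p by simp
    then have "frag_of p - frag_of (a \<odot>\<^bsub>M\<^esub> m, ?v [^]\<^bsub>R'\<^esub> n) \<in> K"
      using K_neg[OF K_rel_smult[of a m "?v [^]\<^bsub>R'\<^esub> n"]] a(1) p v by simp
    then show ?case using a p by blast
  qed
qed

text \<open>For the normal form \<open>x \<otimes> 1/f^n\<close> of \<open>c\<close>, vanishing of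
  \<open>\<Phi>\<close> gives \<open>\<mu> x = 0\<close>, hence \<open>f^k x = 0\<close> for some
  \<open>k\<close> by \<open>\<mu>_eq\<close>. The tensor then equals
  \<open>f^k x \<otimes> 1/f^(n+k)\<close>, which is zero modulo the relations.\<close>

lemma K_iff: "c \<in> carrier G \<Longrightarrow> c \<in> K \<longleftrightarrow> \<Phi> c = \<zero>\<^bsub>N\<^esub>"
proof
  assume c: "c \<in> carrier G" "\<Phi> c = \<zero>\<^bsub>N\<^esub>"
  let ?v = "inv\<^bsub>R'\<^esub> (\<rho> f)"
  have v: "?v \<in> Units R'" "?v \<in> carrier R'" using unit by auto
  obtain x and n :: nat where x: "x \<in> carrier M" "c - frag_of (x, ?v [^]\<^bsub>R'\<^esub> n) \<in> K"
    using frag_normal_form[OF c(1)] by blast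
  have fx: "frag_of (x, ?v [^]\<^bsub>R'\<^esub> n) \<in> carrier G" using x(1) v by simp
  have "\<Phi> (frag_of (x, ?v [^]\<^bsub>R'\<^esub> n)) = \<zero>\<^bsub>N\<^esub>"
    using \<Phi>_K[OF x(2)] \<Phi>_diff_zero[OF c(1) fx] c(2) by simp
  then have "?v [^]\<^bsub>R'\<^esub> n \<odot>\<^bsub>N\<^esub> \<mu> x = ?v [^]\<^bsub>R'\<^esub> n \<odot>\<^bsub>N\<^esub> \<zero>\<^bsub>N\<^esub>"
    using \<Phi>(2)[OF x(1), of "?v [^]\<^bsub>R'\<^esub> n"] v by simp
  then have "\<mu> x = \<mu> \<zero>\<^bsub>M\<^esub>"
    using N.smult_Units_cancel[OF N.R.Units_pow_closed[OF v(1)]] \<mu>_closed[OF x(1)] \<mu>_zero by simp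
  then obtain k :: nat where "f [^]\<^bsub>R\<^esub> k \<odot>\<^bsub>M\<^esub> x = f [^]\<^bsub>R\<^esub> k \<odot>\<^bsub>M\<^esub> \<zero>\<^bsub>M\<^esub>"
    using \<mu>_eq[OF x(1), of "\<zero>\<^bsub>M\<^esub>"] by auto
  then have "f [^]\<^bsub>R\<^esub> k \<odot>\<^bsub>M\<^esub> x = \<zero>\<^bsub>M\<^esub>" using f by simp
  then have "frag_of (x, ?v [^]\<^bsub>R'\<^esub> n) - frag_of (\<zero>\<^bsub>M\<^esub>, ?v [^]\<^bsub>R'\<^esub> (n + k)) \<in> K"
    using frag_scale[OF x(1), of n k] by simp
  then have "frag_of (x, ?v [^]\<^bsub>R'\<^esub> n) \<in> K"
    using K_add[OF _ frag_zero_in_K[of "?v [^]\<^bsub>R'\<^esub> (n + k)"]] v by fastforce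
  then show "c \<in> K" using K_add[OF x(2)] by fastforce
qed (rule \<Phi>_K)

text \<open>With the tensor relations equal to the kernel, cosets are fibres of
  \<open>\<Phi>\<close>; from here on classes are handled through their value under
  \<open>\<Phi>\<close>.\<close>

lemma tensor_class_eq: "c \<in> carrier G \<Longrightarrow> tensor_class R \<rho> R' M c = {d \<in> carrier G. \<Phi> d = \<Phi> c}"
proof (intro equalityI subsetI)
  fix d assume c: "c \<in> carrier G" and "d \<in> tensor_class R \<rho> R' M c"
  then obtain k where k: "k \<in> K" "d = k + c" by (auto simp: tensor_class_def r_coset_def)
  have kG: "k \<in> carrier G" using K_closed[OF k(1)] by simp
  then show "d \<in> {d \<in> carrier G. \<Phi> d = \<Phi> c}"
    using c k keys_add[of k c] \<Phi>_add[OF kG c] \<Phi>_K[OF k(1)] \<Phi>_closed[OF c] by auto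
next
  fix d assume c: "c \<in> carrier G" and "d \<in> {d \<in> carrier G. \<Phi> d = \<Phi> c}"
  then have d: "d \<in> carrier G" "\<Phi> d = \<Phi> c" by auto
  have "d - c \<in> K" using K_iff[OF G_closed[OF d(1) c]] \<Phi>_diff_zero[OF d(1) c] d(2) by blast
  then show "d \<in> tensor_class R \<rho> R' M c"
    unfolding tensor_class_def r_coset_def by (auto intro!: bexI[of _ "d - c"])
qed

definition tensor_map :: "('m \<times> 's \<Rightarrow>\<^sub>0 int) set \<Rightarrow> 'n" where
  "tensor_map C = \<Phi> (SOME c. c \<in> C)"

lemma tensor_map_class: "c \<in> carrier G \<Longrightarrow> tensor_map (tensor_class R \<rho> R' M c) = \<Phi> c"
proof -
  assume c: "c \<in> carrier G"
  have "c \<in> tensor_class R \<rho> R' M c" using c by (simp add: tensor_class_eq)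
  then have "(SOME d. d \<in> tensor_class R \<rho> R' M c) \<in> tensor_class R \<rho> R' M c" by (rule someI)
  then show ?thesis using c by (simp add: tensor_map_def tensor_class_eq)
qed

lemma carrier_tensor_group: "carrier (tensor_group R \<rho> R' M) = tensor_class R \<rho> R' M ` carrier G"
  by (auto simp: tensor_group_def FactGroup_def RCOSETS_def tensor_class_def)

lemma K_normal: "K \<lhd> G"
  using comm_group.normal_iff_subgroup[OF abelian_free_Abelian_group] K_subgroup by blast

lemma tensor_group_group: "group (tensor_group R \<rho> R' M)"
  unfolding tensor_group_def by (rule normal.factorgroup_is_group[OF K_normal])

lemma tensor_map_hom: "tensor_map \<in> hom (tensor_group R \<rho> R' M) (add_monoid N)"
proof (rule homI)
  show "tensor_map C \<in> carrier (add_monoid N)" if "C \<in> carrier (tensor_group R \<rho> R' M)" for C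
    using that tensor_map_class \<Phi>_closed unfolding carrier_tensor_group by auto
  fix C C' assume "C \<in> carrier (tensor_group R \<rho> R' M)" "C' \<in> carrier (tensor_group R \<rho> R' M)"
  then obtain c d where c: "c \<in> carrier G" "C = tensor_class R \<rho> R' M c"
    and d: "d \<in> carrier G" "C' = tensor_class R \<rho> R' M d" unfolding carrier_tensor_group by blast
  have cd: "c + d \<in> carrier G" using c d keys_add[of c d] by auto
  have "C \<otimes>\<^bsub>tensor_group R \<rho> R' M\<^esub> C' = tensor_class R \<rho> R' M (c + d)"
    using normal.rcos_sum[OF K_normal c(1) d(1)]
    unfolding c(2) d(2) tensor_group_def FactGroup_def tensor_class_def by simp
  then show "tensor_map (C \<otimes>\<^bsub>tensor_group R \<rho> R' M\<^esub> C') = tensor_map C \<otimes>\<^bsub>add_monoid N\<^esub> tensor_map C'"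
    using c d cd by (simp add: tensor_map_class \<Phi>_add)
qed

text \<open>\<open>base_change\<close> scales each representative of a class. Scaling multiplies
  \<open>\<Phi>\<close> by \<open>s\<close>, so the resulting class depends only on the class that
  was scaled. Membership in \<open>G\<close> is carried along because the induction step for
  \<open>\<Phi>\<close> needs it.\<close>

lemma frag_extend_smult:
  assumes s: "s \<in> carrier R'" and "c \<in> carrier G"
  shows "frag_extend (\<lambda>(m, t). frag_of (m, s \<otimes>\<^bsub>R'\<^esub> t)) c \<in> carrier G
    \<and> \<Phi> (frag_extend (\<lambda>(m, t). frag_of (m, s \<otimes>\<^bsub>R'\<^esub> t)) c) = s \<odot>\<^bsub>N\<^esub> \<Phi> c"
proof -
  have "Poly_Mapping.keys c \<subseteq> carrier M \<times> carrier R'" using assms by simp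
  then show ?thesis
  proof (induction rule: free_Abelian_group_induct[consumes 1])
    case 1
    then show ?case using s by (simp add: \<Phi>_zero)
  next
    case (2 c d)
    have cd: "c \<in> carrier G" "d \<in> carrier G" using 2(1,2) by simp_all
    show ?case
      unfolding frag_extend_diff
      using 2(3,4) s cd \<Phi>_closed[OF cd(1)] \<Phi>_closed[OF cd(2)]
      by (auto simp only: G_closed \<Phi>_diff a_minus_def N.smult_r_distr N.smult_r_minus N.M.a_inv_closed)
  next
    case (3 p)
    then show ?case using s \<mu>_closed by (auto simp: \<Phi>(2) N.smult_assoc1)
  qed
qed

lemma tensor_map_semilinear: "semilinear_iso R' (\<lambda>a. a) (base_change R \<rho> R' M) N tensor_map"
  unfolding semilinear_iso_def
proof (intro conjI ballI)
  have carr: "carrier (base_change R \<rho> R' M) = tensor_class R \<rho> R' M ` carrier G"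
    by (simp add: base_change_def carrier_tensor_group)
  show "bij_betw tensor_map (carrier (base_change R \<rho> R' M)) (carrier N)"
    unfolding bij_betw_def
  proof
    show "inj_on tensor_map (carrier (base_change R \<rho> R' M))"
    proof (rule inj_onI)
      fix C C' assume "C \<in> carrier (base_change R \<rho> R' M)" "C' \<in> carrier (base_change R \<rho> R' M)"
        and eq: "tensor_map C = tensor_map C'"
      then obtain c d where c: "c \<in> carrier G" "C = tensor_class R \<rho> R' M c"
        and d: "d \<in> carrier G" "C' = tensor_class R \<rho> R' M d" unfolding carr by blast
      have "\<Phi> c = \<Phi> d" using eq tensor_map_class[OF c(1)] tensor_map_class[OF d(1)] c(2) d(2) by simp
      then show "C = C'" unfolding c(2) d(2) tensor_class_eq[OF c(1)] tensor_class_eq[OF d(1)] by simp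
    qed
    show "tensor_map ` carrier (base_change R \<rho> R' M) = carrier N"
    proof (intro equalityI subsetI)
      fix y assume "y \<in> tensor_map ` carrier (base_change R \<rho> R' M)"
      then show "y \<in> carrier N" unfolding carr using \<Phi>_closed tensor_map_class by auto
    next
      fix y assume y: "y \<in> carrier N"
      obtain n :: nat and x where x: "x \<in> carrier M" "\<mu> x = \<rho> f [^]\<^bsub>R'\<^esub> n \<odot>\<^bsub>N\<^esub> y" using \<mu>_ext[OF y] by blast
      let ?w = "inv\<^bsub>R'\<^esub> (\<rho> f [^]\<^bsub>R'\<^esub> n)"
      have u: "\<rho> f [^]\<^bsub>R'\<^esub> n \<in> Units R'" by (rule N.R.Units_pow_closed[OF unit])
      have xw: "frag_of (x, ?w) \<in> carrier G" using x u by simp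
      have "\<Phi> (frag_of (x, ?w)) = (?w \<otimes>\<^bsub>R'\<^esub> \<rho> f [^]\<^bsub>R'\<^esub> n) \<odot>\<^bsub>N\<^esub> y"
        using x u y by (simp add: \<Phi>(2) N.smult_assoc1 N.R.Units_closed del: N.R.Units_l_inv)
      also have "\<dots> = y" using u y by simp
      finally show "y \<in> tensor_map ` carrier (base_change R \<rho> R' M)"
        unfolding carr using tensor_map_class[OF xw] xw by (metis imageI)
    qed
  qed
  fix C assume C: "C \<in> carrier (base_change R \<rho> R' M)"
  show "tensor_map (C' \<oplus>\<^bsub>base_change R \<rho> R' M\<^esub> C) = tensor_map C' \<oplus>\<^bsub>N\<^esub> tensor_map C"
    if "C' \<in> carrier (base_change R \<rho> R' M)" for C'
    using hom_mult[OF tensor_map_hom, of C' C] that C by (simp add: base_change_def)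
  fix s assume s: "s \<in> carrier R'"
  obtain c where c: "c \<in> carrier G" "C = tensor_class R \<rho> R' M c" using C unfolding carr by blast
  let ?e = "frag_extend (\<lambda>(m, t). frag_of (m, s \<otimes>\<^bsub>R'\<^esub> t))"
  have "(\<Union>d\<in>C. tensor_class R \<rho> R' M (?e d)) = tensor_class R \<rho> R' M (?e c)"
  proof (rule SUP_eq_const)
    show "C \<noteq> {}" using c tensor_class_eq by auto
    fix d assume "d \<in> C"
    then have d: "d \<in> carrier G" "\<Phi> d = \<Phi> c" using c tensor_class_eq by auto
    show "tensor_class R \<rho> R' M (?e d) = tensor_class R \<rho> R' M (?e c)"
      using frag_extend_smult[OF s d(1)] frag_extend_smult[OF s c(1)] d(2) tensor_class_eq by simp
  qed
  then have "s \<odot>\<^bsub>base_change R \<rho> R' M\<^esub> C = tensor_class R \<rho> R' M (?e c)" by (simp add: base_change_def)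
  then show "tensor_map (s \<odot>\<^bsub>base_change R \<rho> R' M\<^esub> C) = s \<odot>\<^bsub>N\<^esub> tensor_map C"
    using frag_extend_smult[OF s c(1)] c tensor_map_class by simp
qed

lemma tensor_map_pure:
  "\<lbrakk>m \<in> carrier M; s \<in> carrier R'\<rbrakk> \<Longrightarrow> tensor_map (pure_tensor R \<rho> R' M m s) = s \<odot>\<^bsub>N\<^esub> \<mu> m"
  by (simp add: pure_tensor_def tensor_map_class \<Phi>(2))

text \<open>The image is generated by the elements \<open>s \<mu> l\<close>, which lie in the
  submodule \<open>L'\<close>; conversely, \<open>y\<close> with \<open>f^n y = \<mu> l\<close> is
  the image of \<open>l \<otimes> 1/f^n\<close>.\<close>

lemma tensor_map_image:
  assumes L: "L \<subseteq> carrier M" and L': "submodule L' R' N" and im: "\<And>l. l \<in> L \<Longrightarrow> \<mu> l \<in> L'"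
    and ext: "\<And>y. y \<in> L' \<Longrightarrow> \<exists>n::nat. \<exists>l\<in>L. \<mu> l = \<rho> f [^]\<^bsub>R'\<^esub> n \<odot>\<^bsub>N\<^esub> y"
  shows "tensor_map ` base_change_image R \<rho> R' M L = L'"
proof (intro equalityI subsetI)
  interpret L': submodule L' R' N by (rule L')
  interpret T: group "tensor_group R \<rho> R' M" by (rule tensor_group_group)
  interpret T: group_hom "tensor_group R \<rho> R' M" "add_monoid N" tensor_map
    using tensor_map_hom tensor_group_group N.a_group by (simp add: group_hom_def group_hom_axioms_def)
  have pure: "pure_tensor R \<rho> R' M l s \<in> carrier (tensor_group R \<rho> R' M)"
    "tensor_map (pure_tensor R \<rho> R' M l s) \<in> L'" if "l \<in> L" "s \<in> carrier R'" for l s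
    using that L im by (auto simp: carrier_tensor_group pure_tensor_def[abs_def] tensor_map_pure[unfolded pure_tensor_def] subset_iff)
  have "C \<in> carrier (tensor_group R \<rho> R' M) \<and> tensor_map C \<in> L'" if "C \<in> base_change_image R \<rho> R' M L" for C
    using that unfolding base_change_image_def
  proof (induction rule: generate.induct)
    case one
    then show ?case using T.hom_one L'.one_closed by simp
  next
    case (incl h)
    then show ?case using pure by blast
  next
    case (inv h)
    then have "h \<in> carrier (tensor_group R \<rho> R' M)" "tensor_map h \<in> L'" using pure by blast+
    then show ?case using T.hom_inv L'.m_inv_closed by simp
  next
    case (eng h1 h2)
    then show ?case using T.hom_mult L'.m_closed by simp
  qed
  then show "y \<in> L'" if "y \<in> tensor_map ` base_change_image R \<rho> R' M L" for y using that by blast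
next
  interpret L': submodule L' R' N by (rule L')
  fix y assume y: "y \<in> L'"
  then have yN: "y \<in> carrier N" using L'.subset by auto
  obtain n :: nat and l where l: "l \<in> L" "\<mu> l = \<rho> f [^]\<^bsub>R'\<^esub> n \<odot>\<^bsub>N\<^esub> y" using ext[OF y] by blast
  let ?w = "inv\<^bsub>R'\<^esub> (\<rho> f [^]\<^bsub>R'\<^esub> n)"
  have u: "\<rho> f [^]\<^bsub>R'\<^esub> n \<in> Units R'" by (rule N.R.Units_pow_closed[OF unit])
  then have w: "?w \<in> carrier R'" by simp
  have lM: "l \<in> carrier M" using l L by blast
  have "tensor_map (pure_tensor R \<rho> R' M l ?w) = (?w \<otimes>\<^bsub>R'\<^esub> \<rho> f [^]\<^bsub>R'\<^esub> n) \<odot>\<^bsub>N\<^esub> y"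
    using tensor_map_pure[OF lM w] l(2) u yN w
    by (simp add: N.smult_assoc1 N.R.Units_closed del: N.R.Units_l_inv)
  then have "tensor_map (pure_tensor R \<rho> R' M l ?w) = y" using u yN by simp
  moreover have "pure_tensor R \<rho> R' M l ?w \<in> base_change_image R \<rho> R' M L"
    unfolding base_change_image_def using l(1) w by (intro generate.incl) blast
  ultimately show "y \<in> tensor_map ` base_change_image R \<rho> R' M L" by (metis imageI)
qed

end

section \<open>The closure sheaf on affine open sets\<close>

context module_sheaf_on
begin

lemma localized_sections:
  assumes U: "opn U" and lo: "localizes X M U" and f: "f \<in> carrier (sec X U)"
  shows "localized (sec X U) (sec X (D U f)) (msec M U) (msec M (D U f)) (rres X U (D U f)) (mres M U (D U f)) f"
proof (intro localized.intro localized_axioms.intro)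
  show "Module.module (sec X U) (msec M U)" by (rule msec_module[OF U])
  show "Module.module (sec X (D U f)) (msec M (D U f))" by (rule msec_module[OF D_open])
  show "rres X U (D U f) \<in> ring_hom (sec X U) (sec X (D U f))" by (rule rres_hom[OF U D_open D_subset])
  show "f \<in> carrier (sec X U)" by (rule f)
  show "rres X U (D U f) f \<in> Units (sec X (D U f))" by (rule Units_D[OF U f])
next
  fix x y assume "x \<in> carrier (msec M U)" "y \<in> carrier (msec M U)" "mres M U (D U f) x = mres M U (D U f) y"
  then show "\<exists>n::nat. f [^]\<^bsub>sec X U\<^esub> n \<odot>\<^bsub>msec M U\<^esub> x = f [^]\<^bsub>sec X U\<^esub> n \<odot>\<^bsub>msec M U\<^esub> y"
    using localizes_eq[OF lo f] by blast
next
  fix z assume "z \<in> carrier (msec M (D U f))"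
  then show "\<exists>n::nat. \<exists>x\<in>carrier (msec M U). mres M U (D U f) x
    = rres X U (D U f) f [^]\<^bsub>sec X (D U f)\<^esub> n \<odot>\<^bsub>msec M (D U f)\<^esub> z"
    using localizes_ext[OF lo f] by blast
qed (simp_all add: mres_closed[OF U D_open D_subset] mres_add[OF U D_open D_subset] mres_smult[OF U D_open D_subset])

lemma localized_pair_sections:
  assumes U: "opn U" and O: "localizes X (struct_module X) U" and M: "localizes X M U"
    and f: "f \<in> carrier (sec X U)"
  shows "localized_pair (sec X U) (sec X (D U f)) (msec M U) (msec M (D U f)) (rres X U (D U f)) (mres M U (D U f)) f"
  using localized_sections[OF U M f] module_sheaf_on.localized_sections[OF struct_module_sheaf U O f]
  by (simp add: localized_pair_def localized_pair_axioms_def struct_module_def)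

end

section \<open>Persistence and gluing along basic open sets\<close>

locale closure_setting =
  fixes X :: "('x, 'r) ringed_space" and cl :: "('x, 'r, 'm) module_closure"
    and M :: "('x, 'r, 'm) module_sheaf" and L :: "'x set \<Rightarrow> 'm set"
  assumes X: "scheme X" and cl: "preclosure_operation X cl" and glue: "glueable X cl"
    and M: "quasi_coherent X M" and L: "quasi_coherent_submodule X M L"
begin

sublocale module_sheaf_on X M
  using X M by unfold_locales (simp_all add: scheme_def quasi_coherent_def)

lemma submodule_L: "opn U \<Longrightarrow> submodule (L U) (sec X U) (msec M U)"
  using L by (simp add: quasi_coherent_submodule_def submodule_sheaf_def)

lemma L_subset: "opn U \<Longrightarrow> L U \<subseteq> carrier (msec M U)"
  using submodule.axioms(1)[OF submodule_L] subgroup.subset by fastforce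

lemma mres_L:
  assumes "opn U" "opn V" "V \<subseteq> U" "l \<in> L U"
  shows "mres M U V l \<in> L V"
proof -
  have "is_sheaf (top_of X) L (mres M)"
    using L by (simp add: quasi_coherent_submodule_def submodule_sheaf_def subsheaf_def)
  from is_sheaf_closed[OF this assms] show ?thesis .
qed

lemma affine: "affine_open X U \<Longrightarrow> affine_set X U"
  by (rule affine_set_of_affine_open[OF X])

lemma opn_affine: "affine_open X U \<Longrightarrow> opn U"
  using affine_set.opnU[OF affine] .

lemma affine_open_D:
  assumes "affine_open X U" "f \<in> carrier (sec X U)"
  shows "affine_open X (D U f)"
  using affine_set.affine_D[OF affine[OF assms(1)] assms(2)] affine_open_iff[OF X] by simp

lemma affine_base:
  assumes "opn U" "x \<in> U"
  obtains V where "affine_open X V" "x \<in> V" "V \<subseteq> U"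
proof -
  have "x \<in> topspace (top_of X)" using openin_subset[OF assms(1)] assms(2) by blast
  then obtain W where W: "x \<in> W" "affine_open X W" using X unfolding scheme_def by blast
  obtain f where f: "f \<in> carrier (sec X W)" "x \<in> D W f" "D W f \<subseteq> U"
    by (rule affine_set.base[OF affine[OF W(2)] assms W(1)])
  show ?thesis by (rule that[OF affine_open_D[OF W(2) f(1)] f(2,3)])
qed

lemma cl_submodule: "affine_open X U \<Longrightarrow> submodule (cl U (msec M U) (L U)) (sec X U) (msec M U)"
proof -
  assume U: "affine_open X U"
  note oU = opn_affine[OF U]
  have "affine_open X U \<and> Module.module (sec X U) (msec M U) \<and> submodule (L U) (sec X U) (msec M U)"
    using U msec_module[OF oU] submodule_L[OF oU] by simp
  from cl[unfolded preclosure_operation_def, THEN conjunct1, THEN spec, THEN spec, THEN spec, THEN mp, OF this]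
  show ?thesis by simp
qed

lemma cl_subset:
  assumes "affine_open X U"
  shows "cl U (msec M U) (L U) \<subseteq> carrier (msec M U)"
proof -
  interpret submodule "cl U (msec M U) (L U)" "sec X U" "msec M U" by (rule cl_submodule[OF assms])
  show ?thesis using subset by simp
qed

text \<open>\<open>L\<close> with the structure of \<open>M\<close> is a quasi-coherent module sheaf
  in its own right, so \<open>localizes\<close> holds for it on every affine open set. The numerator
  found in this way lies in \<open>L U\<close>, not merely in \<open>M\<close>.\<close>

lemma L_ext:
  assumes U: "affine_open X U" and f: "f \<in> carrier (sec X U)" and y: "y \<in> L (D U f)"
  shows "\<exists>n::nat. \<exists>l\<in>L U. mres M U (D U f) l = rres X U (D U f) f [^]\<^bsub>sec X (D U f)\<^esub> n \<odot>\<^bsub>msec M (D U f)\<^esub> y"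
proof -
  let ?L = "sub_module_sheaf M L"
  have loc: "localizes X ?L U"
    using L by (intro quasi_coherent_localizes[OF X _ affine[OF U]]) (simp add: quasi_coherent_submodule_def)
  have y': "y \<in> carrier (msec ?L (D U f))" using y by (simp add: sub_module_sheaf_def)
  show ?thesis
  proof (rule localizes_ext[OF loc f y'])
    fix n :: nat and l assume "l \<in> carrier (msec ?L U)"
      "mres ?L U (D U f) l = rres X U (D U f) f [^]\<^bsub>sec X (D U f)\<^esub> n \<odot>\<^bsub>msec ?L (D U f)\<^esub> y"
    then have "l \<in> L U"
      "mres M U (D U f) l = rres X U (D U f) f [^]\<^bsub>sec X (D U f)\<^esub> n \<odot>\<^bsub>msec M (D U f)\<^esub> y"
      by (simp_all add: sub_module_sheaf_def)
    then show ?thesis by blast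
  qed
qed

lemma localized_pair_D:
  assumes U: "affine_open X U" and f: "f \<in> carrier (sec X U)"
  shows "localized_pair (sec X U) (sec X (D U f)) (msec M U) (msec M (D U f)) (rres X U (D U f)) (mres M U (D U f)) f"
  by (rule localized_pair_sections[OF opn_affine[OF U] affine_set.localizes_struct[OF affine[OF U]]
        quasi_coherent_localizes[OF X M affine[OF U]] f])

text \<open>The module of sections over \<open>D U f\<close> serves as the copy of the base change,
  through \<open>tensor_map\<close>. Under it the image of the base change of \<open>L U\<close>
  becomes \<open>L (D U f)\<close>, and \<open>s \<otimes> 1\<close> becomes the restriction of
  \<open>s\<close>.\<close>

lemma persistent_D:
  assumes U: "affine_open X U" and f: "f \<in> carrier (sec X U)" and s: "s \<in> cl U (msec M U) (L U)"
  shows "mres M U (D U f) s \<in> cl (D U f) (msec M (D U f)) (L (D U f))"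
proof -
  let ?V = "D U f"
  note oU = opn_affine[OF U]
  interpret P: localized_pair "sec X U" "sec X ?V" "msec M U" "msec M ?V" "rres X U ?V" "mres M U ?V" f
    by (rule localized_pair_D[OF U f])
  have sM: "s \<in> carrier (msec M U)" using cl_subset[OF U] s by blast
  have model: "base_change_model X U ?V (msec M U) (msec M ?V) P.tensor_map"
    using P.tensor_map_semilinear msec_module[OF D_open] by (simp add: base_change_model_def)
  have "openly_persistent X cl" using glue by (simp add: glueable_def)
  then have "P.tensor_map (pure_tensor (sec X U) (rres X U ?V) (sec X ?V) (msec M U) s \<one>\<^bsub>sec X ?V\<^esub>)
    \<in> cl ?V (msec M ?V) (P.tensor_map ` base_change_image (sec X U) (rres X U ?V) (sec X ?V) (msec M U) (L U))"
    unfolding openly_persistent_def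
    using U affine_open_D[OF U f] D_subset msec_module[OF oU] submodule_L[OF oU] model s by blast
  moreover have "P.tensor_map ` base_change_image (sec X U) (rres X U ?V) (sec X ?V) (msec M U) (L U) = L ?V"
    by (rule P.tensor_map_image[OF L_subset[OF oU] submodule_L[OF D_open]])
      (use mres_L[OF oU D_open D_subset] L_ext[OF U f] in auto)
  moreover have "P.tensor_map (pure_tensor (sec X U) (rres X U ?V) (sec X ?V) (msec M U) s \<one>\<^bsub>sec X ?V\<^esub>)
      = mres M U ?V s"
    using P.tensor_map_pure[OF sM] P.\<mu>_closed[OF sM] by simp
  ultimately show ?thesis by simp
qed

text \<open>The section modules over \<open>D V f\<close> are taken as models of the localizations,
  with the fraction maps as identifications; the hypothesis of gluing is then membership of
  restrictions. At \<open>g = 1\<close> the basic open set is \<open>V\<close>, and the conclusion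
  speaks about \<open>s\<close> itself.\<close>

lemma glue_D:
  assumes V: "affine_open X V" and s: "s \<in> carrier (msec M V)"
    and cover: "\<And>x. x \<in> V \<Longrightarrow> \<exists>f\<in>carrier (sec X V). x \<in> D V f \<and>
      mres M V (D V f) s \<in> cl (D V f) (msec M (D V f)) (L (D V f))"
  shows "s \<in> cl V (msec M V) (L V)"
proof -
  note oV = opn_affine[OF V]
  interpret V: affine_set X V by (rule affine[OF V])
  \<comment> \<open>All functions over whose basic open sets \<open>s\<close> lies in the closure;
    by \<open>cover\<close> they generate the unit ideal.\<close>
  define E where "E = {f \<in> carrier (sec X V). mres M V (D V f) s \<in> cl (D V f) (msec M (D V f)) (L (D V f))}"
  define \<theta> where "\<theta> f = fraction_map (rres X V (D V f)) (self_module (sec X (D V f))) (rres X V (D V f))" for f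
  define \<psi> where "\<psi> f = fraction_map (rres X V (D V f)) (msec M (D V f)) (mres M V (D V f))" for f
  let ?one = "\<one>\<^bsub>sec X V\<^esub>"
  have E: "E \<subseteq> carrier (sec X V)" by (auto simp: E_def)
  have gen: "?one \<in> genideal (sec X V) E"
    by (rule V.one_in_genideal[OF E]) (use cover in \<open>auto simp: E_def\<close>)
  have model: "localization_model X V f (msec M V) (\<theta> f) (msec M (D V f)) (\<psi> f)"
    and val: "\<psi> f (frac (sec X V) (powers (sec X V) f) (msec M V) s ?one) = mres M V (D V f) s"
    and img: "\<psi> f ` loc_image (sec X V) f (msec M V) (L V) = L (D V f)"
    if f: "f \<in> carrier (sec X V)" for f
  proof -
    interpret P: localized_pair "sec X V" "sec X (D V f)" "msec M V" "msec M (D V f)" "rres X V (D V f)" "mres M V (D V f)" f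
      by (rule localized_pair_D[OF V f])
    show "localization_model X V f (msec M V) (\<theta> f) (msec M (D V f)) (\<psi> f)"
      unfolding localization_model_def Let_def \<theta>_def \<psi>_def
      using P.ring_map_iso P.ring_map_one msec_module[OF D_open] P.fraction_map_semilinear by simp
    show "\<psi> f (frac (sec X V) (powers (sec X V) f) (msec M V) s ?one) = mres M V (D V f) s"
      unfolding \<psi>_def by (rule P.fraction_map_one[OF s])
    show "\<psi> f ` loc_image (sec X V) f (msec M V) (L V) = L (D V f)"
      unfolding \<psi>_def
      by (rule P.fraction_map_image[OF L_subset[OF oV] submodule_L[OF D_open]])
        (use mres_L[OF oV D_open D_subset] L_ext[OF V f] in auto)
  qed
  \<comment> \<open>\<open>glueable\<close> with its quantifiers removed. The models are functions
    of \<open>f\<close>, and the family of section modules over \<open>D V f\<close> is supplied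
    explicitly when this is applied.\<close>
  have gl: "affine_open X U \<and> E \<subseteq> carrier (sec X U) \<and>
        g \<in> carrier (sec X U) \<and> (\<exists>n::nat. g [^]\<^bsub>sec X U\<^esub> n \<in> genideal (sec X U) E) \<and>
        Module.module (sec X U) N0 \<and> submodule L0 (sec X U) N0 \<and> z \<in> carrier N0 \<and>
        (\<forall>f\<in>insert g E. localization_model X U f N0 (\<theta> f) (N f) (\<psi> f)) \<and>
        (\<forall>f\<in>E. \<psi> f (frac (sec X U) (powers (sec X U) f) N0 z \<one>\<^bsub>sec X U\<^esub>)
           \<in> cl (basic_open X U f) (N f) (\<psi> f ` loc_image (sec X U) f N0 L0)) \<longrightarrow>
        \<psi> g (frac (sec X U) (powers (sec X U) g) N0 z \<one>\<^bsub>sec X U\<^esub>)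
          \<in> cl (basic_open X U g) (N g) (\<psi> g ` loc_image (sec X U) g N0 L0)" for U E g N0 L0 z \<theta> N \<psi>
    using glue[unfolded glueable_def, THEN conjunct2, THEN spec, THEN spec, THEN spec, THEN spec,
        THEN spec, THEN spec, THEN spec, THEN spec, THEN spec] .
  have "\<psi> ?one (frac (sec X V) (powers (sec X V) ?one) (msec M V) s ?one)
      \<in> cl (D V ?one) (msec M (D V ?one)) (\<psi> ?one ` loc_image (sec X V) ?one (msec M V) (L V))"
  proof (rule gl[where N = "\<lambda>f. msec M (D V f)", THEN mp], intro conjI ballI)
    show "affine_open X V" "E \<subseteq> carrier (sec X V)" "?one \<in> carrier (sec X V)" by (auto simp: V E)
    show "\<exists>n::nat. ?one [^]\<^bsub>sec X V\<^esub> n \<in> genideal (sec X V) E" using gen by simp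
    show "Module.module (sec X V) (msec M V)" "submodule (L V) (sec X V) (msec M V)" "s \<in> carrier (msec M V)"
      by (rule msec_module[OF oV], rule submodule_L[OF oV], rule s)
    show "localization_model X V f (msec M V) (\<theta> f) (msec M (D V f)) (\<psi> f)" if "f \<in> insert ?one E" for f
      using model that E by blast
    show "\<psi> f (frac (sec X V) (powers (sec X V) f) (msec M V) s ?one)
      \<in> cl (D V f) (msec M (D V f)) (\<psi> f ` loc_image (sec X V) f (msec M V) (L V))" if "f \<in> E" for f
      using that val img by (simp add: E_def)
  qed
  then have "mres M V V s \<in> cl V (msec M V) (L V)"
    using val[OF V.R.one_closed] img[OF V.R.one_closed] D_one[OF oV] by simp
  then show ?thesis using mres_id[OF oV s] by simp
qed

section \<open>Affine values and uniqueness of the closure sheaf\<close>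

lemma closure_sheaf_iff:
  assumes U: "opn U" and s: "s \<in> carrier (msec M U)"
  shows "s \<in> closure_sheaf X cl M L U \<longleftrightarrow>
    (\<forall>V. affine_open X V \<and> V \<subseteq> U \<longrightarrow> mres M U V s \<in> cl V (msec M V) (L V))"
proof (intro iffI allI impI)
  fix V assume cs: "s \<in> closure_sheaf X cl M L U" and "affine_open X V \<and> V \<subseteq> U"
  then have V: "affine_open X V" "V \<subseteq> U" by auto
  note oV = opn_affine[OF V(1)]
  show "mres M U V s \<in> cl V (msec M V) (L V)"
  proof (rule glue_D[OF V(1) mres_closed[OF U oV V(2) s]])
    fix x assume x: "x \<in> V"
    then obtain W where W: "affine_open X W" "x \<in> W" "W \<subseteq> U" "mres M U W s \<in> cl W (msec M W) (L W)"
      using cs V(2) unfolding closure_sheaf_def by blast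
    note oW = opn_affine[OF W(1)]
    obtain f g where fg: "f \<in> carrier (sec X V)" "g \<in> carrier (sec X W)" "D V f = D W g" "x \<in> D V f"
      by (rule common_basic_open[OF affine[OF V(1)] affine[OF W(1)] x W(2)])
    have "mres M V (D V f) (mres M U V s) = mres M U (D V f) s"
      by (rule mres_comp[OF U oV D_open D_subset V(2) s])
    also have "\<dots> = mres M W (D W g) (mres M U W s)"
      unfolding fg(3) by (rule mres_comp[OF U oW D_open D_subset W(3) s, symmetric])
    finally have "mres M V (D V f) (mres M U V s) \<in> cl (D V f) (msec M (D V f)) (L (D V f))"
      using persistent_D[OF W(1) fg(2) W(4)] fg(3) by simp
    then show "\<exists>f\<in>carrier (sec X V). x \<in> D V f \<and>
      mres M V (D V f) (mres M U V s) \<in> cl (D V f) (msec M (D V f)) (L (D V f))" using fg by blast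
  qed
next
  assume a: "\<forall>V. affine_open X V \<and> V \<subseteq> U \<longrightarrow> mres M U V s \<in> cl V (msec M V) (L V)"
  have "\<exists>V. affine_open X V \<and> x \<in> V \<and> V \<subseteq> U \<and> mres M U V s \<in> cl V (msec M V) (L V)" if x: "x \<in> U" for x
    using affine_base[OF U x] a by metis
  then show "s \<in> closure_sheaf X cl M L U" using s by (simp add: closure_sheaf_def)
qed

text \<open>\<open>V\<close> is an affine neighborhood of each of its points, which gives one
  inclusion; the other is the criterion at \<open>V\<close> itself.\<close>

lemma closure_sheaf_affine:
  assumes V: "affine_open X V"
  shows "closure_sheaf X cl M L V = cl V (msec M V) (L V)"
proof (intro equalityI subsetI)
  note oV = opn_affine[OF V]
  fix s assume s: "s \<in> closure_sheaf X cl M L V"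
  then have sM: "s \<in> carrier (msec M V)" by (simp add: closure_sheaf_def)
  then show "s \<in> cl V (msec M V) (L V)"
    using closure_sheaf_iff[OF oV sM] s V mres_id[OF oV sM] by fastforce
next
  note oV = opn_affine[OF V]
  fix s assume s: "s \<in> cl V (msec M V) (L V)"
  then have sM: "s \<in> carrier (msec M V)" using cl_subset[OF V] by blast
  then show "s \<in> closure_sheaf X cl M L V"
    unfolding closure_sheaf_def using V s mres_id[OF oV sM] by fastforce
qed

text \<open>A section \<open>s\<close> of the closure sheaf restricts into \<open>F V\<close> for
  every affine \<open>V\<close> inside \<open>U\<close>. These restrictions glue in
  \<open>F\<close>, and the result is \<open>s\<close> because \<open>M\<close> is a sheaf and
  affine open sets cover \<open>U\<close>. The other inclusion is the criterion by affine open sets,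
  which restriction in \<open>F\<close> verifies.\<close>

lemma closure_sheaf_unique:
  assumes F: "subsheaf X M F" and Fcl: "\<And>V. affine_open X V \<Longrightarrow> F V = cl V (msec M V) (L V)"
    and U: "opn U"
  shows "F U = closure_sheaf X cl M L U"
proof (intro equalityI subsetI)
  have FM: "F W \<subseteq> carrier (msec M W)" if "opn W" for W using F that by (simp add: subsheaf_def)
  have sh: "is_sheaf (top_of X) F (mres M)" using F by (simp add: subsheaf_def)
  {
    fix s assume s: "s \<in> F U"
    have "mres M U V s \<in> cl V (msec M V) (L V)" if "affine_open X V" "V \<subseteq> U" for V
      using is_sheaf_closed[OF sh U opn_affine[OF that(1)] that(2) s] Fcl[OF that(1)] by simp
    then show "s \<in> closure_sheaf X cl M L U" using closure_sheaf_iff[OF U] FM[OF U] s by blast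
  }
  fix s assume s: "s \<in> closure_sheaf X cl M L U"
  then have sM: "s \<in> carrier (msec M U)" by (simp add: closure_sheaf_def)
  define I where "I = {V. affine_open X V \<and> V \<subseteq> U}"
  have I: "opn V" "V \<subseteq> U" "affine_open X V" if "V \<in> I" for V
    using that opn_affine by (auto simp: I_def)
  have un: "U = (\<Union>V\<in>I. V)"
  proof
    show "U \<subseteq> (\<Union>V\<in>I. V)"
    proof
      fix x assume "x \<in> U"
      then obtain V where "affine_open X V" "x \<in> V" "V \<subseteq> U" by (rule affine_base[OF U])
      then show "x \<in> (\<Union>V\<in>I. V)" by (auto simp: I_def)
    qed
  qed (auto simp: I_def)
  have "\<exists>!t. t \<in> F (\<Union>V\<in>I. V) \<and> (\<forall>V\<in>I. mres M (\<Union>V\<in>I. V) V t = mres M U V s)"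
  proof (rule is_sheaf_glue[OF sh])
    show "opn V" "mres M U V s \<in> F V" if "V \<in> I" for V
      using I[OF that] closure_sheaf_iff[OF U sM] s Fcl by auto
    fix V W assume V: "V \<in> I" and W: "W \<in> I"
    have "opn (V \<inter> W)" using I[OF V] I[OF W] by blast
    then show "mres M V (V \<inter> W) (mres M U V s) = mres M W (V \<inter> W) (mres M U W s)"
      using mres_comp[OF U I(1)[OF V] _ _ I(2)[OF V] sM] mres_comp[OF U I(1)[OF W] _ _ I(2)[OF W] sM] by simp
  qed
  then obtain t where t: "t \<in> F U" "\<And>V. V \<in> I \<Longrightarrow> mres M U V t = mres M U V s"
    unfolding un[symmetric] by blast
  have "t = s"
    by (rule is_sheaf_unique[OF msec_sheaf I(1) un _ sM t(2)]) (use t(1) FM[OF U] in auto)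
  then show "s \<in> F U" using t(1) by simp
qed

end

theorem theorem2p5:
  fixes X :: "('x, 'r) ringed_space"
    and cl :: "('x, 'r, 'm) module_closure"
    and M :: "('x, 'r, 'm) module_sheaf"
    and L :: "'x set \<Rightarrow> 'm set"
  assumes "scheme X"
    and "preclosure_operation X cl"
    and "glueable X cl"
    and "quasi_coherent X M"
    and "quasi_coherent_submodule X M L"
  shows "(\<forall>U s. openin (top_of X) U \<and> s \<in> carrier (msec M U) \<longrightarrow>
            (s \<in> closure_sheaf X cl M L U \<longleftrightarrow>
             (\<forall>V. affine_open X V \<and> V \<subseteq> U \<longrightarrow> mres M U V s \<in> cl V (msec M V) (L V)))) \<and>
         (\<forall>V. affine_open X V \<longrightarrow> closure_sheaf X cl M L V = cl V (msec M V) (L V)) \<and>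
         (\<forall>F. subsheaf X M F \<and> (\<forall>V. affine_open X V \<longrightarrow> F V = cl V (msec M V) (L V)) \<longrightarrow>
            (\<forall>U. openin (top_of X) U \<longrightarrow> F U = closure_sheaf X cl M L U))"
proof -
  interpret closure_setting X cl M L using assms by (rule closure_setting.intro)
  show ?thesis
  proof (intro conjI allI impI)
    fix U s assume "opn U \<and> s \<in> carrier (msec M U)"
    then show "s \<in> closure_sheaf X cl M L U \<longleftrightarrow>
      (\<forall>V. affine_open X V \<and> V \<subseteq> U \<longrightarrow> mres M U V s \<in> cl V (msec M V) (L V))"
      by (intro closure_sheaf_iff) simp_all
  next
    fix V assume "affine_open X V"
    then show "closure_sheaf X cl M L V = cl V (msec M V) (L V)" by (rule closure_sheaf_affine)
  next
    fix F U
    assume "subsheaf X M F \<and> (\<forall>V. affine_open X V \<longrightarrow> F V = cl V (msec M V) (L V))" "opn U"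
    then show "F U = closure_sheaf X cl M L U" by (intro closure_sheaf_unique) simp_all
  qed
qed

end
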